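(* Let $(M,\omega)$ be a symplectic manifold, let $N\ge 4$, and let $X_1,\dots,X_N\subset M$ be compact sets intersecting cyclically. Then \[ \mathrm{Pb}_N(X_1,\dots,X_N)=\mathrm{Pb}_{N-1}(X_1,\dots,X_{N-2},X_{N-1}\cup X_N). \]
   Context: $\{\cdot,\cdot\}$ is the Poisson bracket of $(M,\omega)$ and $\|\cdot\|$ the supremum norm over $M$. A datum $\mathbf\Delta=(\Delta,p_1,\dots,p_N)$ consists of a compact convex set $\Delta\subset\mathbb R^2$ of area $1$ whose boundary is either smooth or polygonal, and points $p_1,\dots,p_N\in\partial\Delta$ ordered cyclically counterclockwise; $\gamma_i$ is the closed arc of $\partial\Delta$ going counterclockwise from $p_i$ to $p_{i+1}$ (indices mod $N$). A smooth map $\Phi=(\Phi_1,\Phi_2):M\to\Delta$ satisfies condition (CS) if there is $(a,b)\in\Delta$ with $\Phi_1-a$ and $\Phi_2-b$ compactly supported (automatic if $M$ is compact). For compact $X_1,\dots,X_N\subset M$, $\mathcal F'_{\mathbf\Delta,N}(X_1,\dots,X_N)$ is the set of smooth $\Phi:M\to\Delta$ satisfying (CS) such that for every $i$ there is an open $U_i\supset X_i$ with $\Phi(U_i)\subseteq\gamma_i$, and $\mathrm{Pb}^{\mathbf\Delta}_N(X_1,\dots,X_N):=\inf_{\Phi\in\mathcal F'_{\mathbf\Delta,N}}\|\{\Phi_1,\Phi_2\}\|$ (infimum of the empty set is $+\infty$). This quantity is independent of the datum $\mathbf\Delta$ and is denoted $\mathrm{Pb}_N(X_1,\dots,X_N)$.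 Sets $X_1,\dots,X_N$ intersect cyclically if $X_i\cap X_j=\emptyset$ whenever $i\notin\{j-1,j,j+1\}$, indices computed mod $N$. *)

theory Defs
  imports "HOL-Analysis.Analysis"
begin

text \<open>A real function is smooth on an open set U if it is differentiable there and all its
  partial derivatives are again smooth (greatest fixed point = derivatives of all orders exist).\<close>
coinductive smooth_on :: "'e::euclidean_space set \<Rightarrow> ('e \<Rightarrow> real) \<Rightarrow> bool" for U where
  "f differentiable_on U \<Longrightarrow>
   (\<forall>b\<in>Basis. smooth_on U (\<lambda>x. frechet_derivative f (at x) b)) \<Longrightarrow> smooth_on U f"

definition smooth_map_on :: "'e::euclidean_space set \<Rightarrow> ('e \<Rightarrow> 'f::euclidean_space) \<Rightarrow> bool" where
  "smooth_map_on U g \<longleftrightarrow> (\<forall>b\<in>Basis. smooth_on U (\<lambda>x. g x \<bullet> b))"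

type_synonym ('a,'e) chart = "'a set \<times> ('a \<Rightarrow> 'e)"

definition transition :: "('a,'e) chart \<Rightarrow> ('a,'e::euclidean_space) chart \<Rightarrow> 'e \<Rightarrow> 'e" where
  "transition c d = snd d \<circ> inv_into (fst c \<inter> fst d) (snd c)"

text \<open>T: topology of M; A: smooth atlas with charts onto open subsets of the model space 'e;
  om c y: the symplectic form written in chart c at the coordinate point y
  (a bilinear form on the model space).\<close>
definition symplectic_manifold ::
  "'a topology \<Rightarrow> ('a,'e::euclidean_space) chart set \<Rightarrow> (('a,'e) chart \<Rightarrow> 'e \<Rightarrow> 'e \<Rightarrow> 'e \<Rightarrow> real) \<Rightarrow> bool"
where
  "symplectic_manifold T A om \<longleftrightarrow>
     Hausdorff_space T \<and> second_countable T \<and>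
     topspace T = (\<Union>c\<in>A. fst c) \<and>
     (\<forall>(U,\<phi>)\<in>A. openin T U \<and> open (\<phi> ` U) \<and>
                   homeomorphic_map (subtopology T U) (top_of_set (\<phi> ` U)) \<phi>) \<and>
     (\<forall>c\<in>A. \<forall>d\<in>A. smooth_map_on (snd c ` (fst c \<inter> fst d)) (transition c d)) \<and>
     (\<forall>c\<in>A. \<forall>y\<in>snd c ` fst c.
        bilinear (om c y) \<and>
        (\<forall>v w. om c y v w = - om c y w v) \<and>
        (\<forall>v. v \<noteq> 0 \<longrightarrow> (\<exists>w. om c y v w \<noteq> 0))) \<and>
     (\<forall>c\<in>A. \<forall>i\<in>Basis. \<forall>j\<in>Basis. smooth_on (snd c ` fst c) (\<lambda>y. om c y i j)) \<and>
     (\<forall>c\<in>A. \<forall>y\<in>snd c ` fst c. \<forall>i\<in>Basis. \<forall>j\<in>Basis. \<forall>k\<in>Basis.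
        frechet_derivative (\<lambda>z. om c z j k) (at y) i
      + frechet_derivative (\<lambda>z. om c z k i) (at y) j
      + frechet_derivative (\<lambda>z. om c z i j) (at y) k = 0) \<and>
     (\<forall>c\<in>A. \<forall>d\<in>A. \<forall>x\<in>fst c \<inter> fst d. \<forall>v w.
        om c (snd c x) v w =
        om d (snd d x) (frechet_derivative (transition c d) (at (snd c x)) v)
                       (frechet_derivative (transition c d) (at (snd c x)) w))"

definition smooth_fun :: "'a topology \<Rightarrow> ('a,'e::euclidean_space) chart set \<Rightarrow> ('a \<Rightarrow> real) \<Rightarrow> bool" where
  "smooth_fun T A f \<longleftrightarrow> (\<forall>(U,\<phi>)\<in>A. smooth_on (\<phi> ` U) (f \<circ> inv_into U \<phi>))"

definition ham_vec :: "('e \<Rightarrow> 'e \<Rightarrow> real) \<Rightarrow> ('e \<Rightarrow> real) \<Rightarrow> 'e" where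
  "ham_vec w df = (THE v. \<forall>u. w v u = df u)"

definition poisson ::
  "('a,'e::euclidean_space) chart set \<Rightarrow> (('a,'e) chart \<Rightarrow> 'e \<Rightarrow> 'e \<Rightarrow> 'e \<Rightarrow> real)
   \<Rightarrow> ('a \<Rightarrow> real) \<Rightarrow> ('a \<Rightarrow> real) \<Rightarrow> 'a \<Rightarrow> real" where
  "poisson A om f g x =
     (let c = (SOME c. c \<in> A \<and> x \<in> fst c); y = snd c x;
          df = frechet_derivative (f \<circ> inv_into (fst c) (snd c)) (at y);
          dg = frechet_derivative (g \<circ> inv_into (fst c) (snd c)) (at y)
      in om c y (ham_vec (om c y) df) (ham_vec (om c y) dg))"

definition smooth_boundary :: "complex set \<Rightarrow> bool" where
  "smooth_boundary D \<longleftrightarrow> (\<exists>\<gamma>::real \<Rightarrow> complex.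
      smooth_map_on UNIV \<gamma> \<and> (\<forall>t. \<gamma> (t + 1) = \<gamma> t) \<and>
      (\<forall>t. vector_derivative \<gamma> (at t) \<noteq> 0) \<and> inj_on \<gamma> {0..<1} \<and>
      \<gamma> ` {0..1} = frontier D)"

text \<open>Closed counterclockwise arc of the boundary of D from a to b, measured in angle around
  an interior point cc (the arcs do not depend on the choice of cc).\<close>
definition ccw_arc :: "complex set \<Rightarrow> complex \<Rightarrow> complex \<Rightarrow> complex \<Rightarrow> complex set" where
  "ccw_arc D cc a b =
     {z \<in> frontier D. Arg2pi ((z - cc) / (a - cc)) \<le> Arg2pi ((b - cc) / (a - cc))}"

definition datum :: "complex set \<Rightarrow> complex \<Rightarrow> nat \<Rightarrow> (nat \<Rightarrow> complex) \<Rightarrow> bool" where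
  "datum D cc N p \<longleftrightarrow>
     compact D \<and> convex D \<and> emeasure lborel D = 1 \<and>
     (smooth_boundary D \<or> polytope D) \<and> cc \<in> interior D \<and>
     (\<forall>i<N. p i \<in> frontier D) \<and>
     strict_mono_on {0..<N} (\<lambda>i. Arg2pi ((p i - cc) / (p 0 - cc)))"

definition arc :: "complex set \<Rightarrow> complex \<Rightarrow> nat \<Rightarrow> (nat \<Rightarrow> complex) \<Rightarrow> nat \<Rightarrow> complex set" where
  "arc D cc N p i = ccw_arc D cc (p i) (p (Suc i mod N))"

definition FPb ::
  "'a topology \<Rightarrow> ('a,'e::euclidean_space) chart set \<Rightarrow> complex set \<Rightarrow> complex \<Rightarrow> nat
   \<Rightarrow> (nat \<Rightarrow> complex) \<Rightarrow> (nat \<Rightarrow> 'a set) \<Rightarrow> ('a \<Rightarrow> complex) set" where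
  "FPb T A D cc N p X =
     {\<Phi>. smooth_fun T A (\<lambda>x. Re (\<Phi> x)) \<and> smooth_fun T A (\<lambda>x. Im (\<Phi> x)) \<and>
          \<Phi> ` topspace T \<subseteq> D \<and>
          (\<exists>z\<in>D. \<exists>K. compactin T K \<and> (\<forall>x\<in>topspace T - K. \<Phi> x = z)) \<and>
          (\<forall>i<N. \<exists>U. openin T U \<and> X i \<subseteq> U \<and> \<Phi> ` U \<subseteq> arc D cc N p i)}"

definition Pb ::
  "'a topology \<Rightarrow> ('a,'e::euclidean_space) chart set \<Rightarrow> (('a,'e) chart \<Rightarrow> 'e \<Rightarrow> 'e \<Rightarrow> 'e \<Rightarrow> real)
   \<Rightarrow> complex set \<Rightarrow> complex \<Rightarrow> nat \<Rightarrow> (nat \<Rightarrow> complex) \<Rightarrow> (nat \<Rightarrow> 'a set) \<Rightarrow> ennreal" where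
  "Pb T A om D cc N p X =
     (INF \<Phi>\<in>FPb T A D cc N p X.
        SUP x\<in>topspace T. ennreal \<bar>poisson A om (\<lambda>x. Re (\<Phi> x)) (\<lambda>x. Im (\<Phi> x)) x\<bar>)"

definition intersect_cyclically :: "nat \<Rightarrow> (nat \<Rightarrow> 'a set) \<Rightarrow> bool" where
  "intersect_cyclically N X \<longleftrightarrow>
     (\<forall>i<N. \<forall>j<N. i \<noteq> j \<and> i \<noteq> Suc j mod N \<and> j \<noteq> Suc i mod N \<longrightarrow> X i \<inter> X j = {})"

end

theory Submission
  imports Defs "HOL-Complex_Analysis.Complex_Analysis"
begin

text \<open>Independence of the datum. Composing \<open>\<Phi>\<close> with a smooth plane map \<open>\<Psi>\<close> multiplies the bracket by
  the Jacobian of \<open>\<Psi>\<close>, so it suffices to map one convex disc of area 1 into another, arcs into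
  arcs, with Jacobian at most \<open>1 + \<epsilon>\<close>. In polar coordinates such a map is \<open>(r, t) \<mapsto> (k(r), \<tau>(r, t))\<close>,
  where \<open>r\<close> and \<open>k\<close> measure the distance from the centre relative to the boundary. In the bulk
  \<open>\<tau>\<close> equalises the areas of sectors. In a collar, \<open>k = 1\<close>: the image lies in the boundary curve, the
  Jacobian vanishes whatever \<open>\<tau>\<close> is, and \<open>\<tau>\<close> can be moved for free to a reparametrization that
  matches the marked points. Smoothness at the corners of the target is obtained by letting
  the boundary parametrization stop there, smoothness at the centre by letting \<open>k = 0\<close> near it.

  Splitting an arc. Take as datum the square, with the arc to be split equal to an edge from \<open>a\<close> to \<open>b\<close>.
  Near \<open>X\<^bsub>N-1\<^esub> \<union> X\<^bsub>N\<^esub>\<close> the map \<open>\<Phi>\<close> takes values in this edge, so the bracket vanishes there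
  and \<open>\<Phi>\<close> may be moved inside the edge with the help of two cut-off functions, so that \<open>X\<^bsub>N-1\<^esub>\<close> goes to
  the first half and \<open>X\<^bsub>N\<^esub>\<close> to the second. Cyclic intersection keeps the cut-offs away
  from \<open>X\<^bsub>1\<^esub>\<close> and \<open>X\<^bsub>N-2\<^esub>\<close>, respectively.\<close>

subsection \<open>Smooth functions\<close>

text \<open>The two data of the statement are unrelated and the square is a third one, so both
  inequalities become chains of comparisons between infima. For such a comparison only two
  properties of the plane map count: arcs go into arcs, and the absolute Jacobian is at most 1 +
  \<epsilon>. The map may therefore be constant near the centre and collapse a collar onto the
  boundary curve, which a diffeomorphism could not do. The source boundary enters only through a
  smooth function slightly below its radius, so corners are an obstacle on the target side alone.
  There a piecewise smooth radius treats polygons and smooth convex curves alike. Splitting gives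
  one inequality. The other one comes from merging: dropping the marked point between the last two
  arcs of the N-datum joins them, and a map admissible for N sets stays admissible for N - 1, the
  union of the two neighbourhoods serving for the union of the two sets.\<close>

primrec Ck :: "nat \<Rightarrow> 'e::euclidean_space set \<Rightarrow> ('e \<Rightarrow> real) \<Rightarrow> bool" where
  "Ck 0 U f \<longleftrightarrow> True"
| "Ck (Suc k) U f \<longleftrightarrow> f differentiable_on U \<and>
     (\<forall>b\<in>Basis. Ck k U (\<lambda>x. frechet_derivative f (at x) b))"

text \<open>The derivative of a product or a composition is a sum of products, so closure properties
  are awkward by direct coinduction. With the order k made explicit they follow by induction on
  k.\<close>

lemma smooth_on_iff_Ck: "smooth_on U f \<longleftrightarrow> (\<forall>k. Ck k U f)"
proof
  assume "smooth_on U f"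
  moreover have "smooth_on U f \<Longrightarrow> Ck k U f" for k
  proof (induction k arbitrary: f)
    case (Suc k)
    from Suc.prems show ?case
      by (cases rule: smooth_on.cases) (auto intro: Suc.IH)
  qed simp
  ultimately show "\<forall>k. Ck k U f" by blast
next
  assume "\<forall>k. Ck k U f"
  then show "smooth_on U f"
  proof (coinduction arbitrary: f)
    case smooth_on
    then show ?case
      by (metis Ck.simps(2))
  qed
qed

lemma smooth_onD:
  assumes "smooth_on U f"
  shows "f differentiable_on U"
    and "b \<in> Basis \<Longrightarrow> smooth_on U (\<lambda>x. frechet_derivative f (at x) b)"
proof -
  from assms show "f differentiable_on U" by (cases rule: smooth_on.cases)
  from assms show "b \<in> Basis \<Longrightarrow> smooth_on U (\<lambda>x. frechet_derivative f (at x) b)"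
    by (cases rule: smooth_on.cases) blast
qed

lemma smooth_on_differentiable:
  assumes "smooth_on U f" "open U" "x \<in> U"
  shows "f differentiable (at x)"
  using assms by (metis differentiable_on_eq_differentiable_at smooth_onD(1))

lemma frechet_derivative_cong_open:
  assumes "open U" "x \<in> U" "\<And>y. y \<in> U \<Longrightarrow> f y = g y"
  shows "frechet_derivative f (at x) = frechet_derivative g (at x)"
proof -
  have "(f has_derivative D) (at x) \<longleftrightarrow> (g has_derivative D) (at x)" for D
    using assms has_derivative_transform_within_open[of f D x UNIV U g]
      has_derivative_transform_within_open[of g D x UNIV U f] by auto
  then show ?thesis by (simp add: frechet_derivative_def)
qed

lemma Ck_cong:
  assumes "open U" "\<And>y. y \<in> U \<Longrightarrow> f y = g y" "Ck k U f"
  shows "Ck k U g"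
  using assms(2,3)
proof (induction k arbitrary: f g)
  case (Suc k)
  have "g differentiable_on U"
    using Suc.prems by (simp add: differentiable_on_def) (metis differentiable_transform_within zero_less_one)
  moreover have "Ck k U (\<lambda>x. frechet_derivative g (at x) b)" if "b \<in> Basis" for b
  proof (rule Suc.IH)
    show "frechet_derivative f (at y) b = frechet_derivative g (at y) b" if "y \<in> U" for y
      using frechet_derivative_cong_open[OF assms(1) that, of f g] Suc.prems(1) by metis
  qed (use that Suc.prems(2) in auto)
  ultimately show ?case by simp
qed simp

lemma Ck_Suc_imp: "Ck (Suc k) U f \<Longrightarrow> Ck k U f"
  by (induction k arbitrary: f) auto

lemma Ck_subset:
  assumes "V \<subseteq> U" "Ck k U f" shows "Ck k V f"
  using assms(2) by (induction k arbitrary: f) (use assms(1) differentiable_on_subset in auto)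

lemma Ck_SucI:
  assumes "open U" "\<And>x. x \<in> U \<Longrightarrow> (f has_derivative D x) (at x)"
    and "\<And>b. b \<in> Basis \<Longrightarrow> Ck k U (\<lambda>x. D x b)"
  shows "Ck (Suc k) U f"
proof -
  have "f differentiable_on U"
    using assms(2) by (meson differentiableI differentiable_at_imp_differentiable_on)
  moreover have "Ck k U (\<lambda>x. frechet_derivative f (at x) b)" if "b \<in> Basis" for b
    by (rule Ck_cong[OF assms(1) _ assms(3)[OF that]])
       (metis assms(2) frechet_derivative_at)
  ultimately show ?thesis by simp
qed

lemma Ck_SucD:
  assumes "open U" "Ck (Suc k) U f" "x \<in> U"
  shows "(f has_derivative frechet_derivative f (at x)) (at x)"
  using assms by (metis Ck.simps(2) differentiable_on_eq_differentiable_at frechet_derivative_works)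

lemma Ck_local:
  assumes "\<And>x. x \<in> U \<Longrightarrow> \<exists>V. open V \<and> x \<in> V \<and> Ck k V f"
  shows "Ck k U f"
  using assms
proof (induction k arbitrary: f)
  case (Suc k)
  have "f differentiable_on U"
    unfolding differentiable_on_def
  proof
    fix x assume "x \<in> U"
    then obtain V where V: "open V" "x \<in> V" "Ck (Suc k) V f" using Suc.prems by blast
    then show "f differentiable at x within U"
      by (meson Ck_SucD differentiableI differentiable_at_withinI)
  qed
  moreover have "Ck k U (\<lambda>x. frechet_derivative f (at x) b)" if "b \<in> Basis" for b
    by (rule Suc.IH) (use Suc.prems that in auto)
  ultimately show ?case by simp
qed simp

lemma Ck_const: "Ck k U (\<lambda>x. c)"
proof (induction k arbitrary: c)
  case (Suc k)
  then show ?case by (auto simp: frechet_derivative_const)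
qed simp

lemma Ck_add:
  assumes "open U" "Ck k U f" "Ck k U g" shows "Ck k U (\<lambda>x. f x + g x)"
  using assms(2,3)
proof (induction k arbitrary: f g)
  case (Suc k)
  show ?case
    by (rule Ck_SucI[OF assms(1), where
          D="\<lambda>x h. frechet_derivative f (at x) h + frechet_derivative g (at x) h"])
       (use Suc assms(1) in \<open>auto intro!: has_derivative_add Ck_SucD Suc.IH\<close>)
qed simp

lemma Ck_mult:
  assumes "open U" "Ck k U f" "Ck k U g" shows "Ck k U (\<lambda>x. f x * g x)"
  using assms(2,3)
proof (induction k arbitrary: f g)
  case (Suc k)
  note Ck_SucD[OF assms(1) Suc.prems(1)] Ck_SucD[OF assms(1) Suc.prems(2)]
  note D = has_derivative_mult[OF this]
  have "Ck k U (\<lambda>x. f x * frechet_derivative g (at x) b + frechet_derivative f (at x) b * g x)"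
    if "b \<in> Basis" for b
    using Suc.prems that Ck_Suc_imp[OF Suc.prems(1)] Ck_Suc_imp[OF Suc.prems(2)]
    by (intro Ck_add assms(1) Suc.IH) auto
  then show ?case
    using D by (intro Ck_SucI[OF assms(1)]) auto
qed simp

lemma Ck_sum:
  assumes "open U" "\<And>i. i \<in> I \<Longrightarrow> Ck k U (f i)" shows "Ck k U (\<lambda>x. \<Sum>i\<in>I. f i x)"
  using assms(2) by (induction I rule: infinite_finite_induct) (auto intro: Ck_const Ck_add assms(1))

lemma Ck_compose:
  fixes f :: "'f::euclidean_space \<Rightarrow> real" and g :: "'e::euclidean_space \<Rightarrow> 'f"
  assumes "open U" "open V" "g ` U \<subseteq> V"
    and "Ck k V f" "\<And>c. c \<in> Basis \<Longrightarrow> Ck k U (\<lambda>x. g x \<bullet> c)"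
  shows "Ck k U (\<lambda>x. f (g x))"
  using assms(4,5)
proof (induction k arbitrary: f)
  case (Suc k)
  define dg where "dg x h = (\<Sum>c\<in>Basis. frechet_derivative (\<lambda>x. g x \<bullet> c) (at x) h *\<^sub>R c)" for x h
  have dg: "(g has_derivative dg x) (at x)" if "x \<in> U" for x
    using Ck_SucD[OF assms(1) Suc.prems(2) that]
    by (subst has_derivative_componentwise_within) (auto simp: dg_def inner_sum_left inner_Basis if_distrib cong: if_cong)
  have df: "(f has_derivative frechet_derivative f (at (g x))) (at (g x))" if "x \<in> U" for x
    using Ck_SucD[OF assms(2) Suc.prems(1)] that assms(3) by blast
  have D: "((\<lambda>x. f (g x)) has_derivative (\<lambda>h. frechet_derivative f (at (g x)) (dg x h))) (at x)"
    if "x \<in> U" for x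
    using has_derivative_compose[OF dg df] that by blast
  have lin: "frechet_derivative f (at (g x)) (dg x b) =
     (\<Sum>c\<in>Basis. frechet_derivative (\<lambda>x. g x \<bullet> c) (at x) b * frechet_derivative f (at (g x)) c)"
    if "x \<in> U" for x b
    using has_derivative_bounded_linear[OF df[OF that]]
    by (simp add: dg_def bounded_linear.linear linear_sum linear_scale)
  have "Ck k U (\<lambda>x. \<Sum>c\<in>Basis. frechet_derivative (\<lambda>x. g x \<bullet> c) (at x) b * frechet_derivative f (at (g x)) c)"
    if "b \<in> Basis" for b
  proof (intro Ck_sum Ck_mult assms(1))
    fix c :: 'f assume c: "c \<in> Basis"
    show "Ck k U (\<lambda>x. frechet_derivative (\<lambda>x. g x \<bullet> c) (at x) b)"
      using Suc.prems(2)[OF c] that by simp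
    show "Ck k U (\<lambda>x. frechet_derivative f (at (g x)) c)"
      by (rule Suc.IH[of "\<lambda>y. frechet_derivative f (at y) c"])
        (use Suc.prems(1) c in \<open>simp\<close>, erule Ck_Suc_imp[OF Suc.prems(2)])
  qed
  note S = this
  have "Ck k U (\<lambda>x. frechet_derivative f (at (g x)) (dg x b))" if "b \<in> Basis" for b
    by (rule Ck_cong[OF assms(1) _ S[OF that]]) (simp add: lin)
  with D show ?case by (rule Ck_SucI[OF assms(1)])
qed simp

section \<open>Closure properties of smooth functions\<close>

lemma smooth_on_cong:
  "\<lbrakk>open U; \<And>y. y \<in> U \<Longrightarrow> f y = g y; smooth_on U f\<rbrakk> \<Longrightarrow> smooth_on U g"
  unfolding smooth_on_iff_Ck using Ck_cong by blast

lemma smooth_on_subset: "\<lbrakk>smooth_on U f; V \<subseteq> U\<rbrakk> \<Longrightarrow> smooth_on V f"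
  unfolding smooth_on_iff_Ck using Ck_subset by blast

lemma smooth_on_local:
  assumes "\<And>x. x \<in> U \<Longrightarrow> \<exists>V g. open V \<and> x \<in> V \<and> smooth_on V g \<and> (\<forall>y\<in>V. f y = g y)"
  shows "smooth_on U f"
  unfolding smooth_on_iff_Ck
proof (intro allI Ck_local)
  fix k x assume "x \<in> U"
  then obtain V g where V: "open V" "x \<in> V" "smooth_on V g" "\<forall>y\<in>V. f y = g y"
    using assms by blast
  then have "smooth_on V f" using smooth_on_cong[of V g f] by metis
  with V show "\<exists>V. open V \<and> x \<in> V \<and> Ck k V f" unfolding smooth_on_iff_Ck by blast
qed

named_theorems smooth_intros

lemma smooth_on_const [smooth_intros]: "smooth_on U (\<lambda>x. c)"
  unfolding smooth_on_iff_Ck using Ck_const by blast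

lemma smooth_on_add [smooth_intros]:
  "\<lbrakk>open U; smooth_on U f; smooth_on U g\<rbrakk> \<Longrightarrow> smooth_on U (\<lambda>x. f x + g x)"
  unfolding smooth_on_iff_Ck by (intro allI Ck_add) auto

lemma smooth_on_mult [smooth_intros]:
  "\<lbrakk>open U; smooth_on U f; smooth_on U g\<rbrakk> \<Longrightarrow> smooth_on U (\<lambda>x. f x * g x)"
  unfolding smooth_on_iff_Ck by (intro allI Ck_mult) auto

lemma smooth_on_sum [smooth_intros]:
  "\<lbrakk>open U; \<And>i. i \<in> I \<Longrightarrow> smooth_on U (f i)\<rbrakk> \<Longrightarrow> smooth_on U (\<lambda>x. \<Sum>i\<in>I. f i x)"
  unfolding smooth_on_iff_Ck by (intro allI Ck_sum) auto

lemma smooth_on_minus [smooth_intros]: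
  "\<lbrakk>open U; smooth_on U f\<rbrakk> \<Longrightarrow> smooth_on U (\<lambda>x. - f x)"
  using smooth_on_mult[of U "\<lambda>_. -1" f] smooth_on_const[of U "-1"] by simp

lemma smooth_on_diff [smooth_intros]:
  "\<lbrakk>open U; smooth_on U f; smooth_on U g\<rbrakk> \<Longrightarrow> smooth_on U (\<lambda>x. f x - g x)"
  using smooth_on_add[of U f "\<lambda>x. - g x"] smooth_on_minus[of U g] by simp

lemma smooth_on_power [smooth_intros]:
  "\<lbrakk>open U; smooth_on U f\<rbrakk> \<Longrightarrow> smooth_on U (\<lambda>x. f x ^ n)"
  by (induction n) (auto intro: smooth_intros)

lemma smooth_on_compose_map:
  assumes "open U" "open V" "g ` U \<subseteq> V" "smooth_on V f" "smooth_map_on U g"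
  shows "smooth_on U (\<lambda>x. f (g x))"
  using assms unfolding smooth_map_on_def smooth_on_iff_Ck
  by (intro allI Ck_compose[of U V g _ f]) auto

lemma smooth_on_compose:
  fixes f :: "real \<Rightarrow> real"
  assumes "smooth_on V f" "smooth_on U g" "open U" "open V" "g ` U \<subseteq> V"
  shows "smooth_on U (\<lambda>x. f (g x))"
  using assms by (intro smooth_on_compose_map[of U V g f]) (auto simp: smooth_map_on_def)

lemma smooth_on_compose_UNIV:
  fixes f :: "real \<Rightarrow> real"
  assumes "smooth_on UNIV f" "smooth_on U g" "open U"
  shows "smooth_on U (\<lambda>x. f (g x))"
  using assms by (intro smooth_on_compose[of UNIV f U g]) auto

lemma smooth_on_linear:
  assumes "bounded_linear f" shows "smooth_on U f"
proof -
  have "smooth_on UNIV f"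
    unfolding smooth_on_iff_Ck
  proof
    fix k show "Ck k UNIV f"
      by (cases k; simp only: Ck.simps(1); intro Ck_SucI[where D="\<lambda>_. f"])
        (auto intro: Ck_const bounded_linear_imp_has_derivative assms)
  qed
  then show ?thesis using smooth_on_subset by blast
qed

lemma smooth_on_basic [smooth_intros]:
  "smooth_on U1 (\<lambda>x::real. x)" "smooth_on U2 (\<lambda>x. x \<bullet> a)" "smooth_on U2 (\<lambda>x. a \<bullet> x)"
  "smooth_on U3 Re" "smooth_on U3 Im"
  by (auto intro!: smooth_on_linear bounded_linear_ident bounded_linear_inner_left
      bounded_linear_inner_right bounded_linear_Re bounded_linear_Im)

lemma smooth_map_on_complex_iff:
  "smooth_map_on U g \<longleftrightarrow> smooth_on U (\<lambda>x. Re (g x)) \<and> smooth_on U (\<lambda>x. Im (g x))"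
  by (auto simp: smooth_map_on_def Basis_complex_def inner_complex_def)

text \<open>Every derivative stays in the linear span of the family, so the induction on the order
  closes for all members at once. The exponential, sine and cosine, the powers of the inverse and
  the functions \<open>flat n\<close> are handled this way.\<close>

lemma smooth_on_family:
  fixes f :: "'i \<Rightarrow> real \<Rightarrow> real"
  assumes "open U"
    and "\<And>i. i \<in> I \<Longrightarrow> \<exists>J c. finite J \<and> J \<subseteq> I \<and>
        (\<forall>x\<in>U. (f i has_real_derivative (\<Sum>j\<in>J. c j * f j x)) (at x))"
    and "i \<in> I"
  shows "smooth_on U (f i)"
  unfolding smooth_on_iff_Ck
proof
  fix k show "Ck k U (f i)"
    using assms(3)
  proof (induction k arbitrary: i)
    case (Suc k)
    obtain J c where J: "finite J" "J \<subseteq> I" "\<forall>x\<in>U. (f i has_real_derivative (\<Sum>j\<in>J. c j * f j x)) (at x)"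
      using assms(2)[OF Suc.prems] by blast
    then show ?case
      by (intro Ck_SucI[OF assms(1), where D="\<lambda>x. (*) (\<Sum>j\<in>J. c j * f j x)"])
         (auto simp: has_field_derivative_def intro!: Ck_sum Ck_mult Ck_const assms(1) Suc.IH)
  qed simp
qed

lemma smooth_on_real_deriv:
  fixes f f' :: "real \<Rightarrow> real"
  assumes "open U" "\<And>x. x \<in> U \<Longrightarrow> (f has_real_derivative f' x) (at x)" "smooth_on U f'"
  shows "smooth_on U f"
  unfolding smooth_on_iff_Ck
proof
  fix k show "Ck k U f"
    using assms by (cases k; simp only: Ck.simps(1); intro Ck_SucI[where D="\<lambda>x. (*) (f' x)"])
      (auto simp: has_field_derivative_def smooth_on_iff_Ck)
qed

lemma smooth_on_deriv:
  fixes f :: "real \<Rightarrow> real"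
  assumes "open U" "smooth_on U f"
  shows "smooth_on U (deriv f)" and "x \<in> U \<Longrightarrow> (f has_real_derivative deriv f x) (at x)"
proof -
  have D: "(f has_real_derivative deriv f x) (at x)" if "x \<in> U" for x
    using smooth_on_differentiable[OF assms(2,1) that]
    by (simp add: DERIV_deriv_iff_real_differentiable)
  then show "x \<in> U \<Longrightarrow> (f has_real_derivative deriv f x) (at x)" .
  have "frechet_derivative f (at x) 1 = deriv f x" if "x \<in> U" for x
    using fun_cong[OF frechet_derivative_at[of f "(*) (deriv f x)" x], of 1] D[OF that]
    by (simp add: has_field_derivative_def del: frechet_derivative_at)
  then show "smooth_on U (deriv f)"
    using smooth_onD(2)[OF assms(2), of 1] by (auto intro: smooth_on_cong[OF assms(1), rotated])
qed

section \<open>Antiderivatives, elementary functions and inverses\<close>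

lemma continuous_antideriv:
  fixes f :: "real \<Rightarrow> real"
  assumes c: "continuous_on UNIV f"
  obtains F where "\<And>x. (F has_real_derivative f x) (at x)"
proof -
  have "\<exists>F. \<forall>x. (F has_real_derivative f x) (at x)"
  proof -
    define F where "F x = (if 0 \<le> x then integral {0..x} f else - integral {x..0} f)" for x
    have "(F has_real_derivative f x) (at x)" for x
    proof -
      \<comment> \<open>The interval from \<open>a\<close> to \<open>b\<close> contains both 0 and
        \<open>x\<close> in its interior. On it \<open>F\<close> differs by a constant from the
        integral starting at \<open>a\<close>, so the fundamental theorem on a compact interval
        applies.\<close>
      define a where "a = - \<bar>x\<bar> - 1"
      define b where "b = \<bar>x\<bar> + 1"
      have ab: "a < x" "x < b" "a < 0" "0 < b" by (auto simp: a_def b_def)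
      have int: "f integrable_on {p..q}" for p q
        using c continuous_on_subset integrable_continuous_real by blast
      have "F y = integral {a..y} f - integral {a..0} f" if "y \<in> {a<..<b}" for y
      proof (cases "0 \<le> y")
        case True
        then show ?thesis
          using Henstock_Kurzweil_Integration.integral_combine[of a 0 y f] ab int by (simp add: F_def)
      next
        case False
        then show ?thesis
          using Henstock_Kurzweil_Integration.integral_combine[of a y 0 f] ab int that by (simp add: F_def)
      qed
      moreover have "((\<lambda>y. integral {a..y} f - integral {a..0} f) has_real_derivative f x) (at x)"
      proof -
        have "((\<lambda>y. integral {a..y} f) has_real_derivative f x) (at x within {a..b})"
          using ab by (intro integral_has_real_derivative continuous_on_subset[OF c]) auto
        then have "((\<lambda>y. integral {a..y} f) has_real_derivative f x) (at x)"
          using ab by (simp add: at_within_Icc_at)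
        then show ?thesis by (auto intro!: derivative_eq_intros)
      qed
      ultimately show ?thesis
        using ab by (subst DERIV_cong_ev[where g="\<lambda>y. integral {a..y} f - integral {a..0} f"])
          (auto simp: eventually_nhds intro!: exI[of _ "{a<..<b}"])
    qed
    then show ?thesis by blast
  qed
  then show ?thesis using that by metis
qed

lemma smooth_on_antideriv:
  fixes f :: "real \<Rightarrow> real"
  assumes "smooth_on UNIV f"
  obtains F where "\<And>x. (F has_real_derivative f x) (at x)" "smooth_on UNIV F" "F 0 = 0"
proof -
  have "continuous_on UNIV f"
    using smooth_onD(1)[OF assms] differentiable_imp_continuous_on by blast
  then obtain F where F: "\<And>x. (F has_real_derivative f x) (at x)" using continuous_antideriv by metis
  define G where "G x = F x - F 0" for x
  have "(G has_real_derivative f x) (at x)" for x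
    unfolding G_def using F by (auto intro!: derivative_eq_intros)
  then show ?thesis
    using that[of G] smooth_on_real_deriv[of UNIV G f] assms by (auto simp: G_def)
qed

lemma smooth_on_exp: "smooth_on U (exp :: real \<Rightarrow> real)"
proof -
  have "smooth_on UNIV ((\<lambda>_::unit. exp :: real \<Rightarrow> real) ())"
  proof (rule smooth_on_family[where I=UNIV])
    show "\<exists>J c. finite J \<and> J \<subseteq> UNIV \<and>
      (\<forall>x\<in>UNIV. ((exp :: real \<Rightarrow> real) has_real_derivative (\<Sum>j\<in>(J :: unit set). c j * exp x)) (at x))"
      by (rule exI[of _ "{()}"], rule exI[of _ "\<lambda>_. 1"]) (auto intro!: derivative_eq_intros)
  qed auto
  then show ?thesis using smooth_on_subset by blast
qed

lemma smooth_on_sin_cos: "smooth_on U (sin :: real \<Rightarrow> real)" "smooth_on U (cos :: real \<Rightarrow> real)"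
proof -
  define f :: "bool \<Rightarrow> real \<Rightarrow> real" where "f b = (if b then sin else cos)" for b
  have *: "smooth_on UNIV (f b)" for b
  proof (rule smooth_on_family[where I=UNIV])
    fix i
    show "\<exists>J c. finite J \<and> J \<subseteq> UNIV \<and> (\<forall>x\<in>UNIV. (f i has_real_derivative (\<Sum>j\<in>J. c j * f j x)) (at x))"
      by (rule exI[of _ "{\<not> i}"], rule exI[of _ "\<lambda>b. if b then -1 else 1"])
         (auto simp: f_def intro!: derivative_eq_intros)
  qed auto
  from *[of True] *[of False] show "smooth_on U (sin :: real \<Rightarrow> real)" "smooth_on U (cos :: real \<Rightarrow> real)"
    using smooth_on_subset by (auto simp: f_def)
qed

lemma smooth_on_real_inverse: "smooth_on (- {0}) (inverse :: real \<Rightarrow> real)"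
proof -
  have "smooth_on (- {0}) ((\<lambda>n x::real. inverse x ^ n) 1)"
  proof (rule smooth_on_family[where I=UNIV])
    fix n :: nat
    have "((\<lambda>x. inverse x ^ n) has_real_derivative (- real n) * inverse x ^ Suc n) (at x)"
      if "x \<noteq> 0" for x
      by (rule DERIV_cong[OF DERIV_power[OF DERIV_inverse[OF that]]])
         (use that in \<open>cases n; simp add: field_simps\<close>)
    then show "\<exists>J c. finite J \<and> J \<subseteq> UNIV \<and> (\<forall>x\<in>- {0}. ((\<lambda>x::real. inverse x ^ n) has_real_derivative (\<Sum>j\<in>J. c j * inverse x ^ j)) (at x))"
      by (intro exI[of _ "{Suc n}"] exI[of _ "\<lambda>_. - real n"]) auto
  qed auto
  then show ?thesis by simp
qed

lemma smooth_on_divide [smooth_intros]: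
  assumes "open U" "smooth_on U f" "smooth_on U g" "\<And>x. x \<in> U \<Longrightarrow> g x \<noteq> 0"
  shows "smooth_on U (\<lambda>x. f x / g x)"
proof -
  have "smooth_on U (\<lambda>x. inverse (g x))"
    using assms by (intro smooth_on_compose[OF smooth_on_real_inverse]) auto
  then show ?thesis
    using assms by (auto simp: divide_inverse intro: smooth_intros)
qed

text \<open>Bootstrap: the derivative of \<open>h\<close> is \<open>inverse (deriv F)\<close>
  composed with \<open>h\<close>, so order k for \<open>h\<close> gives order k for its derivative,
  hence order k + 1 for \<open>h\<close>.\<close>

lemma smooth_on_inverse_function:
  fixes F h :: "real \<Rightarrow> real"
  assumes "open U" "open V" "smooth_on V F" "h ` U \<subseteq> V"
    and "\<And>x. x \<in> U \<Longrightarrow> (h has_real_derivative inverse (deriv F (h x))) (at x)"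
    and "\<And>y. y \<in> V \<Longrightarrow> deriv F y \<noteq> 0"
  shows "smooth_on U h"
  unfolding smooth_on_iff_Ck
proof
  have "smooth_on V (\<lambda>y. 1 / deriv F y)"
    using assms smooth_on_deriv by (intro smooth_on_divide smooth_on_const) auto
  then have *: "Ck k V (\<lambda>y. inverse (deriv F y))" for k
    by (simp add: smooth_on_iff_Ck divide_inverse)
  fix k show "Ck k U h"
  proof (induction k)
    case (Suc k)
    have "Ck k U (\<lambda>x. inverse (deriv F (h x)))"
      using Suc * assms by (intro Ck_compose[where V=V and g=h and f="\<lambda>y. inverse (deriv F y)"]) auto
    then show ?case
      using assms by (intro Ck_SucI[where D="\<lambda>x. (*) (inverse (deriv F (h x)))"])
        (auto simp: has_field_derivative_def)
  qed simp
qed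

lemma smooth_on_real_polynomial_function:
  fixes f :: "'a::euclidean_space \<Rightarrow> real"
  assumes "real_polynomial_function f" shows "smooth_on UNIV f"
  using assms by induction (auto intro: smooth_intros smooth_on_linear)

text \<open>The derivative in a direction \<open>b\<close> is \<open>deriv g\<close> times
  \<open>b\<close>, which is again holomorphic, so the induction repeats itself. It is meant for
  branches of the logarithm.\<close>

lemma smooth_map_on_holomorphic:
  assumes "open U" "g holomorphic_on U"
  shows "smooth_map_on U g"
proof -
  have "Ck k U (\<lambda>z. g z \<bullet> c)" for k c
    using assms(2)
  proof (induction k arbitrary: g c)
    case (Suc k)
    have "((\<lambda>z. g z \<bullet> c) has_derivative (\<lambda>h. (deriv g z * h) \<bullet> c)) (at z)" if "z \<in> U" for z
      using holomorphic_derivI[OF Suc.prems assms(1) that]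
      by (intro has_derivative_inner_left) (simp add: has_field_derivative_def)
    moreover have "Ck k U (\<lambda>z. (deriv g z * b) \<bullet> c)" for b
      using Suc.prems by (intro Suc.IH) (auto intro!: holomorphic_intros assms(1))
    ultimately show ?case by (intro Ck_SucI[OF assms(1)]) auto
  qed simp
  then show ?thesis by (auto simp: smooth_map_on_def smooth_on_iff_Ck)
qed

subsection \<open>Smooth steps and interpolation\<close>

text \<open>\<open>flat 0\<close> is the classical flat function exp(-1/x); the powers of 1/x make
  the family closed under differentiation up to linear combinations.\<close>

definition flat :: "nat \<Rightarrow> real \<Rightarrow> real" where
  "flat n x = (if x > 0 then exp (- inverse x) * inverse x ^ n else 0)"

lemma flat_tendsto_0: "(flat n \<longlongrightarrow> 0) (at 0)"
proof -
  have "((\<lambda>x. inverse x ^ n / exp (inverse x)) \<longlongrightarrow> 0) (at_right (0::real))"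
    using filterlim_compose[OF tendsto_power_div_exp_0 filterlim_inverse_at_top_right] by simp
  then have "(flat n \<longlongrightarrow> 0) (at_right 0)"
    by (rule Lim_transform_eventually)
       (auto simp: eventually_at_right_field flat_def exp_minus field_simps intro!: exI[of _ 1])
  moreover have "(flat n \<longlongrightarrow> 0) (at_left 0)"
    by (rule tendsto_eventually) (auto simp: eventually_at_left_field flat_def intro!: exI[of _ "-1"])
  ultimately show ?thesis using filterlim_split_at by blast
qed

lemma flat_deriv: "(flat n has_real_derivative flat (n + 2) x - real n * flat (n + 1) x) (at x)"
proof -
  consider "x < 0" | "x = 0" | "x > 0" by linarith
  then show ?thesis
  proof cases
    case 1
    have "(flat n has_real_derivative 0) (at x)"
      by (rule has_field_derivative_transform_within_open[of "\<lambda>_. 0" _ _ "{..<0}"])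
         (use 1 in \<open>auto simp: flat_def\<close>)
    then show ?thesis using 1 by (simp add: flat_def)
  next
    case 2
    \<comment> \<open>The difference quotient of \<open>flat n\<close> at 0 is
      \<open>flat (Suc n)\<close>.\<close>
    have "((\<lambda>h. (flat n (0 + h) - flat n 0) / h) \<longlongrightarrow> 0) (at 0)"
      by (rule Lim_transform_eventually[OF flat_tendsto_0[of "Suc n"]])
         (auto simp: flat_def eventually_at_filter field_simps)
    then show ?thesis using 2 by (simp add: flat_def DERIV_def)
  next
    case 3
    have "((\<lambda>x. exp (- inverse x) * inverse x ^ n) has_real_derivative
        flat (n + 2) x - real n * flat (n + 1) x) (at x)"
      using 3 by (auto simp: flat_def intro!: derivative_eq_intros)
        (cases n; simp add: field_simps)
    then show ?thesis
      by (rule has_field_derivative_transform_within_open[of _ _ _ "{0<..}"])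
         (use 3 in \<open>auto simp: flat_def\<close>)
  qed
qed

lemma smooth_on_flat: "smooth_on U (flat n)"
proof -
  have "smooth_on UNIV (flat n)"
  proof (rule smooth_on_family[where I=UNIV])
    fix n :: nat
    show "\<exists>J c. finite J \<and> J \<subseteq> UNIV \<and> (\<forall>x\<in>UNIV. (flat n has_real_derivative (\<Sum>j\<in>J. c j * flat j x)) (at x))"
      by (rule exI[of _ "{n + 2, n + 1}"], rule exI[of _ "\<lambda>j. if j = n + 2 then 1 else - real n"])
         (use flat_deriv[of n] in auto)
  qed auto
  then show ?thesis using smooth_on_subset by blast
qed

text \<open>The transition is confined to the middle third, so a step rescaled to an interval is
  constant near both endpoints. Neighbouring steps can then be glued, and prescribed values are
  attained on whole neighbourhoods.\<close>

definition step :: "real \<Rightarrow> real" where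
  "step x = flat 0 (x - 1/3) / (flat 0 (x - 1/3) + flat 0 (2/3 - x))"

lemma flat0_pos: "flat 0 x \<ge> 0" "x > 0 \<Longrightarrow> flat 0 x > 0" "x \<le> 0 \<Longrightarrow> flat 0 x = 0"
  by (auto simp: flat_def)

lemma flat0_mono: "x \<le> y \<Longrightarrow> flat 0 x \<le> flat 0 y"
  by (auto simp: flat_def intro!: le_imp_inverse_le)

lemma step_denom: "flat 0 (x - 1/3) + flat 0 (2/3 - x) > 0"
  using flat0_pos(1,2)[of "x - 1/3"] flat0_pos(1,2)[of "2/3 - x"] by (cases "x > 1/3") auto

lemma smooth_on_step: "smooth_on UNIV step"
proof -
  have "smooth_on UNIV (\<lambda>x. flat 0 (x - 1/3))" "smooth_on UNIV (\<lambda>x. flat 0 (2/3 - x))"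
    by (intro smooth_on_compose_UNIV[OF smooth_on_flat] smooth_intros open_UNIV)+
  then have "smooth_on UNIV (\<lambda>x. flat 0 (x - 1/3) / (flat 0 (x - 1/3) + flat 0 (2/3 - x)))"
    using step_denom by (intro smooth_intros open_UNIV) (auto simp: less_le)
  then show ?thesis by (simp add: step_def[abs_def])
qed

lemma step_0: "x \<le> 1/3 \<Longrightarrow> step x = 0"
  by (simp add: step_def flat0_pos(3))

lemma step_1: "x \<ge> 2/3 \<Longrightarrow> step x = 1"
  using step_denom[of x] by (simp add: step_def flat0_pos(3))

lemma step_range: "0 \<le> step x" "step x \<le> 1"
  using step_denom[of x] flat0_pos(1)[of "x - 1/3"] flat0_pos(1)[of "2/3 - x"]
  by (auto simp: step_def divide_simps)

lemma step_mono: assumes "x \<le> y" shows "step x \<le> step y"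
proof -
  have "flat 0 (x - 1/3) * flat 0 (2/3 - y) \<le> flat 0 (y - 1/3) * flat 0 (2/3 - x)"
    using assms by (intro mult_mono flat0_mono flat0_pos) auto
  then show ?thesis
    using step_denom[of x] step_denom[of y] unfolding step_def
    by (simp add: frac_le_eq divide_simps algebra_simps)
qed

lemma smooth_on_step_compose:
  "open U \<Longrightarrow> smooth_on U g \<Longrightarrow> smooth_on U (\<lambda>x. step (g x))"
  by (rule smooth_on_compose_UNIV[OF smooth_on_step])

text \<open>A smooth surrogate for the identity of the unit interval.\<close>

lemma radial_profile:
  fixes e :: real
  assumes "e > 0"
  obtains k k' d where "0 < d" "d < 1/2" "smooth_on UNIV k" "\<And>x. (k has_real_derivative k' x) (at x)"
    "\<And>x. x \<le> d \<Longrightarrow> k x = 0" "\<And>x. x \<ge> 1 - d \<Longrightarrow> k x = 1" "\<And>x. 0 \<le> k x" "\<And>x. k x \<le> 1"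
    "\<And>x. 0 \<le> k' x" "\<And>x. k' x \<le> 1 + e" "\<And>x. x \<ge> 0 \<Longrightarrow> k x \<le> (1 + e) * x"
    "\<And>x. x \<ge> 1 - d \<Longrightarrow> k' x = 0"
proof -
  define e' where "e' = min e 1"
  \<comment> \<open>The profile will be normalised by a number at least 1 - 4d, so (1 + e)(1 - 4d)
    >= 1 is required. Since 16d = e' is at most e and at most 1, both 4d and 4de are at most
    e/4.\<close>
  define d where "d = e' / 16"
  have e': "0 < e'" "e' \<le> e" "e' \<le> 1" using assms by (auto simp: e'_def)
  have d: "0 < d" "d < 1/2" "16 * d = e'" using e' by (auto simp: d_def)
  \<comment> \<open>The unnormalised slope: a bump vanishing up to \<open>d\<close> and from
    \<open>1 - d\<close> on, and equal to 1 between \<open>2 * d\<close> and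
    \<open>1 - 2 * d\<close>.\<close>
  define c where "c x = step ((x - d) / d) * step ((1 - d - x) / d)" for x
  have c_smooth: "smooth_on UNIV c"
    unfolding c_def using d by (intro smooth_intros smooth_on_step_compose open_UNIV) auto
  have c01: "0 \<le> c x" "c x \<le> 1" for x
    using step_range by (auto simp: c_def intro: mult_le_one)
  have c0: "c x = 0" if "x \<le> d \<or> x \<ge> 1 - d" for x
  proof -
    have "(x - d) / d \<le> 0 \<or> (1 - d - x) / d \<le> 0" using that d by (auto simp: divide_simps)
    then have "step ((x - d) / d) = 0 \<or> step ((1 - d - x) / d) = 0"
      using step_0[of "(x - d) / d"] step_0[of "(1 - d - x) / d"] by linarith
    then show ?thesis by (auto simp: c_def)
  qed
  have c1: "c x = 1" if "2 * d \<le> x" "x \<le> 1 - 2 * d" for x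
    using that d by (auto simp: c_def divide_simps intro!: step_1 simp: step_1)
  obtain F where F: "\<And>x. (F has_real_derivative c x) (at x)" "smooth_on UNIV F" "F 0 = 0"
    using smooth_on_antideriv[OF c_smooth] by blast
  have mono: "F x \<le> F y" if "x \<le> y" for x y
    using DERIV_nonneg_imp_nondecreasing[OF that] F(1) c01(1) by blast
  have lip: "F y - F x \<le> y - x" if "x \<le> y" for x y
  proof -
    have "x - F x \<le> y - F y"
      by (rule DERIV_nonneg_imp_nondecreasing[OF that])
        (auto intro!: exI derivative_eq_intros F(1) simp: c01)
    then show ?thesis by simp
  qed
  have eq: "F y = F x" if "x \<le> y" "\<And>z. x \<le> z \<Longrightarrow> z \<le> y \<Longrightarrow> c z = 0" for x y
  proof -
    have "F y \<le> F x"
      by (rule DERIV_nonpos_imp_nonincreasing[OF that(1)]) (metis F(1) that(2) order_refl)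
    then show ?thesis using mono[OF that(1)] by simp
  qed
  \<comment> \<open>The total increase of \<open>F\<close>. Dividing by it makes the profile end
    exactly at 1, at the price of the slope 1 / L.\<close>
  define L where "L = F (1 - d)"
  have F0: "F x = 0" if "x \<le> d" for x
    using eq[of x 0] eq[of 0 x] c0 F(3) that d by (cases "x \<le> 0") auto
  have F1: "F x = L" if "x \<ge> 1 - d" for x
    unfolding L_def using that c0 by (intro eq) auto
  have "(1 - 2*d) - F (1 - 2 * d) \<le> 2 * d - F (2 * d)"
    by (rule DERIV_nonpos_imp_nonincreasing[of "2*d" "1-2*d" "\<lambda>x. x - F x"])
      (use d e' in \<open>auto intro!: exI derivative_eq_intros F(1) simp: c1\<close>)
  moreover have "F (2 * d) \<ge> 0" using mono[of 0 "2*d"] F(3) d by simp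
  moreover have "F (1 - 2*d) \<le> L" unfolding L_def using d by (intro mono) auto
  ultimately have L: "L \<ge> 1 - 4 * d" by linarith
  then have Lpos: "L > 0" using d e' by linarith
  have "1 \<le> (1 + e) * (1 - 4 * d)"
  proof -
    have "16 * d * e \<le> 1 * e" using d(3) e' assms by (intro mult_right_mono) auto
    moreover have "(1 + e) * (1 - 4 * d) = 1 + e - 4 * d - (16 * d * e) / 4"
      by (simp add: algebra_simps)
    ultimately show ?thesis using d(3) e' by linarith
  qed
  then have L2: "1 / L \<le> 1 + e"
    using Lpos assms order_trans[OF _ mult_left_mono[OF L, of "1 + e"], of 1] by (simp add: pos_divide_le_eq)
  show ?thesis
  proof (rule that[of d "\<lambda>x. F x / L" "\<lambda>x. c x / L"])
    show "smooth_on UNIV (\<lambda>x. F x / L)"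
      using Lpos by (intro smooth_on_divide F(2) smooth_on_const open_UNIV) auto
    show "((\<lambda>x. F x / L) has_real_derivative c x / L) (at x)" for x
      by (rule DERIV_cdivide[OF F(1)])
    show "0 \<le> F x / L" for x
      using F0[of x] mono[of d x] F0[of d] Lpos by (cases "x \<le> d") auto
    show "F x / L \<le> 1" for x
      using F1[of x] mono[of x "1-d"] F1[of "1-d"] Lpos by (cases "x \<ge> 1 - d") auto
    show "c x / L \<le> 1 + e" for x
      using L2 c01(2)[of x] Lpos by (smt (verit) divide_right_mono)
    show "F x / L \<le> (1 + e) * x" if "x \<ge> 0" for x
    proof -
      have "F x \<le> x" using lip[of 0 x] F(3) that by simp
      then have "F x / L \<le> x * (1 / L)" using Lpos by (simp add: divide_right_mono)
      also have "\<dots> \<le> x * (1 + e)" using L2 that by (intro mult_left_mono)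
      finally show ?thesis by (simp add: mult.commute)
    qed
  qed (use d c01 c0 F0 F1 Lpos in auto)
qed

text \<open>Because \<open>g\<close> is constant on margins of width \<delta> at both ends of the
  period, the translated copies agree where they overlap and glue to a smooth function.\<close>

lemma periodic_extension:
  fixes g :: "real \<Rightarrow> real"
  assumes g: "smooth_on UNIV g" "mono g" and "\<delta> > 0" "P > \<delta>"
    and g0: "\<And>x. x \<le> a + \<delta> \<Longrightarrow> g x = v" and g1: "\<And>x. x \<ge> a + P - \<delta> \<Longrightarrow> g x = v + Q"
  obtains S where "smooth_on UNIV S" "mono S" "\<And>x. S (x + P) = S x + Q"
    "\<And>x. a - \<delta> \<le> x \<Longrightarrow> x \<le> a + P + \<delta> \<Longrightarrow> S x = g x"
proof -
  have P: "P > 0" using assms by simp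
  define j where "j x = \<lfloor>(x - a) / P\<rfloor>" for x
  define S where "S x = g (x - P * j x) + Q * j x" for x
  have j: "a + P * j x \<le> x" "x < a + P * j x + P" for x
    using floor_divide_lower[OF P, of "x - a"] floor_divide_upper[OF P, of "x - a"]
    by (auto simp: j_def algebra_simps)
  have Q: "0 \<le> Q"
  proof -
    have "g (min (a+\<delta>) (a + P - \<delta>)) \<le> g (max (a+\<delta>) (a + P - \<delta>))"
      by (rule monoD[OF g(2)]) auto
    moreover have "g (min (a+\<delta>) (a + P - \<delta>)) = v" "g (max (a+\<delta>) (a + P - \<delta>)) = v + Q"
      by (rule g0, simp) (rule g1, simp)
    ultimately show ?thesis by simp
  qed
  have jP: "j (x + P) = j x + 1" for x
  proof -
    have "(x + P - a) / P = (x - a) / P + 1" using P by (simp add: divide_simps)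
    then show ?thesis by (simp add: j_def)
  qed
  \<comment> \<open>The formula belonging to the period with index \<open>i\<close> remains valid a
    distance \<delta> beyond that period. There the true index is off by one, where the constant
    margins agree; being off by two is excluded by P > \<delta>.\<close>
  have ext: "S x = g (x - P * of_int i) + Q * of_int i"
    if "a + P * of_int i - \<delta> \<le> x" "x \<le> a + P * of_int i + P + \<delta>" for x i
  proof -
    consider "j x = i" | "j x < i" | "j x > i" by linarith
    then show ?thesis
    proof cases
      case 2
      then have "of_int (j x) \<le> (of_int i - 1 :: real)" by linarith
      then have "P * of_int (j x) \<le> P * (of_int i - 1)" using P by (intro mult_left_mono) auto
      then have le: "x < a + P * of_int i" using j(2)[of x] by (simp add: algebra_simps)
      show ?thesis
      proof (cases "j x = i - 1")
        case True
        then have i: "real_of_int i = j x + 1" by simp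
        have "g (x - P * j x) = v + Q" using that unfolding i by (intro g1) (simp add: algebra_simps)
        moreover have "g (x - P * i) = v" using le assms(3) by (intro g0) (simp add: algebra_simps)
        ultimately show ?thesis by (simp add: S_def i distrib_left)
      next
        case False
        then have "of_int (j x) \<le> (of_int i - 2 :: real)" using 2 by linarith
        then have "P * of_int (j x) \<le> P * (of_int i - 2)" using P by (intro mult_left_mono) auto
        then show ?thesis using that j(2)[of x] assms(4) by (simp add: algebra_simps)
      qed
    next
      case 3
      then have "of_int (j x) \<ge> (of_int i + 1 :: real)" by linarith
      then have "P * of_int (j x) \<ge> P * (of_int i + 1)" using P by (intro mult_left_mono) auto
      then have le: "x \<ge> a + P * of_int i + P" using j(1)[of x] by (simp add: algebra_simps)
      show ?thesis
      proof (cases "j x = i + 1")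
        case True
        then have i: "real_of_int (j x) = i + 1" by simp
        have "g (x - P * j x) = v" using that unfolding i by (intro g0) (simp add: algebra_simps)
        moreover have "g (x - P * i) = v + Q" using le assms(3) by (intro g1) (simp add: algebra_simps)
        ultimately show ?thesis by (simp add: S_def i distrib_left)
      next
        case False
        then have "of_int (j x) \<ge> (of_int i + 2 :: real)" using 3 by linarith
        then have "P * of_int (j x) \<ge> P * (of_int i + 2)" using P by (intro mult_left_mono) auto
        then show ?thesis using that j(1)[of x] assms(4) by (simp add: algebra_simps)
      qed
    qed (simp add: S_def)
  qed
  show ?thesis
  proof (rule that[of S])
    show "smooth_on UNIV S"
    proof (rule smooth_on_local)
      fix x
      let ?V = "{a + P * j x - \<delta> <..< a + P * j x + P + \<delta>}"
      have "smooth_on ?V (\<lambda>x'. g (x' - P * j x) + Q * j x)"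
        by (intro smooth_intros smooth_on_compose_UNIV[OF g(1)]) auto
      moreover have "x \<in> ?V" using j[of x] assms(3) by auto
      ultimately show "\<exists>V g. open V \<and> x \<in> V \<and> smooth_on V g \<and> (\<forall>y\<in>V. S y = g y)"
        using ext[of "j x"] by (intro exI[of _ ?V] exI conjI) auto
    qed
    show "S (x + P) = S x + Q" for x
      unfolding S_def jP by (simp add: algebra_simps)
    show "S x = g x" if "a - \<delta> \<le> x" "x \<le> a + P + \<delta>" for x
      using ext[of 0 x] that by simp
    show "mono S"
    proof (rule monoI)
      fix x y :: real assume xy: "x \<le> y"
      have rng: "v \<le> g z" "g z \<le> v + Q" for z
        using monoD[OF g(2), of "min z (a+\<delta>)" z] monoD[OF g(2), of z "max z (a+P-\<delta>)"]
        by (auto simp: g0 g1)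
      have "j x \<le> j y" using xy P by (auto simp: j_def intro!: floor_mono divide_right_mono)
      show "S x \<le> S y"
      proof (cases "j x = j y")
        case True
        then show ?thesis using monoD[OF g(2), of "x - P * j x" "y - P * j x"] xy by (simp add: S_def)
      next
        case False
        then have "of_int (j x) + 1 \<le> (of_int (j y) :: real)" using \<open>j x \<le> j y\<close> by linarith
        then have "Q * (of_int (j x) + 1) \<le> Q * of_int (j y)" using Q by (intro mult_left_mono)
        then show ?thesis using rng(2)[of "x - P * j x"] rng(1)[of "y - P * j y"]
          by (simp add: S_def algebra_simps)
      qed
    qed
  qed
qed

text \<open>A sum of rescaled steps, one per interval, each weighted by a nonnegative jump. The
  plateaus at the nodes serve twice later: they hold a boundary parametrization at rest at the
  corners, and they send marked angles to marked angles.\<close>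

lemma step_interpolation:
  fixes a v :: "nat \<Rightarrow> real"
  assumes "m > 0" and a: "\<And>i. i < m \<Longrightarrow> a i < a (Suc i)" and v: "\<And>i. i < m \<Longrightarrow> v i \<le> v (Suc i)"
    and "a m = a 0 + P" "v m = v 0 + Q"
  obtains S \<delta> where "smooth_on UNIV S" "mono S" "\<And>x. S (x + P) = S x + Q" "\<delta> > 0"
    "\<And>i x. i \<le> m \<Longrightarrow> \<bar>x - a i\<bar> \<le> \<delta> \<Longrightarrow> S x = v i"
proof -
  have amono: "a i \<le> a j" if "i \<le> j" "j \<le> m" for i j
    using that
  proof (induction rule: dec_induct)
    case (step n)
    then show ?case using a[of n] by force
  qed simp
  define w where "w = Min ((\<lambda>i. a (Suc i) - a i) ` {..<m})"
  \<comment> \<open>\<open>step\<close> is constant on the first and the last third of the unit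
    interval, so a third of the shortest gap is a common plateau width.\<close>
  define \<delta> where "\<delta> = w / 3"
  have w: "w \<le> a (Suc i) - a i" if "i < m" for i
    unfolding w_def using that by (intro Min_le) auto
  have "w \<in> (\<lambda>i. a (Suc i) - a i) ` {..<m}"
    unfolding w_def using assms(1) by (intro Min_in) auto
  then have "w > 0" using a by auto
  then have \<delta>: "\<delta> > 0" by (simp add: \<delta>_def)
  define g where "g x = v 0 + (\<Sum>i<m. (v (Suc i) - v i) * step ((x - a i) / (a (Suc i) - a i)))" for x
  have st0: "step ((x - a i) / (a (Suc i) - a i)) = 0" if "i < m" "x \<le> a i + \<delta>" for x i
    using that w[OF that(1)] a[OF that(1)] \<delta> by (intro step_0) (auto simp: \<delta>_def divide_simps)
  have st1: "step ((x - a i) / (a (Suc i) - a i)) = 1" if "i < m" "x \<ge> a (Suc i) - \<delta>" for x i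
    using that w[OF that(1)] a[OF that(1)] \<delta> by (intro step_1) (auto simp: \<delta>_def divide_simps)
  have gv: "g x = v i" if "i \<le> m" "\<bar>x - a i\<bar> \<le> \<delta>" for i x
  proof -
    have "(\<Sum>k<m. (v (Suc k) - v k) * step ((x - a k) / (a (Suc k) - a k)))
        = (\<Sum>k<m. if k < i then v (Suc k) - v k else 0)"
    proof (rule sum.cong)
      fix k assume "k \<in> {..<m}"
      then have k: "k < m" by simp
      show "(v (Suc k) - v k) * step ((x - a k) / (a (Suc k) - a k)) = (if k < i then v (Suc k) - v k else 0)"
      proof (cases "k < i")
        case True
        then have "a (Suc k) \<le> a i" using that by (intro amono) auto
        then show ?thesis using st1[OF k, of x] that True by auto
      next
        case False
        then have "a i \<le> a k" using k by (intro amono) auto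
        then show ?thesis using st0[OF k, of x] that False by auto
      qed
    qed simp
    also have "\<dots> = (\<Sum>k<i. v (Suc k) - v k)"
    proof -
      have "{..<m} \<inter> {k. k < i} = {..<i}" using that by auto
      then show ?thesis by (simp add: sum.If_cases)
    qed
    also have "\<dots> = v i - v 0" by (rule sum_lessThan_telescope)
    finally show ?thesis by (simp add: g_def)
  qed
  have "smooth_on UNIV g"
    unfolding g_def
  proof (intro smooth_intros smooth_on_step_compose open_UNIV)
    fix i and x :: real assume "i \<in> {..<m}"
    then show "a (Suc i) - a i \<noteq> 0" using a[of i] by auto
  qed
  moreover have "mono g"
  proof (rule monoI)
    fix x y :: real assume "x \<le> y"
    then show "g x \<le> g y"
      unfolding g_def using a v
      by (intro add_left_mono sum_mono mult_left_mono step_mono divide_right_mono) (auto simp: less_imp_le)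
  qed
  moreover have "g x = v 0" if "x \<le> a 0 + \<delta>" for x
  proof -
    have "step ((x - a i) / (a (Suc i) - a i)) = 0" if "i < m" for i
      using \<open>x \<le> a 0 + \<delta>\<close> amono[of 0 i] that by (intro st0) auto
    then show ?thesis by (simp add: g_def)
  qed
  moreover have "g x = v 0 + Q" if "x \<ge> a 0 + P - \<delta>" for x
  proof -
    have "step ((x - a i) / (a (Suc i) - a i)) = 1" if "i < m" for i
      using \<open>x \<ge> a 0 + P - \<delta>\<close> amono[of "Suc i" m] that assms(4) by (intro st1) auto
    then have "g x = v 0 + (\<Sum>i<m. v (Suc i) - v i)" by (simp add: g_def)
    then show ?thesis using assms(5) by (simp add: sum_lessThan_telescope)
  qed
  moreover have "P > \<delta>"
    using w[OF assms(1)] amono[of 1 m] assms(1,4) \<open>w > 0\<close> by (simp add: \<delta>_def)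
  ultimately obtain S where S: "smooth_on UNIV S" "mono S" "\<And>x. S (x + P) = S x + Q"
    "\<And>x. a 0 - \<delta> \<le> x \<Longrightarrow> x \<le> a 0 + P + \<delta> \<Longrightarrow> S x = g x"
    using periodic_extension[of g \<delta> P "a 0" "v 0" Q] \<delta> by metis
  show ?thesis
  proof (rule that[OF S(1-3) \<delta>])
    fix i x assume i: "i \<le> m" "\<bar>x - a i\<bar> \<le> \<delta>"
    then have "a 0 \<le> a i" "a i \<le> a 0 + P" using amono[of 0 i] amono[of i m] assms(4) by auto
    then show "S x = v i" using S(4)[of x] gv[OF i] i by auto
  qed
qed

subsection \<open>Poisson brackets and cut-off functions on a symplectic manifold\<close>

definition bracket :: "('e::euclidean_space \<Rightarrow> 'e \<Rightarrow> real) \<Rightarrow> ('e \<Rightarrow> real) \<Rightarrow> ('e \<Rightarrow> real) \<Rightarrow> real" where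
  "bracket w f g = w (ham_vec w f) (ham_vec w g)"

locale symplectic_form =
  fixes w :: "'e::euclidean_space \<Rightarrow> 'e \<Rightarrow> real"
  assumes bil: "bilinear w"
    and anti: "w v u = - w u v"
    and nondeg: "v \<noteq> 0 \<Longrightarrow> \<exists>u. w v u \<noteq> 0"
begin

lemma ham_vec_unique:
  assumes "\<And>u. w v u = f u" shows "ham_vec w f = v"
  unfolding ham_vec_def
proof (rule the_equality)
  fix v' assume "\<forall>u. w v' u = f u"
  then have "w (v' - v) u = 0" for u
    using assms by (simp add: bilinear_lsub[OF bil])
  then show "v' = v" using nondeg[of "v' - v"] by auto
qed (use assms in auto)

text \<open>Nondegeneracy makes the map from vectors to covectors injective. Encoded by its
  coordinates as the endomorphism \<open>L\<close>, it is surjective because the dimension is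
  finite.\<close>

lemma ham_vec_works:
  assumes "linear f" shows "w (ham_vec w f) u = f u"
proof -
  define L where "L v = (\<Sum>b\<in>Basis. w v b *\<^sub>R b)" for v
  have Lb: "L v \<bullet> b = w v b" if "b \<in> Basis" for v b
    using that by (simp add: L_def)
  have "linear L"
    unfolding L_def
    by (intro linearI) (simp_all add: bilinear_ladd[OF bil] bilinear_lmul[OF bil] scaleR_add_left sum.distrib scaleR_sum_right)
  have eqI: "w v u = f u" if "\<And>b. b \<in> Basis \<Longrightarrow> w v b = f b" "linear f" for v u and f :: "'e \<Rightarrow> real"
  proof -
    have "linear (w v)" using bil by (simp add: bilinear_def)
    then show ?thesis using linear_eq_stdbasis[of "w v" f] that \<open>linear f\<close> by blast
  qed
  have "inj L"
  proof (rule linear_injective_0[OF \<open>linear L\<close>, THEN iffD2], intro allI impI)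
    fix v assume "L v = 0"
    then have "w v b = 0" if "b \<in> Basis" for b
      using that Lb[of b v] by simp
    then have "w v u = 0" for u
      using eqI[of v "\<lambda>_. 0" u] by (simp add: linear_zero)
    then show "v = 0" using nondeg by blast
  qed
  then have "surj L" using linear_injective_imp_surjective[OF \<open>linear L\<close>] by blast
  then obtain v where v: "L v = (\<Sum>b\<in>Basis. f b *\<^sub>R b)" by (metis surjD)
  have "w v b = f b" if "b \<in> Basis" for b
    using Lb[OF that, of v] that by (simp add: v)
  then have "w v u = f u" for u using eqI assms by blast
  then show ?thesis using ham_vec_unique[of v f] by simp
qed

text \<open>By bilinearity and antisymmetry only the determinant of the coefficients survives; it
  becomes the Jacobian of a plane map.\<close>

lemma bracket_linear_comb:
  assumes "linear f" "linear g"
  shows "bracket w (\<lambda>u. a * f u + b * g u) (\<lambda>u. c * f u + d * g u) = (a * d - b * c) * bracket w f g"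
proof -
  have *: "ham_vec w (\<lambda>u. a * f u + b * g u) = a *\<^sub>R ham_vec w f + b *\<^sub>R ham_vec w g" for a b
    by (rule ham_vec_unique)
       (simp add: bilinear_ladd[OF bil] bilinear_lmul[OF bil] ham_vec_works assms)
  have "w v v = 0" for v using anti[of v v] by simp
  then show ?thesis
    using anti[of "ham_vec w g" "ham_vec w f"] unfolding bracket_def *
    by (simp add: bilinear_ladd[OF bil] bilinear_lmul[OF bil] bilinear_radd[OF bil] bilinear_rmul[OF bil] algebra_simps)
qed

lemma bracket_dependent:
  assumes "linear f" "linear g" "\<And>u. p * f u = q * g u" "p \<noteq> 0 \<or> q \<noteq> 0"
  shows "bracket w f g = 0"
proof (cases "p = 0")
  case True
  then have "g = (\<lambda>u. 0)" using assms(3,4) by auto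
  then show ?thesis using bracket_linear_comb[OF assms(1,1), of 1 0 0 0] by simp
next
  case False
  then have "f = (\<lambda>u. (q / p) * g u)" using assms(3) by (auto simp: field_simps)
  then show ?thesis using bracket_linear_comb[OF assms(2,2), of "q / p" 0 1 0] by simp
qed

end

section \<open>The Poisson bracket in charts\<close>

definition jac :: "(complex \<Rightarrow> complex) \<Rightarrow> complex \<Rightarrow> real" where
  "jac \<Psi> z = frechet_derivative (\<lambda>z. Re (\<Psi> z)) (at z) 1 * frechet_derivative (\<lambda>z. Im (\<Psi> z)) (at z) \<i>
     - frechet_derivative (\<lambda>z. Re (\<Psi> z)) (at z) \<i> * frechet_derivative (\<lambda>z. Im (\<Psi> z)) (at z) 1"

locale symplectic =
  fixes T :: "'a topology" and A :: "('a,'e::euclidean_space) chart set"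
    and om :: "('a,'e) chart \<Rightarrow> 'e \<Rightarrow> 'e \<Rightarrow> 'e \<Rightarrow> real"
  assumes symplectic_manifold: "symplectic_manifold T A om"
begin

lemma chart:
  assumes "(U, \<phi>) \<in> A"
  shows "openin T U" "open (\<phi> ` U)" "homeomorphic_map (subtopology T U) (top_of_set (\<phi> ` U)) \<phi>"
    "inj_on \<phi> U" "U \<subseteq> topspace T"
proof -
  have atlas: "\<forall>(U, \<phi>)\<in>A. openin T U \<and> open (\<phi> ` U) \<and>
      homeomorphic_map (subtopology T U) (top_of_set (\<phi> ` U)) \<phi>"
    using symplectic_manifold unfolding symplectic_manifold_def by (elim conjE) assumption
  show *: "openin T U" "open (\<phi> ` U)" "homeomorphic_map (subtopology T U) (top_of_set (\<phi> ` U)) \<phi>"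
    using bspec[OF atlas assms] by auto
  show "U \<subseteq> topspace T" using *(1) by (rule openin_subset)
  then have "topspace (subtopology T U) = U" by (simp add: topspace_subtopology Int_absorb1)
  then show "inj_on \<phi> U" using *(3) homeomorphic_imp_injective_map by force
qed

lemma chart_ex: "x \<in> topspace T \<Longrightarrow> \<exists>U \<phi>. (U, \<phi>) \<in> A \<and> x \<in> U"
proof -
  have "topspace T = (\<Union>c\<in>A. fst c)"
    using symplectic_manifold unfolding symplectic_manifold_def by (elim conjE) assumption
  then show "x \<in> topspace T \<Longrightarrow> \<exists>U \<phi>. (U, \<phi>) \<in> A \<and> x \<in> U" by force
qed

lemma Hausdorff: "Hausdorff_space T"
  using symplectic_manifold unfolding symplectic_manifold_def by (elim conjE)

lemma transition_smooth:
  assumes "(U, \<phi>) \<in> A" "(U', \<phi>') \<in> A"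
  shows "smooth_map_on (\<phi> ` (U \<inter> U')) (\<phi>' \<circ> inv_into (U \<inter> U') \<phi>)"
proof -
  have "\<forall>c\<in>A. \<forall>d\<in>A. smooth_map_on (snd c ` (fst c \<inter> fst d)) (transition c d)"
    using symplectic_manifold unfolding symplectic_manifold_def by (elim conjE) assumption
  from bspec[OF bspec[OF this assms(1)] assms(2)]
  have "smooth_map_on (snd (U, \<phi>) ` (fst (U, \<phi>) \<inter> fst (U', \<phi>'))) (transition (U, \<phi>) (U', \<phi>'))" .
  then show ?thesis by (simp add: transition_def)
qed

lemma symplectic_form_chart:
  assumes "(U, \<phi>) \<in> A" "x \<in> U"
  shows "symplectic_form (om (U, \<phi>) (\<phi> x))"
proof -
  have "\<forall>c\<in>A. \<forall>y\<in>snd c ` fst c. bilinear (om c y) \<and>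
        (\<forall>v w. om c y v w = - om c y w v) \<and>
        (\<forall>v. v \<noteq> 0 \<longrightarrow> (\<exists>w. om c y v w \<noteq> 0))"
    using symplectic_manifold unfolding symplectic_manifold_def by (elim conjE) assumption
  from bspec[OF this assms(1)]
  have "\<forall>y\<in>snd (U, \<phi>) ` fst (U, \<phi>). bilinear (om (U, \<phi>) y) \<and>
        (\<forall>v w. om (U, \<phi>) y v w = - om (U, \<phi>) y w v) \<and>
        (\<forall>v. v \<noteq> 0 \<longrightarrow> (\<exists>w. om (U, \<phi>) y v w \<noteq> 0))" .
  moreover have "\<phi> x \<in> snd (U, \<phi>) ` fst (U, \<phi>)" using assms(2) by simp
  ultimately show ?thesis unfolding symplectic_form_def by blast
qed

lemma open_chart_image:
  assumes "(U, \<phi>) \<in> A" "openin T V"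
  shows "open (\<phi> ` (U \<inter> V))"
proof -
  have "openin (subtopology T U) (U \<inter> V)"
    using assms(2) by (metis openin_subtopology_Int2)
  then have "openin (top_of_set (\<phi> ` U)) (\<phi> ` (U \<inter> V))"
    using homeomorphic_imp_open_map[OF chart(3)[OF assms(1)]] by (simp add: open_map_def)
  then show ?thesis using chart(2)[OF assms(1)] by (simp add: openin_open_eq)
qed

lemma smooth_funD:
  "smooth_fun T A f \<Longrightarrow> (U, \<phi>) \<in> A \<Longrightarrow> smooth_on (\<phi> ` U) (\<lambda>y. f (inv_into U \<phi> y))"
  by (auto simp: smooth_fun_def comp_def)

lemma smooth_funI:
  "(\<And>U \<phi>. (U, \<phi>) \<in> A \<Longrightarrow> smooth_on (\<phi> ` U) (\<lambda>y. f (inv_into U \<phi> y))) \<Longrightarrow> smooth_fun T A f"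
  by (auto simp: smooth_fun_def comp_def)

lemma smooth_fun_compose:
  assumes "smooth_on UNIV h" "smooth_fun T A (\<lambda>x. Re (\<Phi> x))" "smooth_fun T A (\<lambda>x. Im (\<Phi> x))"
  shows "smooth_fun T A (\<lambda>x. h (\<Phi> x))"
proof (rule smooth_funI)
  fix U \<phi> assume c: "(U, \<phi>) \<in> A"
  show "smooth_on (\<phi> ` U) (\<lambda>y. h (\<Phi> (inv_into U \<phi> y)))"
    using smooth_funD[OF assms(2) c] smooth_funD[OF assms(3) c]
    by (intro smooth_on_compose_map[OF chart(2)[OF c] open_UNIV _ assms(1)])
       (simp_all add: smooth_map_on_complex_iff)
qed

lemma smooth_fun_arith:
  assumes "smooth_fun T A f" "smooth_fun T A g"
  shows "smooth_fun T A (\<lambda>x. f x + g x)" "smooth_fun T A (\<lambda>x. f x * g x)"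
  by (rule smooth_funI, rule smooth_on_add, erule chart, erule smooth_funD[OF assms(1)], erule smooth_funD[OF assms(2)])
     (rule smooth_funI, rule smooth_on_mult, erule chart, erule smooth_funD[OF assms(1)], erule smooth_funD[OF assms(2)])

lemma smooth_fun_const: "smooth_fun T A (\<lambda>x. c)"
  by (intro smooth_funI smooth_intros)

lemma smooth_fun_sum:
  "(\<And>i. i \<in> I \<Longrightarrow> smooth_fun T A (f i)) \<Longrightarrow> smooth_fun T A (\<lambda>x. \<Sum>i\<in>I. f i x)"
  by (induction I rule: infinite_finite_induct) (auto intro: smooth_fun_const smooth_fun_arith)

lemma smooth_fun_real_compose:
  assumes "smooth_on UNIV h" "smooth_fun T A f"
  shows "smooth_fun T A (\<lambda>x. h (f x))"
  by (rule smooth_funI, rule smooth_on_compose_UNIV[OF assms(1)], erule smooth_funD[OF assms(2)], erule chart)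

text \<open>The chart selected by \<open>poisson\<close> depends on the point only, so brackets of
  different pairs of functions at one point can be compared in one and the same chart.\<close>

lemma poisson_chart:
  assumes "x \<in> topspace T"
  obtains U \<phi> where "(U, \<phi>) \<in> A" "x \<in> U"
    "\<And>f g. poisson A om f g x = bracket (om (U, \<phi>) (\<phi> x))
       (frechet_derivative (\<lambda>y. f (inv_into U \<phi> y)) (at (\<phi> x)))
       (frechet_derivative (\<lambda>y. g (inv_into U \<phi> y)) (at (\<phi> x)))"
proof -
  obtain U \<phi> where U: "(U, \<phi>) = (SOME c. c \<in> A \<and> x \<in> fst c)" by (metis surj_pair)
  have "(U, \<phi>) \<in> A \<and> x \<in> fst (U, \<phi>)"
    unfolding U by (rule someI_ex) (use chart_ex[OF assms] in force)
  then show ?thesis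
    using that[of U \<phi>] by (simp add: poisson_def U[symmetric] bracket_def comp_def Let_def)
qed

lemma smooth_fun_has_derivative:
  assumes "smooth_fun T A f" "(U, \<phi>) \<in> A" "x \<in> U"
  shows "((\<lambda>y. f (inv_into U \<phi> y)) has_derivative
           frechet_derivative (\<lambda>y. f (inv_into U \<phi> y)) (at (\<phi> x))) (at (\<phi> x))"
  using smooth_on_differentiable[OF smooth_funD[OF assms(1,2)] chart(2)[OF assms(2)]] assms(3)
  by (simp add: frechet_derivative_works[symmetric])

lemma poisson_compose:
  assumes x: "x \<in> topspace T"
    and \<Phi>: "smooth_fun T A (\<lambda>x. Re (\<Phi> x))" "smooth_fun T A (\<lambda>x. Im (\<Phi> x))"
    and \<Psi>: "smooth_map_on UNIV \<Psi>"
  shows "poisson A om (\<lambda>x. Re (\<Psi> (\<Phi> x))) (\<lambda>x. Im (\<Psi> (\<Phi> x))) x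
       = jac \<Psi> (\<Phi> x) * poisson A om (\<lambda>x. Re (\<Phi> x)) (\<lambda>x. Im (\<Phi> x)) x"
proof -
  obtain U \<phi> where c: "(U, \<phi>) \<in> A" "x \<in> U"
    and P: "\<And>f g. poisson A om f g x = bracket (om (U, \<phi>) (\<phi> x))
       (frechet_derivative (\<lambda>y. f (inv_into U \<phi> y)) (at (\<phi> x)))
       (frechet_derivative (\<lambda>y. g (inv_into U \<phi> y)) (at (\<phi> x)))"
    using poisson_chart[OF x] by blast
  interpret symplectic_form "om (U, \<phi>) (\<phi> x)" by (rule symplectic_form_chart[OF c])
  define \<psi> where "\<psi> = inv_into U \<phi>"
  have \<psi>x: "\<psi> (\<phi> x) = x" using chart(4)[OF c(1)] c(2) by (simp add: \<psi>_def)
  define df where "df = frechet_derivative (\<lambda>y. Re (\<Phi> (\<psi> y))) (at (\<phi> x))"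
  define dg where "dg = frechet_derivative (\<lambda>y. Im (\<Phi> (\<psi> y))) (at (\<phi> x))"
  have df: "((\<lambda>y. Re (\<Phi> (\<psi> y))) has_derivative df) (at (\<phi> x))"
    and dg: "((\<lambda>y. Im (\<Phi> (\<psi> y))) has_derivative dg) (at (\<phi> x))"
    using smooth_fun_has_derivative[OF \<Phi>(1) c] smooth_fun_has_derivative[OF \<Phi>(2) c]
    by (auto simp: df_def dg_def \<psi>_def)
  have lin: "linear df" "linear dg"
    using df dg has_derivative_linear by blast+
  have D: "((\<lambda>y. \<Phi> (\<psi> y)) has_derivative (\<lambda>u. df u *\<^sub>R 1 + dg u *\<^sub>R \<i>)) (at (\<phi> x))"
    unfolding has_derivative_componentwise_within[of "\<lambda>y. \<Phi> (\<psi> y)"]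
    using df dg by (auto simp: Basis_complex_def inner_complex_def)
  have comp: "frechet_derivative (\<lambda>y. h (\<Phi> (\<psi> y))) (at (\<phi> x))
      = (\<lambda>u. frechet_derivative h (at (\<Phi> x)) 1 * df u + frechet_derivative h (at (\<Phi> x)) \<i> * dg u)"
    if "smooth_on UNIV h" for h :: "complex \<Rightarrow> real"
  proof -
    have h: "(h has_derivative frechet_derivative h (at (\<Phi> x))) (at (\<Phi> x))"
      using smooth_on_differentiable[OF that, of "\<Phi> x"] by (simp add: frechet_derivative_works[symmetric])
    then have "linear (frechet_derivative h (at (\<Phi> x)))" using has_derivative_linear by blast
    then have "(\<lambda>u. frechet_derivative h (at (\<Phi> x)) (df u *\<^sub>R 1 + dg u *\<^sub>R \<i>))
       = (\<lambda>u. frechet_derivative h (at (\<Phi> x)) 1 * df u + frechet_derivative h (at (\<Phi> x)) \<i> * dg u)"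
      by (simp only: linear_add linear_scale) (simp add: mult.commute)
    moreover have "((\<lambda>y. h (\<Phi> (\<psi> y))) has_derivative
        (\<lambda>u. frechet_derivative h (at (\<Phi> x)) (df u *\<^sub>R 1 + dg u *\<^sub>R \<i>))) (at (\<phi> x))"
      using has_derivative_compose[OF D] h \<psi>x by simp
    ultimately show ?thesis using frechet_derivative_at by metis
  qed
  have "smooth_on UNIV (\<lambda>z. Re (\<Psi> z))" "smooth_on UNIV (\<lambda>z. Im (\<Psi> z))"
    using \<Psi> by (auto simp: smooth_map_on_complex_iff)
  from comp[OF this(1)] comp[OF this(2)] show ?thesis
    unfolding P using bracket_linear_comb[OF lin]
    by (simp add: \<psi>_def[symmetric] df_def[symmetric] dg_def[symmetric] jac_def)
qed

lemma poisson_cong: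
  assumes "openin T V" "x \<in> V" "\<And>y. y \<in> V \<Longrightarrow> f y = f' y" "\<And>y. y \<in> V \<Longrightarrow> g y = g' y"
  shows "poisson A om f g x = poisson A om f' g' x"
proof -
  have "x \<in> topspace T" using assms(1,2) openin_subset by blast
  then obtain U \<phi> where c: "(U, \<phi>) \<in> A" "x \<in> U"
    and P: "\<And>f g. poisson A om f g x = bracket (om (U, \<phi>) (\<phi> x))
       (frechet_derivative (\<lambda>y. f (inv_into U \<phi> y)) (at (\<phi> x)))
       (frechet_derivative (\<lambda>y. g (inv_into U \<phi> y)) (at (\<phi> x)))"
    using poisson_chart by blast
  have inv: "inv_into U \<phi> y \<in> V" if "y \<in> \<phi> ` (U \<inter> V)" for y
    using that chart(4)[OF c(1)] by auto
  have *: "frechet_derivative (\<lambda>y. f (inv_into U \<phi> y)) (at (\<phi> x)) = frechet_derivative (\<lambda>y. f' (inv_into U \<phi> y)) (at (\<phi> x))"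
    if "\<And>y. y \<in> V \<Longrightarrow> f y = f' y" for f f' :: "'a \<Rightarrow> real"
    by (rule frechet_derivative_cong_open[OF open_chart_image[OF c(1) assms(1)]])
       (use c(2) assms(2) that inv in auto)
  show ?thesis unfolding P by (simp only: *[of f f', OF assms(3)] *[of g g', OF assms(4)])
qed

text \<open>Differentiating the affine relation makes the two differentials proportional, so their
  Hamiltonian vectors are parallel.\<close>

lemma poisson_on_line:
  assumes V: "openin T V" "x \<in> V" and fg: "smooth_fun T A f" "smooth_fun T A g"
    and line: "\<And>y. y \<in> V \<Longrightarrow> p * f y = q * g y + c" and "p \<noteq> 0 \<or> q \<noteq> 0"
  shows "poisson A om f g x = 0"
proof -
  have "x \<in> topspace T" using assms(1,2) openin_subset by blast
  then obtain U \<phi> where c: "(U, \<phi>) \<in> A" "x \<in> U"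
    and P: "\<And>f g. poisson A om f g x = bracket (om (U, \<phi>) (\<phi> x))
       (frechet_derivative (\<lambda>y. f (inv_into U \<phi> y)) (at (\<phi> x)))
       (frechet_derivative (\<lambda>y. g (inv_into U \<phi> y)) (at (\<phi> x)))"
    using poisson_chart by blast
  interpret symplectic_form "om (U, \<phi>) (\<phi> x)" by (rule symplectic_form_chart[OF c])
  note df = smooth_fun_has_derivative[OF fg(1) c] and dg = smooth_fun_has_derivative[OF fg(2) c]
  let ?O = "\<phi> ` (U \<inter> V)"
  have O: "open ?O" "\<phi> x \<in> ?O" using open_chart_image[OF c(1) V(1)] c V by auto
  have inv: "inv_into U \<phi> y \<in> V" if "y \<in> ?O" for y
    using that chart(4)[OF c(1)] by auto
  have D1: "((\<lambda>y. p * f (inv_into U \<phi> y)) has_derivative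
      (\<lambda>u. p * frechet_derivative (\<lambda>y. f (inv_into U \<phi> y)) (at (\<phi> x)) u)) (at (\<phi> x))"
    by (intro derivative_intros df)
  have D2: "((\<lambda>y. p * f (inv_into U \<phi> y)) has_derivative
      (\<lambda>u. q * frechet_derivative (\<lambda>y. g (inv_into U \<phi> y)) (at (\<phi> x)) u)) (at (\<phi> x))"
  proof (rule has_derivative_transform_within_open[OF _ O])
    show "((\<lambda>y. q * g (inv_into U \<phi> y) + c) has_derivative
      (\<lambda>u. q * frechet_derivative (\<lambda>y. g (inv_into U \<phi> y)) (at (\<phi> x)) u)) (at (\<phi> x))"
      by (auto intro!: derivative_eq_intros dg)
  qed (use line inv in auto)
  have "p * frechet_derivative (\<lambda>y. f (inv_into U \<phi> y)) (at (\<phi> x)) u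
     = q * frechet_derivative (\<lambda>y. g (inv_into U \<phi> y)) (at (\<phi> x)) u" for u
    by (rule fun_cong[OF has_derivative_unique[OF D1 D2]])
  then show ?thesis
    unfolding P using df dg has_derivative_linear assms(6) by (intro bracket_dependent[of _ _ p q]) blast+
qed

text \<open>A radial bump in one chart, extended by zero. In any other chart it is smooth at points
  of \<open>U\<close> by the transition map, and elsewhere because it vanishes on the complement of
  the compact set \<open>K\<close>.\<close>

lemma bump_at_point:
  assumes "openin T V" "x \<in> V"
  obtains f K W where "smooth_fun T A f" "\<And>y. 0 \<le> f y" "compactin T K" "K \<subseteq> V"
    "\<And>y. y \<in> topspace T - K \<Longrightarrow> f y = 0" "openin T W" "x \<in> W" "\<And>y. y \<in> W \<Longrightarrow> f y = 1"
proof -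
  have "x \<in> topspace T" using assms openin_subset by blast
  then obtain U \<phi> where c: "(U, \<phi>) \<in> A" "x \<in> U" using chart_ex by blast
  note c' = chart[OF c(1)]
  have "open (\<phi> ` (U \<inter> V))" "\<phi> x \<in> \<phi> ` (U \<inter> V)"
    using open_chart_image[OF c(1) assms(1)] c(2) assms(2) by auto
  then obtain r where r: "r > 0" "cball (\<phi> x) r \<subseteq> \<phi> ` (U \<inter> V)"
    using open_contains_cball by blast
  \<comment> \<open>The squared distance is spelled out in coordinates, which makes it visibly a
    polynomial.\<close>
  define b where "b z = step (1 - (\<Sum>i\<in>Basis. ((z - \<phi> x) \<bullet> i) ^ 2) / r ^ 2)" for z
  have b_alt: "b z = step (1 - (dist (\<phi> x) z / r) ^ 2)" for z
    unfolding b_def dist_norm by (subst norm_minus_commute)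
      (simp add: norm_eq_sqrt_inner euclidean_inner[of "z - \<phi> x" "z - \<phi> x"] power2_eq_square sum_nonneg power_divide)
  have b_smooth: "smooth_on UNIV b"
    unfolding b_def inner_diff_left using r(1) by (intro smooth_on_step_compose smooth_intros open_UNIV) auto
  define f where "f y = (if y \<in> U then b (\<phi> y) else 0)" for y
  define K where "K = inv_into U \<phi> ` cball (\<phi> x) r"
  define W where "W = {y \<in> U. \<phi> y \<in> ball (\<phi> x) (r / 2)}"
  have cont: "continuous_map (top_of_set (\<phi> ` U)) (subtopology T U) (inv_into U \<phi>)"
  proof -
    obtain g where g: "homeomorphic_maps (subtopology T U) (top_of_set (\<phi> ` U)) \<phi> g"
      using c'(3) homeomorphic_map_maps by blast
    then have gy: "g (\<phi> y) = y" if "y \<in> U" for y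
      using that c'(5) by (auto simp: homeomorphic_maps_def)
    have eq: "g z = inv_into U \<phi> z" if z: "z \<in> \<phi> ` U" for z
    proof -
      obtain y where "y \<in> U" "z = \<phi> y" using z by blast
      then show ?thesis using gy[of y] c'(4) by simp
    qed
    have "continuous_map (top_of_set (\<phi> ` U)) (subtopology T U) g"
      using g by (simp add: homeomorphic_maps_def)
    then show ?thesis by (rule continuous_map_eq) (simp add: eq)
  qed
  have sub: "cball (\<phi> x) r \<subseteq> \<phi> ` U" using r(2) by blast
  have "compactin (top_of_set (\<phi> ` U)) (cball (\<phi> x) r)"
    using sub by (simp add: compactin_subtopology)
  then have "compactin (subtopology T U) K"
    unfolding K_def using cont image_compactin by blast
  then have K: "compactin T K" by (simp add: compactin_subtopology)
  have KV: "K \<subseteq> V"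
    unfolding K_def using r(2) c'(4) by (force simp: image_iff)
  have W: "openin T W"
  proof -
    have "continuous_map (subtopology T U) (top_of_set (\<phi> ` U)) \<phi>"
      using c'(3) homeomorphic_imp_continuous_map by blast
    moreover have "openin (top_of_set (\<phi> ` U)) (\<phi> ` U \<inter> ball (\<phi> x) (r/2))" by blast
    ultimately have "openin (subtopology T U) {y \<in> topspace (subtopology T U). \<phi> y \<in> \<phi> ` U \<inter> ball (\<phi> x) (r/2)}"
      using openin_continuous_map_preimage by blast
    moreover have "{y \<in> topspace (subtopology T U). \<phi> y \<in> \<phi> ` U \<inter> ball (\<phi> x) (r/2)} = W"
      using c'(5) by (auto simp: W_def topspace_subtopology_subset)
    ultimately show ?thesis using c'(1) openin_trans_full by metis
  qed
  have f0: "f y = 0" if "y \<in> topspace T - K" for y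
  proof (cases "y \<in> U")
    case True
    have "\<phi> y \<notin> cball (\<phi> x) r"
      using that True c'(4) unfolding K_def by (metis DiffD2 imageI inv_into_f_f)
    then have "1 < dist (\<phi> x) (\<phi> y) / r" using r(1) by simp
    then have "1 \<le> (dist (\<phi> x) (\<phi> y) / r)^2" by (simp add: one_le_power)
    then show ?thesis using True by (simp add: f_def b_alt step_0)
  qed (simp add: f_def)
  \<comment> \<open>The Hausdorff property enters here: \<open>K\<close> is closed, so the region
    where \<open>f\<close> vanishes is open and the extension by zero is smooth across the edge of
    the chart.\<close>
  have Kcl: "openin T (topspace T - K)"
    using compactin_imp_closedin[OF Hausdorff K] by blast
  have "smooth_fun T A f"
  proof (rule smooth_funI, rule smooth_on_local)
    fix U' \<phi>' z assume d: "(U', \<phi>') \<in> A" and "z \<in> \<phi>' ` U'"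
    then obtain y where y: "y \<in> U'" "z = \<phi>' y" by blast
    note d' = chart[OF d]
    show "\<exists>V g. open V \<and> z \<in> V \<and> smooth_on V g \<and> (\<forall>y\<in>V. f (inv_into U' \<phi>' y) = g y)"
    proof (cases "y \<in> U")
      case True
      let ?V = "\<phi>' ` (U' \<inter> U)"
      have "open ?V" using open_chart_image[OF d c'(1)] .
      moreover have "smooth_on ?V (\<lambda>z. b ((\<phi> \<circ> inv_into (U' \<inter> U) \<phi>') z))"
        by (rule smooth_on_compose_map[OF \<open>open ?V\<close> open_UNIV _ b_smooth transition_smooth[OF d c(1)]]) simp
      moreover have "\<forall>z\<in>?V. f (inv_into U' \<phi>' z) = b ((\<phi> \<circ> inv_into (U' \<inter> U) \<phi>') z)"
        using d'(4) by (auto simp: f_def inj_on_Int)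
      ultimately show ?thesis using True y by blast
    next
      case False
      let ?V = "\<phi>' ` (U' \<inter> (topspace T - K))"
      have "K \<subseteq> U" unfolding K_def using sub by (auto intro: inv_into_into)
      then have "z \<in> ?V" using False y d'(5) by blast
      moreover have "\<forall>z\<in>?V. f (inv_into U' \<phi>' z) = 0"
        using d'(4) f0 by auto
      moreover have "open ?V" by (rule open_chart_image[OF d Kcl])
      ultimately show ?thesis using smooth_on_const[of ?V 0] by blast
    qed
  qed
  moreover have "0 \<le> f y" for y by (simp add: f_def b_def step_range)
  moreover have "f y = 1" if "y \<in> W" for y
  proof -
    \<comment> \<open>Within half the radius the argument of \<open>step\<close> is at least 3/4,
      beyond the threshold 2/3.\<close>
    have "dist (\<phi> x) (\<phi> y) / r < 1/2" using that r(1) by (simp add: W_def divide_simps)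
    then have "(dist (\<phi> x) (\<phi> y) / r)^2 \<le> (1/2)^2" using r(1) by (intro power_mono) auto
    then have "1 - (dist (\<phi> x) (\<phi> y) / r)^2 \<ge> 2/3" by (simp add: power2_eq_square)
    then show ?thesis using that by (auto simp: f_def W_def b_alt step_1)
  qed
  moreover have "x \<in> W" using c(2) r(1) by (simp add: W_def)
  ultimately show ?thesis using that K KV f0 W by blast
qed

text \<open>Finitely many neighbourhoods on which a point bump equals 1 cover \<open>C\<close>. The
  sum of these bumps is at least 1 near \<open>C\<close> and vanishes off a compact subset of
  \<open>V\<close>.\<close>

lemma smooth_Urysohn:
  assumes "openin T V" "compactin T C" "C \<subseteq> V"
  obtains u K W where "smooth_fun T A u" "\<And>y. 0 \<le> u y" "\<And>y. u y \<le> 1" "compactin T K" "K \<subseteq> V"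
    "\<And>y. y \<in> topspace T - K \<Longrightarrow> u y = 0" "openin T W" "C \<subseteq> W" "\<And>y. y \<in> W \<Longrightarrow> u y = 1"
proof -
  define P where "P x f K W \<longleftrightarrow> smooth_fun T A f \<and> (\<forall>y. 0 \<le> f y) \<and> compactin T K \<and> K \<subseteq> V \<and>
    (\<forall>y \<in> topspace T - K. f y = 0) \<and> openin T W \<and> x \<in> W \<and> (\<forall>y\<in>W. f y = (1::real))" for x f K W
  have "\<exists>f K W. P x f K W" if "x \<in> C" for x
  proof -
    have "x \<in> V" using that assms(3) by blast
    then show ?thesis
      using bump_at_point[OF assms(1), of x] unfolding P_def by metis
  qed
  then obtain f K W where fKW: "\<And>x. x \<in> C \<Longrightarrow> P x (f x) (K x) (W x)" by metis
  have "openin T (W x)" "x \<in> W x" if "x \<in> C" for x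
    using fKW[OF that] by (simp_all add: P_def)
  then have "(\<forall>U\<in>W ` C. openin T U) \<and> C \<subseteq> \<Union>(W ` C)" by blast
  then obtain \<F> where \<F>: "finite \<F>" "\<F> \<subseteq> W ` C" "C \<subseteq> \<Union>\<F>"
    using assms(2) unfolding compactin_def by meson
  then obtain I where "finite I" "I \<subseteq> C" "\<F> = W ` I"
    using finite_subset_image by metis
  with \<F> have I: "finite I" "I \<subseteq> C" "C \<subseteq> (\<Union>x\<in>I. W x)" by auto
  have P: "P x (f x) (K x) (W x)" if "x \<in> I" for x using fKW I that by blast
  \<comment> \<open>Applying \<open>step\<close> turns the sum into a function with values between 0
    and 1 that is still 0 where the sum is 0 and is 1 where the sum is at least 1.\<close>
  define u where "u y = step (\<Sum>x\<in>I. f x y)" for y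
  show ?thesis
  proof (rule that[of u "\<Union>x\<in>I. K x" "\<Union>x\<in>I. W x"])
    show "smooth_fun T A u"
      unfolding u_def using P
      by (intro smooth_fun_real_compose[OF smooth_on_step] smooth_fun_sum) (auto simp: P_def)
    show "compactin T (\<Union>x\<in>I. K x)"
      using I(1) P by (intro compactin_Union) (auto simp: P_def)
    show "u y = 0" if "y \<in> topspace T - (\<Union>x\<in>I. K x)" for y
      using that P by (auto simp: u_def P_def step_0)
    show "u y = 1" if "y \<in> (\<Union>x\<in>I. W x)" for y
    proof -
      obtain x where x: "x \<in> I" "y \<in> W x" using \<open>y \<in> _\<close> by blast
      then have "1 = f x y" using P by (auto simp: P_def)
      also have "\<dots> \<le> (\<Sum>x\<in>I. f x y)" using I(1) x P by (intro member_le_sum) (auto simp: P_def)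
      finally show ?thesis by (simp add: u_def step_1)
    qed
    show "(\<Union>x\<in>I. K x) \<subseteq> V" using P unfolding P_def by blast
    show "openin T (\<Union>x\<in>I. W x)" using P unfolding P_def by blast
  qed (use I in \<open>auto simp: u_def step_range\<close>)
qed

end

text \<open>\<open>FPb\<close> with arbitrary plane sets in place of the arcs of a datum, so that
  arcs given by intervals of angles and merged arcs fit as well.\<close>

definition plane_maps ::
  "'a topology \<Rightarrow> ('a,'e::euclidean_space) chart set \<Rightarrow> complex set \<Rightarrow> nat
   \<Rightarrow> (nat \<Rightarrow> complex set) \<Rightarrow> (nat \<Rightarrow> 'a set) \<Rightarrow> ('a \<Rightarrow> complex) set" where
  "plane_maps T A D n \<gamma> X =
     {\<Phi>. smooth_fun T A (\<lambda>x. Re (\<Phi> x)) \<and> smooth_fun T A (\<lambda>x. Im (\<Phi> x)) \<and>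
          \<Phi> ` topspace T \<subseteq> D \<and>
          (\<exists>z\<in>D. \<exists>K. compactin T K \<and> (\<forall>x\<in>topspace T - K. \<Phi> x = z)) \<and>
          (\<forall>i<n. \<exists>U. openin T U \<and> X i \<subseteq> U \<and> \<Phi> ` U \<subseteq> \<gamma> i)}"

lemma plane_mapsI:
  assumes "smooth_fun T A (\<lambda>x. Re (\<Phi> x))" "smooth_fun T A (\<lambda>x. Im (\<Phi> x))" "\<Phi> ` topspace T \<subseteq> D"
    and "z \<in> D" "compactin T K" "\<And>x. x \<in> topspace T - K \<Longrightarrow> \<Phi> x = z"
    and "\<And>i. i < n \<Longrightarrow> \<exists>U. openin T U \<and> X i \<subseteq> U \<and> \<Phi> ` U \<subseteq> \<gamma> i"
  shows "\<Phi> \<in> plane_maps T A D n \<gamma> X"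
proof -
  have "\<exists>z\<in>D. \<exists>K. compactin T K \<and> (\<forall>x\<in>topspace T - K. \<Phi> x = z)"
    using assms(4-6) by (intro bexI[of _ z] exI[of _ K]) auto
  then show ?thesis using assms(1-3,7) by (simp add: plane_maps_def)
qed

lemma FPb_eq_plane_maps: "FPb T A D cc N p X = plane_maps T A D N (arc D cc N p) X"
  by (simp add: FPb_def plane_maps_def)

definition poisson_norm ::
  "'a topology \<Rightarrow> ('a,'e::euclidean_space) chart set \<Rightarrow> (('a,'e) chart \<Rightarrow> 'e \<Rightarrow> 'e \<Rightarrow> 'e \<Rightarrow> real)
   \<Rightarrow> ('a \<Rightarrow> complex) \<Rightarrow> ennreal" where
  "poisson_norm T A om \<Phi> =
     (SUP x\<in>topspace T. ennreal \<bar>poisson A om (\<lambda>x. Re (\<Phi> x)) (\<lambda>x. Im (\<Phi> x)) x\<bar>)"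

lemma Pb_eq_poisson_norm:
  "Pb T A om D cc N p X = (INF \<Phi>\<in>plane_maps T A D N (arc D cc N p) X. poisson_norm T A om \<Phi>)"
  by (simp add: Pb_def FPb_eq_plane_maps poisson_norm_def)

section \<open>Composition with plane maps, and the splitting of an arc\<close>

context symplectic
begin

lemma plane_maps_compose:
  assumes "\<Phi> \<in> plane_maps T A D n \<gamma> X" and "smooth_map_on UNIV \<Psi>" "\<Psi> ` D \<subseteq> D'"
    and "\<And>i. i < n \<Longrightarrow> \<Psi> ` \<gamma> i \<subseteq> \<gamma>' i"
  shows "(\<lambda>x. \<Psi> (\<Phi> x)) \<in> plane_maps T A D' n \<gamma>' X"
proof -
  have \<Phi>: "smooth_fun T A (\<lambda>x. Re (\<Phi> x))" "smooth_fun T A (\<lambda>x. Im (\<Phi> x))" "\<Phi> ` topspace T \<subseteq> D"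
    "\<And>i. i < n \<Longrightarrow> \<exists>U. openin T U \<and> X i \<subseteq> U \<and> \<Phi> ` U \<subseteq> \<gamma> i"
    using assms(1) by (simp_all add: plane_maps_def)
  obtain z K where z: "z \<in> D" "compactin T K" "\<forall>x\<in>topspace T - K. \<Phi> x = z"
    using assms(1) unfolding plane_maps_def by blast
  have "smooth_on UNIV (\<lambda>z. Re (\<Psi> z))" "smooth_on UNIV (\<lambda>z. Im (\<Psi> z))"
    using assms(2) by (auto simp: smooth_map_on_complex_iff)
  then have "smooth_fun T A (\<lambda>x. Re (\<Psi> (\<Phi> x)))" "smooth_fun T A (\<lambda>x. Im (\<Psi> (\<Phi> x)))"
    using smooth_fun_compose \<Phi>(1,2) by blast+
  moreover have "(\<lambda>x. \<Psi> (\<Phi> x)) ` topspace T \<subseteq> D'" using \<Phi>(3) assms(3) by blast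
  moreover have "\<Psi> z \<in> D'" "\<forall>x\<in>topspace T - K. \<Psi> (\<Phi> x) = \<Psi> z" using z assms(3) by auto
  moreover have "\<exists>U. openin T U \<and> X i \<subseteq> U \<and> (\<lambda>x. \<Psi> (\<Phi> x)) ` U \<subseteq> \<gamma>' i" if i: "i < n" for i
  proof -
    obtain U where "openin T U" "X i \<subseteq> U" "\<Phi> ` U \<subseteq> \<gamma> i" using \<Phi>(4)[OF i] by blast
    then show ?thesis using assms(4)[OF i] by (intro exI[of _ U]) auto
  qed
  ultimately show ?thesis using z(2) by (intro plane_mapsI[of T A _ D' "\<Psi> z" K]) simp_all
qed

lemma poisson_norm_compose:
  assumes "\<Phi> \<in> plane_maps T A D n \<gamma> X" and "smooth_map_on UNIV \<Psi>"
    and "\<And>z. z \<in> D \<Longrightarrow> \<bar>jac \<Psi> z\<bar> \<le> C"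
  shows "poisson_norm T A om (\<lambda>x. \<Psi> (\<Phi> x)) \<le> ennreal C * poisson_norm T A om \<Phi>"
  unfolding poisson_norm_def
proof (rule SUP_least)
  fix x assume x: "x \<in> topspace T"
  let ?p = "poisson A om (\<lambda>x. Re (\<Phi> x)) (\<lambda>x. Im (\<Phi> x)) x"
  have \<Phi>: "smooth_fun T A (\<lambda>x. Re (\<Phi> x))" "smooth_fun T A (\<lambda>x. Im (\<Phi> x))" "\<Phi> x \<in> D"
    using assms(1) x by (auto simp: plane_maps_def)
  have "ennreal \<bar>poisson A om (\<lambda>x. Re (\<Psi> (\<Phi> x))) (\<lambda>x. Im (\<Psi> (\<Phi> x))) x\<bar> = ennreal (\<bar>jac \<Psi> (\<Phi> x)\<bar> * \<bar>?p\<bar>)"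
    by (simp add: poisson_compose[OF x \<Phi>(1,2) assms(2)] abs_mult)
  also have "\<dots> \<le> ennreal (C * \<bar>?p\<bar>)"
    using assms(3)[OF \<Phi>(3)] by (intro ennreal_leI mult_right_mono) auto
  also have "\<dots> = ennreal C * ennreal \<bar>?p\<bar>"
    using assms(3)[OF \<Phi>(3)] by (intro ennreal_mult) auto
  also have "\<dots> \<le> ennreal C * (SUP x\<in>topspace T. ennreal \<bar>poisson A om (\<lambda>x. Re (\<Phi> x)) (\<lambda>x. Im (\<Phi> x)) x\<bar>)"
    using x by (intro mult_left_mono SUP_upper) auto
  finally show "ennreal \<bar>poisson A om (\<lambda>x. Re (\<Psi> (\<Phi> x))) (\<lambda>x. Im (\<Psi> (\<Phi> x))) x\<bar> \<le>
    ennreal C * (SUP x\<in>topspace T. ennreal \<bar>poisson A om (\<lambda>x. Re (\<Phi> x)) (\<lambda>x. Im (\<Phi> x)) x\<bar>)" .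
qed

text \<open>On the open set where \<open>\<Phi>\<close> already takes values in the segment from \<open>a\<close> to \<open>b\<close>, it may be
  moved freely inside that segment: the bracket vanishes there before and after.\<close>

lemma split_arc:
  assumes \<Phi>: "\<Phi> \<in> plane_maps T A D n \<gamma> X'" and n: "n \<ge> 3"
    and X: "\<And>i. i \<le> n \<Longrightarrow> compactin T (X i)" "X (n - 1) \<inter> X 0 = {}" "X n \<inter> X (n - 2) = {}"
    and X': "\<And>i. i < n - 1 \<Longrightarrow> X' i = X i" "X' (n - 1) = X (n - 1) \<union> X n"
    and D: "convex D" "a \<in> D" "b \<in> D" "a \<noteq> b"
    and seg: "\<gamma> (n - 1) \<subseteq> closed_segment a b"
      "\<gamma> 0 \<inter> closed_segment a b \<subseteq> {b}" "\<gamma> (n - 2) \<inter> closed_segment a b \<subseteq> {a}"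
      "\<And>i. 0 < i \<Longrightarrow> i < n - 2 \<Longrightarrow> \<gamma> i \<inter> closed_segment a b = {}"
    and \<gamma>': "\<And>i. i < n - 1 \<Longrightarrow> \<gamma>' i = \<gamma> i"
      "closed_segment a (midpoint a b) \<subseteq> \<gamma>' (n - 1)" "closed_segment (midpoint a b) b \<subseteq> \<gamma>' n"
  shows "\<exists>\<Phi>'\<in>plane_maps T A D (Suc n) \<gamma>' X. poisson_norm T A om \<Phi>' \<le> poisson_norm T A om \<Phi>"
proof -
  define m where "m = midpoint a b"
  have m: "m \<in> closed_segment a b" by (simp add: m_def)
  have S: "closed_segment a b \<subseteq> D" using D by (simp add: closed_segment_subset)
  have \<Phi>': "smooth_fun T A (\<lambda>x. Re (\<Phi> x))" "smooth_fun T A (\<lambda>x. Im (\<Phi> x))" "\<Phi> ` topspace T \<subseteq> D"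
    "\<And>i. i < n \<Longrightarrow> \<exists>U. openin T U \<and> X' i \<subseteq> U \<and> \<Phi> ` U \<subseteq> \<gamma> i"
    using \<Phi> by (simp_all add: plane_maps_def)
  obtain z K where z: "z \<in> D" "compactin T K" "\<forall>x\<in>topspace T - K. \<Phi> x = z"
    using \<Phi> unfolding plane_maps_def by blast
  obtain U where U: "openin T U" "X (n - 1) \<union> X n \<subseteq> U" "\<Phi> ` U \<subseteq> \<gamma> (n - 1)"
    using \<Phi>'(4)[of "n - 1"] X'(2) n by auto
  then have \<Phi>U: "\<Phi> y \<in> closed_segment a b" if "y \<in> U" for y using seg(1) that by blast
  have cl: "closedin T (X i)" if "i \<le> n" for i using X(1)[OF that] Hausdorff compactin_imp_closedin by blast
  have "openin T (U - X 0)" "X (n - 1) \<subseteq> U - X 0" "openin T (U - X (n - 2))" "X n \<subseteq> U - X (n - 2)"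
    using cl U X by (auto intro: openin_diff)
  note V = this
  obtain u Ku Wu where u: "smooth_fun T A u" "\<And>y. 0 \<le> u y" "\<And>y. u y \<le> 1" "compactin T Ku" "Ku \<subseteq> U - X 0"
    "\<And>y. y \<in> topspace T - Ku \<Longrightarrow> u y = 0" "openin T Wu" "X (n - 1) \<subseteq> Wu" "\<And>y. y \<in> Wu \<Longrightarrow> u y = 1"
    using smooth_Urysohn[OF V(1) X(1) V(2)] by (metis diff_le_self)
  obtain v Kv Wv where v: "smooth_fun T A v" "\<And>y. 0 \<le> v y" "\<And>y. v y \<le> 1" "compactin T Kv" "Kv \<subseteq> U - X (n - 2)"
    "\<And>y. y \<in> topspace T - Kv \<Longrightarrow> v y = 0" "openin T Wv" "X n \<subseteq> Wv" "\<And>y. y \<in> Wv \<Longrightarrow> v y = 1"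
    using smooth_Urysohn[OF V(3) X(1) V(4)] by (metis order_refl)
  \<comment> \<open>Bilinear interpolation in (u, v) with corner values \<Phi> at (0,0),
    \<open>b\<close> at (0,1), \<open>a\<close> at (1,0) and \<open>m\<close> at (1,1). The side u =
    1 gives the segment from \<open>a\<close> to \<open>m\<close>, the side v = 1 the segment from
    \<open>m\<close> to \<open>b\<close>.\<close>
  define \<Psi> where "\<Psi> x = (1 - u x) *\<^sub>R ((1 - v x) *\<^sub>R \<Phi> x + v x *\<^sub>R b) + u x *\<^sub>R ((1 - v x) *\<^sub>R a + v x *\<^sub>R m)" for x
  have \<Psi>_in: "\<Psi> x \<in> S" if "convex S" "\<Phi> x \<in> S" "a \<in> S" "b \<in> S" "m \<in> S" for x S
    unfolding \<Psi>_def using that u(2,3) v(2,3) by (intro convexD) auto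
  have \<Psi>U: "\<Psi> y \<in> closed_segment a b" if "y \<in> U" for y
    using \<Phi>U[OF that] m by (intro \<Psi>_in) auto
  have \<Psi>0: "\<Psi> y = \<Phi> y" if "y \<in> topspace T - Ku - Kv" for y
    using that by (simp add: \<Psi>_def u(6) v(6))
  have diff: "smooth_fun T A (\<lambda>x. 1 - f x)" if "smooth_fun T A f" for f
    using smooth_fun_arith(1)[OF smooth_fun_const[of 1] smooth_fun_arith(2)[OF smooth_fun_const[of "-1"] that]] by simp
  have smooth: "smooth_fun T A (\<lambda>x. Re (\<Psi> x))" "smooth_fun T A (\<lambda>x. Im (\<Psi> x))"
    unfolding \<Psi>_def by (simp_all, (intro smooth_fun_arith smooth_fun_const diff u(1) v(1) \<Phi>'(1,2))+)
  have clK: "closedin T Ku" "closedin T Kv"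
    using u(4) v(4) Hausdorff compactin_imp_closedin by blast+
  have "\<Psi> \<in> plane_maps T A D (Suc n) \<gamma>' X"
  proof (rule plane_mapsI[OF smooth, where z=z and K="K \<union> Ku \<union> Kv"])
    show "\<Psi> ` topspace T \<subseteq> D"
      using \<Phi>'(3) D S m by (auto intro!: \<Psi>_in)
    show "\<Psi> x = z" if "x \<in> topspace T - (K \<union> Ku \<union> Kv)" for x using that z(3) by (simp add: \<Psi>0)
    show "compactin T (K \<union> Ku \<union> Kv)" using z(2) u(4) v(4) by (intro compactin_Un)
    show "z \<in> D" by (rule z)
    fix i assume i: "i < Suc n"
    consider "i = n" | "i = n - 1" | "i = 0" | "i = n - 2" "i \<noteq> 0" | "0 < i" "i < n - 2" using i by linarith
    then show "\<exists>U. openin T U \<and> X i \<subseteq> U \<and> \<Psi> ` U \<subseteq> \<gamma>' i"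
    proof cases
      case 1
      have "\<Psi> y \<in> closed_segment m b" if "y \<in> Wv" for y
        using u(2,3) v(9)[OF that] by (auto simp: \<Psi>_def in_segment add.commute intro!: exI[of _ "1 - u y"])
      then show ?thesis using 1 v(7,8) \<gamma>'(3) unfolding m_def by blast
    next
      case 2
      have "\<Psi> y \<in> closed_segment a m" if "y \<in> Wu" for y
        using v(2,3) u(9)[OF that] by (auto simp: \<Psi>_def in_segment intro!: exI[of _ "v y"])
      then show ?thesis using 2 u(7,8) \<gamma>'(2) unfolding m_def by blast
    next
      case 3
      then have "X' i = X i" "\<gamma>' i = \<gamma> i" using n X'(1) \<gamma>'(1) by auto
      then obtain Q where Q: "openin T Q" "X i \<subseteq> Q" "\<Phi> ` Q \<subseteq> \<gamma> i"
        using \<Phi>'(4)[of i] 3 n by auto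
      have "\<Psi> y \<in> \<gamma> i" if y: "y \<in> Q - Ku" for y
      proof -
        have yT: "y \<in> topspace T" using y Q(1) openin_subset by blast
        have "\<Phi> y \<in> \<gamma> i" using y Q(3) by blast
        show ?thesis
        proof (cases "y \<in> Kv")
          case True
          \<comment> \<open>Near \<open>X 0\<close> only \<open>v\<close> can be active, and where
            it is, \<Phi> lies both in the first arc and in the segment, hence already at
            \<open>b\<close>; pulling it towards \<open>b\<close> changes nothing. The case of
            \<open>X (n - 2)\<close> is the mirror image with \<open>u\<close> and
            \<open>a\<close>.\<close>
          then have "\<Phi> y = b" using v(5) \<Phi>U[of y] \<open>\<Phi> y \<in> \<gamma> i\<close> seg(2) 3 by blast
          then have "\<Psi> y = \<Phi> y" using y yT by (simp add: \<Psi>_def u(6) flip: scaleR_add_left)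
          then show ?thesis using \<open>\<Phi> y \<in> \<gamma> i\<close> by simp
        next
          case False
          then show ?thesis using \<Psi>0[of y] y yT \<open>\<Phi> y \<in> \<gamma> i\<close> by auto
        qed
      qed
      moreover have "openin T (Q - Ku)" using Q(1) clK by blast
      moreover have "X i \<subseteq> Q - Ku" using Q(2) u(5) 3 by blast
      ultimately show ?thesis using \<open>\<gamma>' i = \<gamma> i\<close> by (intro exI[of _ "Q - Ku"]) auto
    next
      case 4
      then have "X' i = X i" "\<gamma>' i = \<gamma> i" using n X'(1) \<gamma>'(1) by auto
      then obtain Q where Q: "openin T Q" "X i \<subseteq> Q" "\<Phi> ` Q \<subseteq> \<gamma> i"
        using \<Phi>'(4)[of i] 4 n by auto
      have "\<Psi> y \<in> \<gamma> i" if y: "y \<in> Q - Kv" for y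
      proof -
        have yT: "y \<in> topspace T" using y Q(1) openin_subset by blast
        have "\<Phi> y \<in> \<gamma> i" using y Q(3) by blast
        show ?thesis
        proof (cases "y \<in> Ku")
          case True
          then have "\<Phi> y = a" using u(5) \<Phi>U[of y] \<open>\<Phi> y \<in> \<gamma> i\<close> seg(3) 4 by blast
          then have "\<Psi> y = \<Phi> y" using y yT by (simp add: \<Psi>_def v(6) flip: scaleR_add_left)
          then show ?thesis using \<open>\<Phi> y \<in> \<gamma> i\<close> by simp
        next
          case False
          then show ?thesis using \<Psi>0[of y] y yT \<open>\<Phi> y \<in> \<gamma> i\<close> by auto
        qed
      qed
      moreover have "openin T (Q - Kv)" using Q(1) clK by blast
      moreover have "X i \<subseteq> Q - Kv" using Q(2) v(5) 4 by blast
      ultimately show ?thesis using \<open>\<gamma>' i = \<gamma> i\<close> by (intro exI[of _ "Q - Kv"]) auto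
    next
      case 5
      then have "i < n" "X' i = X i" "\<gamma>' i = \<gamma> i" using n X'(1) \<gamma>'(1) by auto
      then obtain Q where Q: "openin T Q" "X i \<subseteq> Q" "\<Phi> ` Q \<subseteq> \<gamma> i"
        using \<Phi>'(4)[of i] by auto
      have "\<Psi> y \<in> \<gamma> i" if y: "y \<in> Q" for y
      proof -
        have yT: "y \<in> topspace T" using y Q(1) openin_subset by blast
        have "\<Phi> y \<in> \<gamma> i" using y Q(3) by blast
        then have "y \<notin> U" using \<Phi>U[of y] seg(4) 5 by blast
        then have "y \<notin> Ku" "y \<notin> Kv" using u(5) v(5) by blast+
        then show ?thesis using \<Psi>0[of y] yT \<open>\<Phi> y \<in> \<gamma> i\<close> by auto
      qed
      then show ?thesis using Q \<open>\<gamma>' i = \<gamma> i\<close> by (intro exI[of _ Q]) auto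
    qed
  qed
  moreover have "poisson_norm T A om \<Psi> \<le> poisson_norm T A om \<Phi>"
    unfolding poisson_norm_def
  proof (rule SUP_mono)
    fix x assume x: "x \<in> topspace T"
    have "\<bar>poisson A om (\<lambda>x. Re (\<Psi> x)) (\<lambda>x. Im (\<Psi> x)) x\<bar> \<le> \<bar>poisson A om (\<lambda>x. Re (\<Phi> x)) (\<lambda>x. Im (\<Phi> x)) x\<bar>"
    proof (cases "x \<in> U")
      case True
      have "poisson A om (\<lambda>x. Re (\<Psi> x)) (\<lambda>x. Im (\<Psi> x)) x = 0"
      proof (rule poisson_on_line[OF U(1) True smooth])
        fix y assume "y \<in> U"
        then obtain t where t: "\<Psi> y = (1 - t) *\<^sub>R a + t *\<^sub>R b" using \<Psi>U by (auto simp: in_segment)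
        show "Im (b - a) * Re (\<Psi> y) = Re (b - a) * Im (\<Psi> y) + (Im (b - a) * Re a - Re (b - a) * Im a)"
          unfolding t by (simp add: algebra_simps)
      qed (use D(4) in \<open>auto simp: complex_eq_iff\<close>)
      then show ?thesis by simp
    next
      case False
      \<comment> \<open>\<open>Ku\<close> and \<open>Kv\<close> are closed and contained in
        \<open>U\<close>, so a point outside \<open>U\<close> has a neighbourhood on which \<Psi>
        and \<Phi> coincide.\<close>
      have "poisson A om (\<lambda>x. Re (\<Psi> x)) (\<lambda>x. Im (\<Psi> x)) x = poisson A om (\<lambda>x. Re (\<Phi> x)) (\<lambda>x. Im (\<Phi> x)) x"
        by (rule poisson_cong[of "topspace T - Ku - Kv"])
           (use clK x False u(5) v(5) \<Psi>0 in \<open>auto intro: openin_diff\<close>)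
      then show ?thesis by simp
    qed
    then show "\<exists>x'\<in>topspace T. ennreal \<bar>poisson A om (\<lambda>x. Re (\<Psi> x)) (\<lambda>x. Im (\<Psi> x)) x\<bar>
       \<le> ennreal \<bar>poisson A om (\<lambda>x. Re (\<Phi> x)) (\<lambda>x. Im (\<Phi> x)) x'\<bar>"
      using x ennreal_leI by blast
  qed
  ultimately show ?thesis by blast
qed

end

subsection \<open>Convex discs in polar coordinates\<close>

lemma cis_eqD: assumes "cis s = cis t" shows "\<exists>k::int. s = t + of_int k * (2 * pi)"
proof -
  have "cos s = cos t" "sin s = sin t" using assms by (simp_all add: complex_eq_iff)
  then have "cos (s - t) = 1" by (simp add: cos_diff)
  then obtain k :: int where "s - t = of_int k * 2 * pi" using cos_one_2pi_int by auto
  then show ?thesis by (intro exI[of _ k]) simp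
qed

lemma mult_pi_less: "a * (2 * pi) < b * (2 * pi) \<Longrightarrow> a < b"
  using mult_less_cancel_right_pos[of "2 * pi" a b] by simp

lemma cis_inj_on: "inj_on cis {x..<x + 2 * pi}"
proof (rule inj_onI)
  fix s t assume st: "s \<in> {x..<x + 2 * pi}" "t \<in> {x..<x + 2 * pi}" "cis s = cis t"
  then obtain k :: int where k: "s = t + of_int k * (2 * pi)" using cis_eqD by blast
  have "x \<le> s" "s < x + 2 * pi" "x \<le> t" "t < x + 2 * pi" using st by auto
  then have "of_int k * (2 * pi) < 1 * (2 * pi)" "(-1) * (2 * pi) < of_int k * (2 * pi)"
    unfolding k by linarith+
  then have "of_int k < (1::real)" "(-1::real) < of_int k" using mult_pi_less by blast+
  then have "k = 0" by linarith
  then show "s = t" using k by simp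
qed

text \<open>The radial function of \<open>D\<close> about \<open>cc\<close>: for nonzero directions,
  the reciprocal of the gauge (Minkowski functional) of \<open>D\<close> centred at
  \<open>cc\<close>.\<close>

definition reach :: "complex set \<Rightarrow> complex \<Rightarrow> complex \<Rightarrow> real" where
  "reach D cc z = Sup {r. 0 \<le> r \<and> cc + r *\<^sub>R z \<in> D}"

locale convex_disc =
  fixes D :: "complex set" and cc :: complex
  assumes comp: "compact D" and conv: "convex D" and int: "cc \<in> interior D"
begin

abbreviation "rad s \<equiv> reach D cc (cis s)"

definition bd :: "real \<Rightarrow> complex" where "bd s = cc + rad s *\<^sub>R cis s"

text \<open>A ray from the interior point meets the boundary exactly once: if it were in
  \<open>D\<close> further out, shrinking towards \<open>cc\<close> would make the first boundary
  point interior.\<close>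

lemma reach_props:
  assumes "z \<noteq> 0"
  shows "reach D cc z > 0"
    and "\<And>r. 0 \<le> r \<Longrightarrow> cc + r *\<^sub>R z \<in> D \<longleftrightarrow> r \<le> reach D cc z"
    and "\<And>r. 0 \<le> r \<Longrightarrow> cc + r *\<^sub>R z \<in> frontier D \<longleftrightarrow> r = reach D cc z"
    and "\<And>r. 0 \<le> r \<Longrightarrow> r < reach D cc z \<Longrightarrow> cc + r *\<^sub>R z \<in> interior D"
proof -
  obtain d where d: "d > 0" "cc + d *\<^sub>R z \<in> frontier D"
    "\<And>e. 0 \<le> e \<Longrightarrow> e < d \<Longrightarrow> cc + e *\<^sub>R z \<in> interior D"
    using ray_to_frontier[OF compact_imp_bounded[OF comp] int assms] by metis
  have cl: "closed D" by (rule compact_imp_closed[OF comp])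
  have fr: "cc + d *\<^sub>R z \<in> D" "cc + d *\<^sub>R z \<notin> interior D"
    using d(2) frontier_subset_closed[OF cl] by (auto simp: frontier_def)
  have out: "cc + r *\<^sub>R z \<notin> D" if "r > d" for r
  proof
    assume "cc + r *\<^sub>R z \<in> D"
    then have "cc + r *\<^sub>R z - (1 - d / r) *\<^sub>R (cc + r *\<^sub>R z - cc) \<in> interior D"
      using that d(1) by (intro mem_interior_convex_shrink[OF conv int]) auto
    moreover have "cc + r *\<^sub>R z - (1 - d / r) *\<^sub>R (cc + r *\<^sub>R z - cc) = cc + d *\<^sub>R z"
      using that d(1) by (simp add: algebra_simps)
    ultimately show False using fr(2) by metis
  qed
  have inD: "cc + r *\<^sub>R z \<in> D \<longleftrightarrow> r \<le> d" if "0 \<le> r" for r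
    using out[of r] fr(1) d(3)[OF that] interior_subset[of D] by (cases r d rule: linorder_cases) auto
  have "{r. 0 \<le> r \<and> cc + r *\<^sub>R z \<in> D} = {0..d}" using inD by auto
  then have R: "reach D cc z = d" using d(1) by (simp add: reach_def)
  show "reach D cc z > 0" "\<And>r. 0 \<le> r \<Longrightarrow> cc + r *\<^sub>R z \<in> D \<longleftrightarrow> r \<le> reach D cc z"
    "\<And>r. 0 \<le> r \<Longrightarrow> r < reach D cc z \<Longrightarrow> cc + r *\<^sub>R z \<in> interior D"
    using d inD by (auto simp: R)
  show "cc + r *\<^sub>R z \<in> frontier D \<longleftrightarrow> r = reach D cc z" if "0 \<le> r" for r
    using out[of r] d(2) d(3)[OF that] cl that
    by (cases r d rule: linorder_cases) (auto simp: R frontier_def)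
qed

lemma rad_pos [simp]: "rad s > 0"
  by (rule reach_props) simp

lemma bd_frontier: "bd s \<in> frontier D"
  using reach_props(3)[of "cis s" "rad s"] rad_pos[of s] by (simp add: bd_def less_imp_le)

lemma frontier_eq_bd:
  assumes "cc + r *\<^sub>R cis s \<in> frontier D" "r \<ge> 0"
  shows "cc + r *\<^sub>R cis s = bd s"
  using reach_props(3)[of "cis s" r] assms by (simp add: bd_def)

lemma frontier_bd_ex:
  assumes "z \<in> frontier D" shows "\<exists>s. a \<le> s \<and> s < a + 2 * pi \<and> z = bd s"
proof -
  define w where "w = (z - cc) / cis a"
  have "z = cc + norm (z - cc) *\<^sub>R cis (a + Arg2pi w)"
    using Arg2pi_eq[of w] by (simp add: w_def norm_divide cis_mult[symmetric] scaleR_conv_of_real exp_eq_polar field_simps)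
  then show ?thesis
    using frontier_eq_bd[of "norm (z - cc)" "a + Arg2pi w"] assms Arg2pi[of w]
    by (intro exI[of _ "a + Arg2pi w"]) auto
qed

lemma rad_period: "rad (s + 2 * pi) = rad s" and bd_period: "bd (s + 2 * pi) = bd s"
  by (simp_all add: bd_def cis.ctr complex_eq_iff)

lemma bd_inj: assumes "bd s = bd t" shows "cis s = cis t"
proof -
  have "rad s *\<^sub>R cis s = rad t *\<^sub>R cis t" using assms by (simp add: bd_def)
  moreover from arg_cong[OF this, of norm] have "rad s = rad t"
    using rad_pos[of s] rad_pos[of t] by (simp add: less_imp_le)
  ultimately show ?thesis using rad_pos[of t] by simp
qed

lemma disc_polar: "D = (\<lambda>z. cc + z) ` {r *\<^sub>R cis s | r s. 0 \<le> r \<and> r \<le> rad s}"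
proof (intro set_eqI iffI)
  fix z assume z: "z \<in> D"
  have "z = cc + norm (z - cc) *\<^sub>R cis (Arg2pi (z - cc))"
    using Arg2pi_eq[of "z - cc"] by (simp add: scaleR_conv_of_real exp_eq_polar)
  then have "norm (z - cc) \<le> rad (Arg2pi (z - cc))"
    using reach_props(2)[of "cis (Arg2pi (z - cc))" "norm (z - cc)"] z by simp
  then show "z \<in> (\<lambda>z. cc + z) ` {r *\<^sub>R cis s | r s. 0 \<le> r \<and> r \<le> rad s}"
    using \<open>z = _\<close> by (intro image_eqI[of _ _ "norm (z - cc) *\<^sub>R cis (Arg2pi (z - cc))"] CollectI
        exI[of _ "norm (z - cc)"] exI[of _ "Arg2pi (z - cc)"]) simp_all
next
  fix z assume "z \<in> (\<lambda>z. cc + z) ` {r *\<^sub>R cis s | r s. 0 \<le> r \<and> r \<le> rad s}"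
  then show "z \<in> D" using reach_props(2) by auto
qed

text \<open>The graph consists of the pairs (z, r) with z on the circle, r between 0 and
  \<open>B\<close>, and cc + r z on the frontier. It is closed, and a map into a compact interval
  with closed graph is continuous.\<close>

lemma continuous_on_reach: "continuous_on (sphere 0 1) (reach D cc)"
proof -
  obtain B where B: "\<And>z. z \<in> D \<Longrightarrow> norm (z - cc) \<le> B"
    using compact_imp_bounded[OF comp] bounded_def[of D] by (metis dist_norm dist_commute bounded_any_center)
  have z0: "z \<noteq> 0" if "z \<in> sphere 0 1" for z :: complex using that by auto
  have "reach D cc z \<le> B" if "z \<in> sphere 0 1" for z
    using B[of "cc + reach D cc z *\<^sub>R z"] reach_props(1,2)[OF z0[OF that]] that by (simp add: less_imp_le)
  then have im: "reach D cc \<in> sphere 0 1 \<rightarrow> {0..B}" using reach_props(1)[OF z0] by (auto simp: less_imp_le)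
  have "(\<lambda>z. (z, reach D cc z)) ` sphere 0 1 = {p. fst p \<in> sphere 0 1 \<and> snd p \<in> {0..B} \<and> cc + snd p *\<^sub>R fst p \<in> frontier D}"
    using im reach_props(3)[OF z0] reach_props(1)[OF z0] by (auto simp: Pi_iff image_iff less_imp_le)
  also have "closed \<dots>"
  proof -
    have "closed ((\<lambda>p. cc + snd p *\<^sub>R fst p) -` frontier D)"
      by (intro continuous_closed_vimage frontier_closed) (auto intro!: continuous_intros)
    moreover have "closed (sphere (0::complex) 1 \<times> {0..B})" by (intro closed_Times) auto
    ultimately have "closed (sphere 0 1 \<times> {0..B} \<inter> (\<lambda>p. cc + snd p *\<^sub>R fst p) -` frontier D)" by blast
    then show ?thesis by (rule back_subst[of closed]) auto
  qed
  finally show ?thesis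
    by (subst continuous_closed_graph_eq[OF compact_Icc im]) (rule closed_subset, use im in \<open>auto simp: Pi_iff\<close>)
qed

lemma continuous_on_rad: "continuous_on S rad"
  by (rule continuous_on_compose2[OF continuous_on_reach]) (auto intro!: continuous_intros)

text \<open>A smooth periodic substitute for the radius of a disc with possible corners: a
  polynomial in the point of the unit circle, from Stone-Weierstrass, evaluated at
  \<open>cis s\<close>.\<close>

lemma smooth_inner_radius:
  fixes \<delta> :: real
  assumes "0 < \<delta>" "\<delta> < 1"
  obtains g where "smooth_on UNIV g" "\<And>s. g (s + 2 * pi) = g s" "\<And>s. (1 - \<delta>) * rad s < g s" "\<And>s. g s < rad s"
proof -
  have "compact (sphere (0::complex) 1)" "sphere (0::complex) 1 \<noteq> {}" by auto
  then obtain z0 :: complex where z0: "z0 \<in> sphere 0 1" "\<And>z. z \<in> sphere 0 1 \<Longrightarrow> reach D cc z0 \<le> reach D cc z"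
    using continuous_attains_inf[OF _ _ continuous_on_reach] by blast
  \<comment> \<open>The target of the approximation is (1 - \<delta>/2) times the radius. An error
    below \<delta>/2 times the minimal radius keeps the result strictly between (1 - \<delta>) times
    the radius and the radius.\<close>
  define e where "e = \<delta> / 2 * reach D cc z0"
  have "z0 \<noteq> 0" using z0(1) by auto
  then have "e > 0" using reach_props(1) assms by (simp add: e_def)
  then obtain p where p: "real_polynomial_function p" "\<And>z. z \<in> sphere 0 1 \<Longrightarrow> \<bar>(1 - \<delta> / 2) * reach D cc z - p z\<bar> < e"
    using Stone_Weierstrass_real_polynomial_function[OF \<open>compact (sphere 0 1)\<close>, of "\<lambda>z. (1 - \<delta> / 2) * reach D cc z" e]
      continuous_on_reach continuous_on_mult_left by blast
  have bound: "e \<le> \<delta> / 2 * rad s" for s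
    using z0(2)[of "cis s"] assms by (simp add: e_def)
  have "\<bar>(1 - \<delta> / 2) * rad s - p (cis s)\<bar> < \<delta> / 2 * rad s" for s
    using p(2)[of "cis s"] bound[of s] by simp
  then have b: "(1 - \<delta> / 2) * rad s - \<delta> / 2 * rad s < p (cis s)" "p (cis s) < (1 - \<delta> / 2) * rad s + \<delta> / 2 * rad s" for s
    by (smt (verit))+
  have "smooth_map_on UNIV cis"
    by (simp add: smooth_map_on_complex_iff smooth_on_sin_cos[of UNIV])
  then have "smooth_on UNIV (\<lambda>s. p (cis s))"
    using smooth_on_compose_map[OF open_UNIV open_UNIV _ smooth_on_real_polynomial_function[OF p(1)]] by simp
  then show ?thesis
  proof (rule that[of "\<lambda>s. p (cis s)"])
    show "p (cis (s + 2 * pi)) = p (cis s)" for s by (simp add: cis.ctr)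
    show "(1 - \<delta>) * rad s < p (cis s)" for s using b(1)[of s] by (simp add: algebra_simps)
    show "p (cis s) < rad s" for s using b(2)[of s] by (simp add: algebra_simps)
  qed
qed

end

subsection \<open>Area in polar coordinates\<close>

text \<open>The library has the rotation invariance of Lebesgue measure only on \<open>real^'n\<close>.\<close>

definition plane :: "complex \<Rightarrow> real^2" where
  "plane z = (\<chi> i. if i = 1 then Re z else Im z)"

lemma plane_nth [simp]: "plane z $ 1 = Re z" "plane z $ 2 = Im z"
  by (simp_all add: plane_def)

lemma plane_Complex: "plane (Complex (v $ 1) (v $ 2)) = v"
  by (simp add: vec_eq_iff forall_2)

lemma inj_plane: "inj plane"
  by (rule injI) (metis complex_eqI plane_nth)

lemma linear_plane: "linear plane"
  by (intro linearI) (simp_all add: vec_eq_iff forall_2)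

lemma lborel_plane: "distr lborel borel plane = lborel"
proof (rule lborel_eqI[symmetric])
  fix l u :: "real^2" assume lu: "\<And>b. b \<in> Basis \<Longrightarrow> l \<bullet> b \<le> u \<bullet> b"
  have "axis i 1 \<in> (Basis :: (real^2) set)" for i by (auto simp: Basis_vec_def)
  from lu[OF this] have le: "l $ i \<le> u $ i" for i by (simp add: inner_axis)
  have meas: "plane \<in> borel_measurable lborel"
    using linear_continuous_on[OF linear_conv_bounded_linear[THEN iffD1, OF linear_plane]]
    by (simp add: borel_measurable_continuous_onI)
  have "plane -` box l u = box (Complex (l $ 1) (l $ 2)) (Complex (u $ 1) (u $ 2))"
    by (auto simp: box_def Basis_vec_def inner_axis Basis_complex_def inner_complex_def forall_2)
  then have "emeasure (distr lborel borel plane) (box l u) = emeasure lborel (box (Complex (l $ 1) (l $ 2)) (Complex (u $ 1) (u $ 2)))"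
    using meas by (simp add: emeasure_distr)
  also have "\<dots> = ennreal ((u $ 1 - l $ 1) * (u $ 2 - l $ 2))"
    using le by (subst emeasure_lborel_box) (auto simp: Basis_complex_def inner_complex_def)
  also have "(u $ 1 - l $ 1) * (u $ 2 - l $ 2) = (\<Prod>b\<in>Basis. (u - l) \<bullet> b)"
  proof -
    have neq: "axis 1 (1::real) \<noteq> (axis 2 1 :: real^2)" by (simp add: axis_eq_axis)
    have B: "(Basis :: (real^2) set) = {axis 1 1, axis 2 1}"
      by (auto simp: Basis_vec_def UNIV_2)
    have "(\<Prod>b\<in>Basis. (u - l) \<bullet> b) = ((u - l) \<bullet> axis 1 1) * ((u - l) \<bullet> axis 2 1)"
      unfolding B using neq by (subst prod.insert) auto
    then show ?thesis by (simp add: inner_axis)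
  qed
  finally show "emeasure (distr lborel borel plane) (box l u) = (\<Prod>b\<in>Basis. (u - l) \<bullet> b)" .
qed simp

lemma measure_plane_image:
  assumes "compact S" shows "measure lebesgue (plane ` S) = measure lebesgue S"
proof -
  have cont: "continuous_on X plane" for X
    using linear_continuous_on[OF linear_conv_bounded_linear[THEN iffD1, OF linear_plane]] .
  have c: "compact (plane ` S)" by (intro compact_continuous_image cont assms)
  have "emeasure lborel (plane ` S) = emeasure (distr lborel borel plane) (plane ` S)"
    by (simp add: lborel_plane)
  also have "\<dots> = emeasure lborel (plane -` plane ` S)"
    using c by (subst emeasure_distr)
      (auto intro!: borel_measurable_continuous_onI cont simp: compact_imp_closed borel_closed)
  also have "plane -` plane ` S = S" by (rule inj_vimage_image_eq[OF inj_plane])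
  finally show ?thesis
    using c assms by (simp add: measure_def compact_imp_closed borel_closed)
qed

lemma measure_rotation:
  assumes "compact S" shows "measure lebesgue ((\<lambda>z. cis a * z) ` S) = measure lebesgue S"
proof -
  define R where "R v = plane (cis a * Complex (v $ 1) (v $ 2))" for v :: "real^2"
  have "orthogonal_transformation R"
    unfolding orthogonal_transformation
  proof
    show "linear R"
      by (intro linearI) (auto simp: R_def vec_eq_iff forall_2 algebra_simps)
    have "norm (plane z) = norm z" for z
      by (simp add: norm_vec_def L2_set_def UNIV_2 cmod_def)
    moreover from this have "norm (Complex (v $ 1) (v $ 2)) = norm v" for v :: "real^2"
      by (metis plane_Complex)
    ultimately show "\<forall>v. norm (R v) = norm v"
      by (simp add: R_def norm_mult)
  qed
  have R: "plane (cis a * z) = R (plane z)" for z by (simp add: R_def)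
  have cS: "compact (plane ` S)"
    using linear_continuous_on[OF linear_conv_bounded_linear[THEN iffD1, OF linear_plane]]
    by (intro compact_continuous_image assms)
  have "compact ((\<lambda>z. cis a * z) ` S)"
    by (intro compact_continuous_image assms continuous_intros)
  then have "measure lebesgue ((\<lambda>z. cis a * z) ` S) = measure lebesgue (plane ` (\<lambda>z. cis a * z) ` S)"
    by (simp add: measure_plane_image)
  also have "plane ` (\<lambda>z. cis a * z) ` S = R ` plane ` S" by (simp add: image_image R)
  also have "measure lebesgue \<dots> = measure lebesgue (plane ` S)"
    by (rule measure_orthogonal_image[OF \<open>orthogonal_transformation R\<close> lmeasurable_compact[OF cS]])
  finally show ?thesis using assms by (simp add: measure_plane_image)
qed

section \<open>Sectors and the area formula in polar coordinates\<close>

definition sector :: "(real \<Rightarrow> real) \<Rightarrow> real \<Rightarrow> real \<Rightarrow> complex set" where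
  "sector \<rho> a b = {r *\<^sub>R cis s | r s. 0 \<le> r \<and> r \<le> \<rho> s \<and> a \<le> s \<and> s \<le> b}"

lemma sectorI: "\<lbrakk>0 \<le> r; r \<le> \<rho> s; a \<le> s; s \<le> b\<rbrakk> \<Longrightarrow> r *\<^sub>R cis s \<in> sector \<rho> a b"
  unfolding sector_def by blast

lemma compact_sector:
  assumes "continuous_on UNIV \<rho>" shows "compact (sector \<rho> a b)"
proof -
  have "compact (\<rho> ` {a..b})"
    using assms continuous_on_subset by (intro compact_continuous_image) auto
  then obtain B where B: "\<And>s. s \<in> {a..b} \<Longrightarrow> \<rho> s \<le> B"
    using compact_imp_bounded bounded_iff by (metis abs_le_D1 image_eqI real_norm_def)
  have "continuous_on UNIV (\<lambda>p::real \<times> real. \<rho> (snd p))"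
    by (rule continuous_on_compose2[OF assms]) (auto intro!: continuous_intros)
  then have "closed {p. fst p \<le> \<rho> (snd p)}" by (intro closed_Collect_le continuous_intros) auto
  then have "compact ({0..B} \<times> {a..b} \<inter> {p. fst p \<le> \<rho> (snd p)})"
    by (intro compact_Int_closed compact_Times) auto
  then have "compact ((\<lambda>p. fst p *\<^sub>R cis (snd p)) ` ({0..B} \<times> {a..b} \<inter> {p. fst p \<le> \<rho> (snd p)}))"
    by (intro compact_continuous_image) (auto intro!: continuous_intros)
  also have "(\<lambda>p. fst p *\<^sub>R cis (snd p)) ` ({0..B} \<times> {a..b} \<inter> {p. fst p \<le> \<rho> (snd p)}) = sector \<rho> a b"
  proof (intro set_eqI iffI)
    fix z assume "z \<in> sector \<rho> a b"
    then obtain r s where "z = r *\<^sub>R cis s" "0 \<le> r" "r \<le> \<rho> s" "a \<le> s" "s \<le> b" by (auto simp: sector_def)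
    then show "z \<in> (\<lambda>p. fst p *\<^sub>R cis (snd p)) ` ({0..B} \<times> {a..b} \<inter> {p. fst p \<le> \<rho> (snd p)})"
      using B[of s] by (intro image_eqI[of _ _ "(r, s)"]) auto
  qed (auto intro: sectorI)
  finally show ?thesis .
qed

lemma sector_mono: "(\<And>s. a \<le> s \<Longrightarrow> s \<le> b \<Longrightarrow> \<rho> s \<le> \<rho>' s) \<Longrightarrow> sector \<rho> a b \<subseteq> sector \<rho>' a b"
  unfolding sector_def by (blast intro: order_trans)

lemma sector_rotate: "sector (\<lambda>_. R) (a + t) (b + t) = (\<lambda>z. cis t * z) ` sector (\<lambda>_. R) a b"
proof (intro set_eqI iffI)
  fix z assume "z \<in> sector (\<lambda>_. R) (a + t) (b + t)"
  then obtain r s where "z = r *\<^sub>R cis s" "0 \<le> r" "r \<le> R" "a + t \<le> s" "s \<le> b + t" by (auto simp: sector_def)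
  moreover from this have "r *\<^sub>R cis (s - t) \<in> sector (\<lambda>_. R) a b" by (intro sectorI) auto
  moreover have "r *\<^sub>R cis s = cis t * (r *\<^sub>R cis (s - t))" by (simp add: cis_mult)
  ultimately show "z \<in> (\<lambda>z. cis t * z) ` sector (\<lambda>_. R) a b" by (metis image_eqI)
next
  fix z assume "z \<in> (\<lambda>z. cis t * z) ` sector (\<lambda>_. R) a b"
  then obtain r s where "z = cis t * (r *\<^sub>R cis s)" "0 \<le> r" "r \<le> R" "a \<le> s" "s \<le> b" by (auto simp: sector_def)
  moreover from this have "r *\<^sub>R cis (s + t) \<in> sector (\<lambda>_. R) (a + t) (b + t)" by (intro sectorI) auto
  ultimately show "z \<in> sector (\<lambda>_. R) (a + t) (b + t)" by (simp add: cis_mult add.commute)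
qed

text \<open>Two different sectors of the subdivision meet only along rays, which lie in lines and
  are therefore negligible.\<close>

lemma measure_polar_partition:
  assumes "continuous_on UNIV \<rho>" "n > 0"
  shows "measure lebesgue (sector \<rho> 0 (2 * pi)) =
     (\<Sum>i<n. measure lebesgue (sector \<rho> (2 * pi / n * i) (2 * pi / n * Suc i)))"
proof -
  define t where "t i = 2 * pi / n * real i" for i
  have tn: "t n = 2 * pi" and t0: "t 0 = 0" using assms(2) by (simp_all add: t_def)
  have tmono: "t i \<le> t j" if "i \<le> j" for i j using that by (auto simp: t_def intro!: mult_left_mono divide_right_mono)
  have U: "sector \<rho> 0 (2 * pi) = (\<Union>i<n. sector \<rho> (t i) (t (Suc i)))"
  proof (intro set_eqI iffI)
    fix z assume "z \<in> sector \<rho> 0 (2 * pi)"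
    then obtain r s where z: "z = r *\<^sub>R cis s" "0 \<le> r" "r \<le> \<rho> s" "0 \<le> s" "s \<le> 2 * pi" by (auto simp: sector_def)
    have "\<exists>i<n. t i \<le> s \<and> s \<le> t (Suc i)"
    proof -
      have "s \<le> t (Suc n) \<longrightarrow> (\<exists>i<Suc n. t i \<le> s \<and> s \<le> t (Suc i))" for n
      proof (induction n)
        case 0
        then show ?case using z(4) t0 by auto
      next
        case (Suc n)
        then show ?case using linear[of s "t (Suc n)"] less_SucI by blast
      qed
      then show ?thesis using z(5) tn assms(2) by (metis Suc_pred)
    qed
    then show "z \<in> (\<Union>i<n. sector \<rho> (t i) (t (Suc i)))" using z(1-3) by (auto intro: sectorI)
  next
    fix z assume "z \<in> (\<Union>i<n. sector \<rho> (t i) (t (Suc i)))"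
    then obtain i r s where "i < n" "z = r *\<^sub>R cis s" "0 \<le> r" "r \<le> \<rho> s" "t i \<le> s" "s \<le> t (Suc i)" by (auto simp: sector_def)
    then show "z \<in> sector \<rho> 0 (2 * pi)"
      using tmono[of 0 i] tmono[of "Suc i" n] t0 tn by (auto intro: sectorI)
  qed
  have "measure lebesgue (\<Union>i\<in>{..<n}. sector \<rho> (t i) (t (Suc i))) = (\<Sum>i<n. measure lebesgue (sector \<rho> (t i) (t (Suc i))))"
  proof (rule measure_negligible_finite_Union_image)
    show "sector \<rho> (t i) (t (Suc i)) \<in> lmeasurable" for i
      by (intro lmeasurable_compact compact_sector assms)
    have main: "negligible (sector \<rho> (t i) (t (Suc i)) \<inter> sector \<rho> (t j) (t (Suc j)))" if ij: "i < j" "j < n" for i j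
    proof -
      define L where "L x = {z. (\<i> * cis x) \<bullet> z = 0}" for x
      have neg: "negligible (L x)" for x
        unfolding L_def by (rule negligible_hyperplane) simp
      have "sector \<rho> (t i) (t (Suc i)) \<inter> sector \<rho> (t j) (t (Suc j)) \<subseteq> L (t i) \<union> L (t (Suc i))"
      proof
        fix z assume z: "z \<in> sector \<rho> (t i) (t (Suc i)) \<inter> sector \<rho> (t j) (t (Suc j))"
        obtain r s where 1: "z = r *\<^sub>R cis s" "0 \<le> r" "t i \<le> s" "s \<le> t (Suc i)" using z by (auto simp: sector_def)
        obtain r' s' where 2: "z = r' *\<^sub>R cis s'" "0 \<le> r'" "t j \<le> s'" "s' \<le> t (Suc j)" using z by (auto simp: sector_def)
        have "norm z = r" using 1(1,2) by simp
        moreover have "norm z = r'" using 2(1,2) by simp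
        ultimately have rr: "r = r'" by simp
        have ord: "0 \<le> s" "s \<le> t (Suc i)" "t (Suc i) \<le> s'" "s' \<le> 2 * pi"
          using 1 2 tmono[of 0 i] tmono[of "Suc i" j] tmono[of "Suc j" n] ij t0 tn by auto
        have inL: "r *\<^sub>R cis x \<in> L x" for r x
          by (simp add: L_def inner_complex_def)
        show "z \<in> L (t i) \<union> L (t (Suc i))"
        proof (cases "r = 0")
          case True
          then show ?thesis using 1 by (simp add: L_def)
        next
          case False
          then have "cis s = cis s'" using 1(1) 2(1) rr by simp
          then obtain k :: int where k: "s' = s + of_int k * (2 * pi)" using cis_eqD by metis
          have "(-1) * (2 * pi) < of_int k * (2 * pi)" "of_int k * (2 * pi) < 2 * (2 * pi)"
            using ord k pi_gt_zero by linarith+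
          then have "(-1::real) < of_int k" "of_int k < (2::real)" using mult_pi_less by blast+
          then have "-1 < k" "k < 2" by linarith+
          \<comment> \<open>Either both angles are the common endpoint of adjacent sectors, or they
            differ by a full turn, and then the first and the last sector meet along the ray of
            angle 0.\<close>
          then consider "k = 0" | "k = 1" by linarith
          then show ?thesis
          proof cases
            case 1
            then have "s = t (Suc i)" using k ord by simp
            then show ?thesis using \<open>z = r *\<^sub>R cis s\<close> inL by simp
          next
            case 2
            then have "s = 0" "i = 0 \<or> i > 0" using k ord by auto
            then have "t i = s" using \<open>t i \<le> s\<close> tmono[of 0 i] t0 by simp
            then show ?thesis using \<open>z = r *\<^sub>R cis s\<close> inL by simp
          qed
        qed
      qed
      then show ?thesis by (rule negligible_subset[OF negligible_Un[OF neg neg]])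
    qed
    show "pairwise (\<lambda>x y. negligible (sector \<rho> (t x) (t (Suc x)) \<inter> sector \<rho> (t y) (t (Suc y)))) {..<n}"
      unfolding pairwise_def using main by (metis Int_commute lessThan_iff linorder_neqE_nat)
  qed auto
  then show ?thesis unfolding U by (simp add: t_def)
qed

text \<open>The n sectors are rotations of one another and make up a disc of area \<pi> R^2, so each
  has the n-th part of it.\<close>

lemma measure_circular_sector:
  fixes n :: nat
  assumes "R \<ge> 0" "n > 0"
  shows "measure lebesgue (sector (\<lambda>_. R) (2 * pi / n * real i) (2 * pi / n * Suc i)) = pi * R\<^sup>2 / n"
proof -
  define \<mu> where "\<mu> = measure lebesgue (sector (\<lambda>_. R) 0 (2 * pi / n))"
  have \<mu>: "measure lebesgue (sector (\<lambda>_. R) (2 * pi / n * real i) (2 * pi / n * Suc i)) = \<mu>" for i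
  proof -
    have "2 * pi / n * Suc i = 2 * pi / n + 2 * pi / n * real i" by (simp add: algebra_simps add_divide_distrib)
    then have "sector (\<lambda>_. R) (2 * pi / n * real i) (2 * pi / n * Suc i)
        = (\<lambda>z. cis (2 * pi / n * real i) * z) ` sector (\<lambda>_. R) 0 (2 * pi / n)"
      using sector_rotate[of R 0 "2 * pi / n * real i" "2 * pi / n"] by simp
    then show ?thesis
      unfolding \<mu>_def by (simp only: measure_rotation[OF compact_sector[OF continuous_on_const]])
  qed
  have "sector (\<lambda>_. R) 0 (2 * pi) = cball 0 R"
  proof (intro set_eqI iffI)
    fix z :: complex assume "z \<in> cball 0 R"
    then show "z \<in> sector (\<lambda>_. R) 0 (2 * pi)"
      using Arg2pi_eq[of z] Arg2pi[of z] sectorI[of "norm z" "\<lambda>_. R" "Arg2pi z" 0 "2 * pi"]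
      by (simp add: scaleR_conv_of_real exp_eq_polar less_imp_le)
  qed (auto simp: sector_def)
  then have "measure lebesgue (cball (0::complex) R) = n * \<mu>"
    using measure_polar_partition[of "\<lambda>_. R" n] assms(2) \<mu> by simp
  moreover have "measure lebesgue (cball (0::complex) R) = pi * R\<^sup>2"
    using content_cball[OF assms(1), of "0::complex"] unit_ball_vol_2 by simp
  ultimately show ?thesis using \<mu>[of i] assms(2) by (simp add: field_simps)
qed

text \<open>On a fine subdivision each sector is squeezed between circular sectors whose squared
  radii differ from the sampled value by at most \<open>e\<close>. The same Riemann sum approximates
  the area within \<pi> e and half of the integral within \<pi> e.\<close>

lemma measure_polar:
  assumes \<rho>: "continuous_on UNIV \<rho>" "\<And>s. \<rho> s \<ge> 0"
  shows "measure lebesgue (sector \<rho> 0 (2 * pi)) = integral {0..2 * pi} (\<lambda>s. (\<rho> s)\<^sup>2) / 2"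
proof -
  define f where "f s = (\<rho> s)\<^sup>2" for s
  define M where "M = measure lebesgue (sector \<rho> 0 (2 * pi))"
  have fc: "continuous_on S f" for S
    unfolding f_def using continuous_on_subset[OF \<rho>(1)] by (intro continuous_intros) auto
  have "\<bar>M - integral {0..2 * pi} f / 2\<bar> \<le> 2 * pi * e" if e: "e > 0" for e
  proof -
    have "uniformly_continuous_on {0..2 * pi} f"
      by (intro compact_uniformly_continuous fc) auto
    then obtain d where d: "d > 0" "\<And>s s'. s \<in> {0..2*pi} \<Longrightarrow> s' \<in> {0..2*pi} \<Longrightarrow> dist s' s < d \<Longrightarrow> dist (f s') (f s) < e"
      unfolding uniformly_continuous_on_def using e by blast
    obtain n :: nat where n: "2 * pi / d < n" using reals_Archimedean2 by blast
    have "0 < 2 * pi / d" using d(1) by simp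
    then have n0: "n > 0" using n by (metis less_trans of_nat_0_less_iff)
    then have h: "2 * pi / n < d" using n d(1) by (simp add: field_simps)
    define t where "t i = 2 * pi / n * real i" for i
    have t0: "t 0 = 0" and tn: "t n = 2 * pi" using n0 by (simp_all add: t_def)
    have tS: "t (Suc i) = t i + 2 * pi / n" for i by (simp add: t_def algebra_simps add_divide_distrib)
    have trange: "0 \<le> t i" "t i \<le> 2 * pi" if "i \<le> n" for i
      using that n0 by (auto simp: t_def field_simps)
    have osc: "f (t i) - e \<le> f s" "f s \<le> f (t i) + e" if "i < n" "t i \<le> s" "s \<le> t (Suc i)" for i s
      using d(2)[of "t i" s] trange[of i] trange[of "Suc i"] that h tS[of i] by (auto simp: dist_real_def)
    define \<Sigma> where "\<Sigma> k = (\<Sum>i<k. f (t i))" for k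
    have A: "\<bar>measure lebesgue (sector \<rho> (t i) (t (Suc i))) - pi / n * f (t i)\<bar> \<le> pi / n * e" if i: "i < n" for i
    proof -
      \<comment> \<open>The sampled value minus \<open>e\<close> may be negative;
        \<open>max 0\<close> keeps the inner radius nonnegative while its square is still at least
        that value.\<close>
      define m where "m = sqrt (max 0 (f (t i) - e))"
      define M where "M = sqrt (f (t i) + e)"
      have f0: "f s \<ge> 0" for s by (simp add: f_def)
      have cmp: "m \<le> \<rho> s" "\<rho> s \<le> M" if "t i \<le> s" "s \<le> t (Suc i)" for s
      proof -
        have "\<rho> s = sqrt (f s)" using \<rho>(2)[of s] by (simp add: f_def)
        then show "m \<le> \<rho> s" "\<rho> s \<le> M"
          using osc[OF i that] f0[of s] by (auto simp: m_def M_def intro!: real_sqrt_le_mono)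
      qed
      have L: "measure lebesgue (sector (\<lambda>_. m) (t i) (t (Suc i))) \<le> measure lebesgue (sector \<rho> (t i) (t (Suc i)))"
        using cmp(1) by (intro measure_mono_fmeasurable sector_mono)
          (auto intro!: lmeasurable_compact compact_sector \<rho> fmeasurableD)
      have U: "measure lebesgue (sector \<rho> (t i) (t (Suc i))) \<le> measure lebesgue (sector (\<lambda>_. M) (t i) (t (Suc i)))"
        using cmp(2) by (intro measure_mono_fmeasurable sector_mono)
          (auto intro!: lmeasurable_compact compact_sector \<rho> fmeasurableD)
      have "m \<ge> 0" "M \<ge> 0" using e f0[of "t i"] by (simp_all add: m_def M_def)
      then have "pi * m\<^sup>2 / n \<le> measure lebesgue (sector \<rho> (t i) (t (Suc i)))"
        "measure lebesgue (sector \<rho> (t i) (t (Suc i))) \<le> pi * M\<^sup>2 / n"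
        using L U measure_circular_sector[OF _ n0, of m i] measure_circular_sector[OF _ n0, of M i] by (simp_all add: t_def)
      moreover have "M\<^sup>2 = f (t i) + e" "m\<^sup>2 \<ge> f (t i) - e"
        using e f0[of "t i"] by (simp_all add: m_def M_def)
      then have "pi / n * (f (t i) - e) \<le> pi * m\<^sup>2 / n" "pi * M\<^sup>2 / n = pi / n * (f (t i) + e)"
        by (simp_all add: divide_right_mono)
      ultimately have "pi / n * (f (t i) - e) \<le> measure lebesgue (sector \<rho> (t i) (t (Suc i)))"
        "measure lebesgue (sector \<rho> (t i) (t (Suc i))) \<le> pi / n * (f (t i) + e)" by linarith+
      then show ?thesis by (simp add: abs_le_iff right_diff_distrib distrib_left)
    qed
    have "\<bar>M - pi / n * \<Sigma> n\<bar> \<le> (\<Sum>i<n. \<bar>measure lebesgue (sector \<rho> (t i) (t (Suc i))) - pi / n * f (t i)\<bar>)"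
      unfolding M_def measure_polar_partition[OF \<rho>(1) n0] \<Sigma>_def sum_distrib_left t_def sum_subtractf[symmetric]
      by (rule sum_abs)
    also have "\<dots> \<le> (\<Sum>i<n. pi / n * e)" using A by (intro sum_mono) auto
    also have "\<dots> = pi * e" using n0 by simp
    finally have 1: "\<bar>M - pi / n * \<Sigma> n\<bar> \<le> pi * e" .
    have I: "f integrable_on {a..b}" for a b
      by (intro integrable_continuous_real fc)
    define h where "h = 2 * pi / n"
    have tSh: "t (Suc i) = t i + h" for i by (simp add: tS h_def)
    have h0: "h > 0" using n0 by (simp add: h_def)
    have "\<bar>integral {0..t k} f - h * \<Sigma> k\<bar> \<le> k * (h * e)" if "k \<le> n" for k
      using that
    proof (induction k)
      case (Suc k)
      have le: "t k \<le> t (Suc k)" "0 \<le> t k" using trange[of k] Suc.prems h0 by (auto simp: tSh)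
      have "integral {0..t (Suc k)} f = integral {0..t k} f + integral {t k..t (Suc k)} f"
        using Henstock_Kurzweil_Integration.integral_combine[OF le(2,1) I] by simp
      moreover have "integral {t k..t (Suc k)} f \<le> integral {t k..t (Suc k)} (\<lambda>_. f (t k) + e)"
        using osc Suc.prems by (intro integral_le I) auto
      moreover have "integral {t k..t (Suc k)} (\<lambda>_. f (t k) - e) \<le> integral {t k..t (Suc k)} f"
        using osc Suc.prems by (intro integral_le I) auto
      ultimately have "\<bar>integral {0..t (Suc k)} f - (integral {0..t k} f + h * f (t k))\<bar> \<le> h * e"
        using h0 by (simp add: tSh abs_le_iff algebra_simps)
      moreover have "\<bar>integral {0..t k} f - h * \<Sigma> k\<bar> \<le> k * (h * e)" using Suc by simp
      ultimately show ?case by (simp add: \<Sigma>_def abs_le_iff algebra_simps)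
    qed (simp add: t0 \<Sigma>_def)
    from this[of n] have 2: "\<bar>integral {0..2 * pi} f - 2 * pi / n * \<Sigma> n\<bar> \<le> 2 * pi * e"
      using n0 by (simp add: tn h_def)
    have "2 * pi / n * \<Sigma> n = 2 * (pi / n * \<Sigma> n)" by simp
    with 1 2 show ?thesis by (simp only: abs_le_iff) linarith
  qed
  note * = this
  have "\<bar>M - integral {0..2 * pi} f / 2\<bar> \<le> 0"
  proof (rule field_le_epsilon)
    fix e :: real assume "e > 0"
    then show "\<bar>M - integral {0..2 * pi} f / 2\<bar> \<le> 0 + e" using *[of "e / (2 * pi)"] by simp
  qed
  then show ?thesis by (simp add: M_def f_def[abs_def])
qed

lemma (in convex_disc) measure_disc: "measure lebesgue D = integral {0..2 * pi} (\<lambda>s. (rad s)\<^sup>2) / 2"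
proof -
  have "{r *\<^sub>R cis s | r s. 0 \<le> r \<and> r \<le> rad s} = sector (\<lambda>s. rad s) 0 (2 * pi)"
  proof (intro set_eqI iffI)
    fix z assume "z \<in> {r *\<^sub>R cis s | r s. 0 \<le> r \<and> r \<le> rad s}"
    then obtain r s where z: "z = r *\<^sub>R cis s" "0 \<le> r" "r \<le> rad s" by blast
    have "cis (Arg2pi (cis s)) = cis s" using Arg2pi_eq[of "cis s"] by (simp add: exp_eq_polar)
    then show "z \<in> sector (\<lambda>s. rad s) 0 (2 * pi)"
      using z Arg2pi[of "cis s"] sectorI[of r "\<lambda>s. rad s" "Arg2pi (cis s)" 0 "2 * pi"] by simp
  qed (auto simp: sector_def)
  then have "measure lebesgue D = measure lebesgue (sector (\<lambda>s. rad s) 0 (2 * pi))"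
    by (subst disc_polar) (simp add: measure_translation)
  also have "\<dots> = integral {0..2 * pi} (\<lambda>s. (rad s)\<^sup>2) / 2"
    by (intro measure_polar continuous_on_rad less_imp_le rad_pos)
  finally show ?thesis .
qed

subsection \<open>Piecewise smoothness of the boundary\<close>

text \<open>The inverse function theorem supplies a differentiable local inverse, and the formula
  for its derivative then bootstraps smoothness.\<close>

lemma local_smooth_inverse:
  fixes F :: "real \<Rightarrow> real"
  assumes "open V" "smooth_on V F" "x0 \<in> V" "deriv F x0 \<noteq> 0"
  obtains N g where "open N" "F x0 \<in> N" "smooth_on N g" "\<And>y. y \<in> N \<Longrightarrow> g y \<in> V" "\<And>y. y \<in> N \<Longrightarrow> F (g y) = y"
proof -
  define f' where "f' x = deriv F x *\<^sub>R (id_blinfun :: real \<Rightarrow>\<^sub>L real)" for x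
  have cont: "continuous_on V (deriv F)"
    using smooth_onD(1)[OF smooth_on_deriv(1)[OF assms(1,2)]] differentiable_imp_continuous_on by blast
  have app: "blinfun_apply (f' x) = (*) (deriv F x)" for x
    by (auto simp: f'_def scaleR_blinfun.rep_eq)
  have op: "open (V \<inter> deriv F -` (- {0}))"
    by (rule continuous_open_preimage[OF cont assms(1)]) (intro open_Compl closed_singleton)
  let ?U = "V \<inter> deriv F -` (- {0})"
  have 1: "(F has_derivative blinfun_apply (f' x)) (at x)" if "x \<in> ?U" for x
    using smooth_on_deriv(2)[OF assms(1,2), of x] that by (simp add: app has_field_derivative_def)
  have 2: "continuous_on ?U f'"
    unfolding f'_def by (intro continuous_intros continuous_on_subset[OF cont]) auto
  have 3: "((1 / deriv F x0) *\<^sub>R id_blinfun) o\<^sub>L f' x0 = id_blinfun"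
    using assms(4) by (intro blinfun_eqI) (simp add: app scaleR_blinfun.rep_eq)
  have "x0 \<in> ?U" using assms by simp
  then obtain U' N g g' where g: "open U'" "U' \<subseteq> ?U" "open N" "F x0 \<in> N" "homeomorphism U' N F g"
    "\<And>y. y \<in> N \<Longrightarrow> (g has_derivative (g' y)) (at y)"
    "\<And>y. y \<in> N \<Longrightarrow> g' y = inv (blinfun_apply (f' (g y)))"
    using inverse_function_theorem[OF op 1 2 _ 3] by metis
  have gN: "g y \<in> ?U" "F (g y) = y" if "y \<in> N" for y
    using g(2,5) that by (auto simp: homeomorphism_def)
  have "smooth_on N g"
  proof (rule smooth_on_inverse_function[OF g(3) op])
    show "smooth_on ?U F" using assms(2) smooth_on_subset by blast
    show "g ` N \<subseteq> ?U" using gN by blast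
    fix y assume y: "y \<in> N"
    have d: "deriv F (g y) \<noteq> 0" using gN(1)[OF y] by simp
    have "inv ((*) (deriv F (g y))) = (*) (inverse (deriv F (g y)))"
      using d by (intro inv_equality) (auto simp: field_simps)
    then show "(g has_real_derivative inverse (deriv F (g y))) (at y)"
      using g(6,7)[OF y] by (simp add: app has_field_derivative_def)
  qed auto
  then show ?thesis using that[of N g] g(3,4) gN by blast
qed

text \<open>Only two unit vectors are orthogonal to \<open>w\<close>, namely i w/|w| and its
  negative, and \<open>cis\<close> is injective on a half-open period.\<close>

lemma finite_orthogonal_directions:
  assumes "w \<noteq> 0" shows "finite {s \<in> {x..<x + 2 * pi}. w \<bullet> cis s = 0}"
proof (rule finite_imageD)
  have "cis s \<in> {\<i> * w / norm w, - \<i> * w / norm w}" if "w \<bullet> cis s = 0" for s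
  proof -
    define q where "q = cis s * cnj w"
    have "Re q = 0" using that by (simp add: q_def inner_complex_def algebra_simps)
    moreover have nq: "norm q = norm w" by (simp add: q_def norm_mult)
    ultimately have "\<bar>Im q\<bar> = norm w" by (simp add: cmod_eq_Im)
    then have "q = \<i> * norm w \<or> q = - \<i> * norm w"
      using \<open>Re q = 0\<close> by (auto simp: complex_eq_iff abs_if split: if_splits)
    moreover have "cis s = q * w / (norm w)\<^sup>2"
      using assms by (simp add: q_def mult.assoc complex_norm_square[symmetric] mult.commute[of "cnj w"])
    ultimately show ?thesis using assms by (auto simp: power2_eq_square)
  qed
  then have "cis ` {s \<in> {x..<x + 2 * pi}. w \<bullet> cis s = 0} \<subseteq> {\<i> * w / norm w, - \<i> * w / norm w}" by blast
  then show "finite (cis ` {s \<in> {x..<x + 2 * pi}. w \<bullet> cis s = 0})" by (rule finite_subset) simp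
  show "inj_on cis {s \<in> {x..<x + 2 * pi}. w \<bullet> cis s = 0}"
    by (rule inj_on_subset[OF cis_inj_on]) auto
qed

context convex_disc
begin

text \<open>The set \<open>B\<close> contains the angles of the corners; between them the radius extends smoothly
  beyond both ends.\<close>

definition piecewise_smooth :: bool where
  "piecewise_smooth \<longleftrightarrow> (\<exists>B. (\<forall>x. finite (B \<inter> {x..<x + 2 * pi})) \<and>
     (\<forall>x y. x < y \<longrightarrow> {x<..<y} \<inter> B = {} \<longrightarrow>
        (\<exists>J g. open J \<and> {x..y} \<subseteq> J \<and> smooth_on J g \<and> (\<forall>s\<in>{x..y}. rad s = g s))))"

text \<open>If \<open>D\<close> is cut out by inequalities u \<bullet> (x - cc) <= 1, then
  \<open>rad s\<close> is the reciprocal of the largest u \<bullet> \<open>cis s\<close>. Between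
  consecutive angles at which two of these forms tie, one form stays maximal, and its reciprocal is
  smooth as long as the form is positive, hence a little beyond both ends.\<close>

lemma polytope_piecewise_smooth:
  assumes "polytope D" shows piecewise_smooth
proof -
  obtain F where F: "finite F" "D = \<Inter>F" "\<forall>h\<in>F. \<exists>a b. a \<noteq> 0 \<and> h = {x. a \<bullet> x \<le> b}"
    using polytope_imp_polyhedron[OF assms] unfolding polyhedron_def by blast
  \<comment> \<open>The centre is interior, so each half-plane inequality is strict at
    \<open>cc\<close> and can be scaled to have right-hand side 1.\<close>
  have "\<exists>u. \<forall>x. x \<in> h \<longleftrightarrow> u \<bullet> (x - cc) \<le> 1" if h: "h \<in> F" for h
  proof -
    obtain a b where ab: "a \<noteq> 0" "h = {x. a \<bullet> x \<le> b}" using F(3) h by blast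
    have "D \<subseteq> h" using F(2) h by blast
    then have "cc \<in> interior h" using int interior_mono by blast
    then have lt: "a \<bullet> cc < b" unfolding ab(2) interior_halfspace_le[OF ab(1)] by simp
    show ?thesis
      using lt by (intro exI[of _ "(1 / (b - a \<bullet> cc)) *\<^sub>R a"])
        (simp add: ab(2) inner_diff_right pos_divide_le_eq diff_divide_distrib[symmetric])
  qed
  then obtain u where u: "\<And>h x. h \<in> F \<Longrightarrow> x \<in> h \<longleftrightarrow> u h \<bullet> (x - cc) \<le> 1" by metis
  define U where "U = u ` F"
  have U: "finite U" "\<And>x. x \<in> D \<longleftrightarrow> (\<forall>w\<in>U. w \<bullet> (x - cc) \<le> 1)"
    using F(1,2) u by (auto simp: U_def)
  have U_ne: "U \<noteq> {}"
  proof
    assume "U = {}"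
    then have "D = UNIV" using U(2) by auto
    then show False using comp not_bounded_UNIV compact_imp_bounded by blast
  qed
  have rad: "0 < j \<bullet> cis s" "rad s = 1 / (j \<bullet> cis s)" if j: "j \<in> U" "\<And>w. w \<in> U \<Longrightarrow> w \<bullet> cis s \<le> j \<bullet> cis s" for j s
  proof -
    have mem: "r \<le> rad s \<longleftrightarrow> (\<forall>w\<in>U. r * (w \<bullet> cis s) \<le> 1)" if "0 \<le> r" for r
      using reach_props(2)[of "cis s" r] that by (simp add: U(2))
    have "\<not> rad s + 1 \<le> rad s" by simp
    then obtain w where "w \<in> U" "(rad s + 1) * (w \<bullet> cis s) > 1"
      using mem[of "rad s + 1"] rad_pos[of s] by (auto simp: not_le)
    then have "0 < w \<bullet> cis s" using rad_pos[of s]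
      by (smt (verit) mult_nonneg_nonpos)
    then show pos: "0 < j \<bullet> cis s" using j(2)[OF \<open>w \<in> U\<close>] by linarith
    have "rad s * (j \<bullet> cis s) \<le> 1" using mem[of "rad s"] j(1) rad_pos[of s] by simp
    then have "rad s \<le> 1 / (j \<bullet> cis s)" using pos by (simp add: field_simps)
    moreover have "1 / (j \<bullet> cis s) \<le> rad s"
      using mem[of "1 / (j \<bullet> cis s)"] pos j(2) by (simp add: divide_simps)
    ultimately show "rad s = 1 / (j \<bullet> cis s)" by simp
  qed
  define B where "B = {s. \<exists>v\<in>U. \<exists>w\<in>U. v \<noteq> w \<and> (v - w) \<bullet> cis s = 0}"
  have "finite (B \<inter> {x..<x + 2 * pi})" for x
  proof (rule finite_subset)
    show "B \<inter> {x..<x + 2 * pi} \<subseteq> (\<Union>v\<in>U. \<Union>w\<in>U - {v}. {s \<in> {x..<x + 2 * pi}. (v - w) \<bullet> cis s = 0})"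
      unfolding B_def by blast
    show "finite \<dots>" using U(1) by (intro finite_UN_I finite_Diff finite_orthogonal_directions) auto
  qed
  moreover have "\<exists>J g. open J \<and> {x..y} \<subseteq> J \<and> smooth_on J g \<and> (\<forall>s\<in>{x..y}. rad s = g s)"
    if xy: "x < y" "{x<..<y} \<inter> B = {}" for x y
  proof -
    define z where "z = (x + y) / 2"
    have z: "x < z" "z < y" using xy by (auto simp: z_def)
    have "Max ((\<lambda>w. w \<bullet> cis z) ` U) \<in> (\<lambda>w. w \<bullet> cis z) ` U" using U(1) U_ne by (intro Max_in) auto
    then obtain j where j: "j \<in> U" "Max ((\<lambda>w. w \<bullet> cis z) ` U) = j \<bullet> cis z" by blast
    have jmax: "w \<bullet> cis z \<le> j \<bullet> cis z" if "w \<in> U" for w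
      using Max_ge[of "(\<lambda>w. w \<bullet> cis z) ` U" "w \<bullet> cis z"] U(1) that j(2) by simp
    have cont: "continuous_on S (\<lambda>t. w \<bullet> cis t)" for S w by (intro continuous_intros)
    \<comment> \<open>A competitor can overtake the form that is maximal at the midpoint only
      through a tie strictly inside the interval, where no tie occurs.\<close>
    have max: "w \<bullet> cis s \<le> j \<bullet> cis s" if s: "s \<in> {x..y}" and w: "w \<in> U" for s w
    proof (rule ccontr)
      assume "\<not> w \<bullet> cis s \<le> j \<bullet> cis s"
      then have pos: "(w - j) \<bullet> cis s > 0" and "w \<noteq> j" by (auto simp: inner_diff_left)
      have nB: "(w - j) \<bullet> cis t \<noteq> 0" if "x < t" "t < y" for t
      proof -
        have "t \<notin> B" using xy(2) that by auto
        then show ?thesis using w j(1) \<open>w \<noteq> j\<close> unfolding B_def by blast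
      qed
      have neg: "(w - j) \<bullet> cis z < 0" using jmax[OF w] nB[OF z] by (simp add: inner_diff_left)
      show False
      proof (cases "s \<le> z")
        case True
        then obtain t where t: "s \<le> t" "t \<le> z" "(w - j) \<bullet> cis t = 0"
          using IVT2'[of "\<lambda>t. (w - j) \<bullet> cis t" z 0 s] cont pos neg by (auto simp: less_imp_le)
        then have "t \<noteq> s" using pos by auto
        then show False using nB[of t] t s z by auto
      next
        case False
        then obtain t where t: "z \<le> t" "t \<le> s" "(w - j) \<bullet> cis t = 0"
          using IVT'[of "\<lambda>t. (w - j) \<bullet> cis t" z 0 s] cont pos neg by (auto simp: less_imp_le)
        then have "t \<noteq> s" using pos by auto
        then show False using nB[of t] t s z by auto
      qed
    qed
    define J where "J = {s. 0 < j \<bullet> cis s}"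
    have "open J" unfolding J_def by (intro open_Collect_less cont continuous_intros)
    moreover have "{x..y} \<subseteq> J" using rad(1)[OF j(1)] max by (auto simp: J_def)
    moreover have "smooth_on J (\<lambda>s. 1 / (j \<bullet> cis s))"
      unfolding inner_complex_def cis.sel using \<open>open J\<close>
      by (intro smooth_on_divide smooth_on_add smooth_on_mult smooth_on_const smooth_on_sin_cos)
        (auto simp: J_def inner_complex_def)
    ultimately show ?thesis using rad(2)[OF j(1)] max by blast
  qed
  ultimately show ?thesis unfolding piecewise_smooth_def by blast
qed

text \<open>A supporting functional at the boundary point is minimal along the curve there, so it
  kills the tangent. On the radial vector it is negative, because the centre is interior. Hence
  tangent and radial vector are not parallel, which the imaginary part, their cross product,
  expresses.\<close>

lemma tangent_not_radial:
  assumes \<gamma>: "(\<gamma> has_vector_derivative \<gamma>') (at t)" "\<gamma>' \<noteq> 0" "\<And>t. \<gamma> t \<in> frontier D"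
  shows "Im (\<gamma>' * cnj (\<gamma> t - cc)) \<noteq> 0"
proof
  assume Im0: "Im (\<gamma>' * cnj (\<gamma> t - cc)) = 0"
  have cl: "closed D" by (rule compact_imp_closed[OF comp])
  have fr: "\<gamma> t \<in> D" "\<gamma> t \<notin> interior D" for t
    using \<gamma>(3)[of t] frontier_subset_closed[OF cl] by (auto simp: frontier_def)
  have ri: "rel_interior D = interior D" using int by (intro rel_interior_nonempty_interior) auto
  obtain a where a: "\<And>y. y \<in> D \<Longrightarrow> a \<bullet> \<gamma> t \<le> a \<bullet> y" "\<And>y. y \<in> interior D \<Longrightarrow> a \<bullet> \<gamma> t < a \<bullet> y"
    using supporting_hyperplane_rel_boundary[OF conv fr(1)[of t]] fr(2)[of t] unfolding ri by metis
  have pos: "a \<bullet> (\<gamma> t - cc) < 0" using a(2)[OF int] by (simp add: inner_diff_right)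
  then have nz: "\<gamma> t - cc \<noteq> 0" by auto
  have "((\<lambda>s. a \<bullet> \<gamma> s) has_vector_derivative a \<bullet> \<gamma>') (at t)"
    using bounded_linear.has_vector_derivative[OF bounded_linear_inner_right \<gamma>(1)] .
  then have "((\<lambda>s. a \<bullet> \<gamma> s) has_real_derivative a \<bullet> \<gamma>') (at t)"
    by (simp add: has_real_derivative_iff_has_vector_derivative)
  then have "a \<bullet> \<gamma>' = 0"
    by (rule DERIV_local_min[of _ _ _ 1]) (use a(1) fr(1) in auto)
  define q where "q = \<gamma>' * cnj (\<gamma> t - cc)"
  have "q = of_real (Re q)" using Im0 by (simp add: q_def complex_eq_iff)
  moreover have "\<gamma>' * (norm (\<gamma> t - cc))\<^sup>2 = q * (\<gamma> t - cc)"
    by (simp only: q_def of_real_power[symmetric] complex_norm_square mult_ac)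
  ultimately have eq: "(norm (\<gamma> t - cc))\<^sup>2 *\<^sub>R \<gamma>' = Re q *\<^sub>R (\<gamma> t - cc)"
    by (metis mult.commute scaleR_conv_of_real)
  then have "a \<bullet> ((norm (\<gamma> t - cc))\<^sup>2 *\<^sub>R \<gamma>') = Re q * (a \<bullet> (\<gamma> t - cc))" by simp
  then have "Re q = 0" using \<open>a \<bullet> \<gamma>' = 0\<close> pos by simp
  then show False using eq nz \<gamma>(2) by simp
qed

text \<open>Since the tangent is never radial, the polar angle is a local coordinate on the boundary
  curve. Inverting it expresses the curve parameter, and with it the radius, smoothly by the angle;
  there are no corners at all.\<close>

lemma smooth_boundary_piecewise_smooth:
  assumes "smooth_boundary D" shows piecewise_smooth
proof -
  obtain \<gamma> :: "real \<Rightarrow> complex" where \<gamma>: "smooth_map_on UNIV \<gamma>" "\<And>t. \<gamma> (t + 1) = \<gamma> t"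
    "\<And>t. vector_derivative \<gamma> (at t) \<noteq> 0" "\<gamma> ` {0..1} = frontier D"
    using assms unfolding smooth_boundary_def by blast
  have \<gamma>s: "smooth_on UNIV (\<lambda>t. Re (\<gamma> t))" "smooth_on UNIV (\<lambda>t. Im (\<gamma> t))"
    using \<gamma>(1) by (simp_all add: smooth_map_on_complex_iff)
  have D: "(\<gamma> has_vector_derivative Complex (deriv (\<lambda>t. Re (\<gamma> t)) t) (deriv (\<lambda>t. Im (\<gamma> t)) t)) (at t)" for t
    using smooth_on_deriv(2)[OF open_UNIV \<gamma>s(1)] smooth_on_deriv(2)[OF open_UNIV \<gamma>s(2)]
    by (simp add: has_vector_derivative_complex_iff)
  then have Dnz: "Complex (deriv (\<lambda>t. Re (\<gamma> t)) t) (deriv (\<lambda>t. Im (\<gamma> t)) t) \<noteq> 0" for t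
    using \<gamma>(3)[of t] vector_derivative_at by metis
  have fr: "\<gamma> t \<in> frontier D" for t
  proof -
    have per: "\<gamma> (t + of_int k) = \<gamma> t" for k :: int
    proof (induction k rule: int_induct[of _ 0])
      case (step1 i)
      then show ?case using \<gamma>(2)[of "t + of_int i"] by (simp add: add.assoc)
    next
      case (step2 i)
      then show ?case using \<gamma>(2)[of "t + of_int (i - 1)"] by (simp add: algebra_simps)
    qed simp
    have "\<gamma> (frac t) \<in> frontier D" using \<gamma>(4) frac_ge_0[of t] frac_lt_1[of t] by auto
    then show ?thesis using per[of "- \<lfloor>t\<rfloor>"] by (simp add: frac_def)
  qed
  have "smooth_on UNIV (\<lambda>s. rad s)"
  proof (rule smooth_on_local)
    fix s0 :: real
    obtain t0 where t0: "\<gamma> t0 = bd s0" using bd_frontier[of s0] \<gamma>(4) by (metis imageE)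
    \<comment> \<open>The boundary curve seen from the centre, rotated so that the ray of angle
      \<open>s0\<close> becomes the positive real axis.\<close>
    define q where "q t = (\<gamma> t - cc) * cis (- s0)" for t
    have q_alt: "Re (q t) = (Re (\<gamma> t) - Re cc) * cos s0 + (Im (\<gamma> t) - Im cc) * sin s0"
      "Im (q t) = (Im (\<gamma> t) - Im cc) * cos s0 - (Re (\<gamma> t) - Re cc) * sin s0" for t
      by (simp_all add: q_def algebra_simps)
    have qs: "smooth_on UNIV (\<lambda>t. Re (q t))" "smooth_on UNIV (\<lambda>t. Im (q t))"
      unfolding q_alt by (intro smooth_intros \<gamma>s open_UNIV)+
    have q0: "q t0 = rad s0"
      by (simp add: q_def t0 bd_def scaleR_conv_of_real cis_mult)
    define V where "V = {t. Re (q t) > 0}"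
    have "continuous_on UNIV (\<lambda>t. Re (q t))"
      using smooth_onD(1)[OF qs(1)] differentiable_imp_continuous_on by blast
    then have V: "open V" unfolding V_def by (intro open_Collect_less continuous_on_const)
    have t0V: "t0 \<in> V" using q0 rad_pos[of s0] by (simp add: V_def)
    \<comment> \<open>The tangent of the angle relative to \<open>s0\<close>: a rational expression
      in the curve, so that no branch of an argument function has to be differentiated.\<close>
    define F where "F t = Im (q t) / Re (q t)" for t
    have F: "smooth_on V F"
      unfolding F_def using V smooth_on_subset[OF qs(1)] smooth_on_subset[OF qs(2)]
      by (intro smooth_on_divide) (auto simp: V_def)
    have Fd: "deriv F t0 \<noteq> 0"
    proof -
      note d = smooth_on_deriv(2)[OF open_UNIV qs(1), of t0, simplified] smooth_on_deriv(2)[OF open_UNIV qs(2), of t0, simplified]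
      have "Im (q t0) = 0" "Re (q t0) = rad s0" by (simp_all add: q0)
      then have "(F has_real_derivative deriv (\<lambda>t. Im (q t)) t0 / rad s0) (at t0)"
        unfolding F_def using rad_pos[of s0] by (intro DERIV_cong[OF DERIV_divide[OF d(2,1)]]) (auto simp del: rad_pos)
      then have eq: "deriv F t0 = deriv (\<lambda>t. Im (q t)) t0 / rad s0" by (rule DERIV_imp_deriv)
      have "((\<lambda>t. Im (q t)) has_real_derivative
          (deriv (\<lambda>t. Im (\<gamma> t)) t0 * cos s0 - deriv (\<lambda>t. Re (\<gamma> t)) t0 * sin s0)) (at t0)"
      proof -
        have "((\<lambda>t. (Y t - c) * p - (X t - d) * r) has_real_derivative Y' * p - X' * r) (at t0)"
          if "(X has_real_derivative X') (at t0)" "(Y has_real_derivative Y') (at t0)" for X Y X' Y' and c d p r :: real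
          by (auto intro!: derivative_eq_intros that)
        then show ?thesis
          unfolding q_alt using smooth_on_deriv(2)[OF open_UNIV \<gamma>s(1)] smooth_on_deriv(2)[OF open_UNIV \<gamma>s(2)] by simp
      qed
      then have eq2: "deriv (\<lambda>t. Im (q t)) t0 = deriv (\<lambda>t. Im (\<gamma> t)) t0 * cos s0 - deriv (\<lambda>t. Re (\<gamma> t)) t0 * sin s0"
        by (rule DERIV_imp_deriv)
      have "Im (Complex (deriv (\<lambda>t. Re (\<gamma> t)) t0) (deriv (\<lambda>t. Im (\<gamma> t)) t0) * cnj (\<gamma> t0 - cc)) \<noteq> 0"
        by (rule tangent_not_radial[OF D Dnz fr])
      then have "rad s0 * (deriv (\<lambda>t. Im (\<gamma> t)) t0 * cos s0 - deriv (\<lambda>t. Re (\<gamma> t)) t0 * sin s0) \<noteq> 0"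
        by (simp add: t0 bd_def algebra_simps)
      then show ?thesis using eq eq2 less_imp_neq[OF rad_pos[of s0]] by simp
    qed
    obtain N g where g: "open N" "F t0 \<in> N" "smooth_on N g" "\<And>y. y \<in> N \<Longrightarrow> g y \<in> V" "\<And>y. y \<in> N \<Longrightarrow> F (g y) = y"
      using local_smooth_inverse[OF V F t0V Fd] by metis
    have F0: "F t0 = 0" by (simp add: F_def q0)
    define C where "C = {s. cos (s - s0) > 0}"
    have C: "open C" unfolding C_def by (intro open_Collect_less continuous_intros)
    have tns: "smooth_on C (\<lambda>s. sin (s - s0) / cos (s - s0))"
      using C by (intro smooth_on_divide smooth_on_compose_UNIV[OF smooth_on_sin_cos(1)]
          smooth_on_compose_UNIV[OF smooth_on_sin_cos(2)] smooth_intros) (auto simp: C_def)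
    have "continuous_on C (\<lambda>s. sin (s - s0) / cos (s - s0))"
      using smooth_onD(1)[OF tns] differentiable_imp_continuous_on by blast
    then have "open (C \<inter> (\<lambda>s. sin (s - s0) / cos (s - s0)) -` N)"
      by (rule continuous_open_preimage[OF _ C g(1)])
    moreover define W where "W = C \<inter> (\<lambda>s. sin (s - s0) / cos (s - s0)) -` N"
    ultimately have W: "open W" by simp
    have "s0 \<in> W" using g(2) F0 by (simp add: W_def C_def)
    have "smooth_on W (\<lambda>s. g (sin (s - s0) / cos (s - s0)))"
      by (rule smooth_on_compose[OF g(3) smooth_on_subset[OF tns] W g(1)]) (auto simp: W_def)
    then have "smooth_on W (\<lambda>s. Re (q (g (sin (s - s0) / cos (s - s0)))))"
      by (rule smooth_on_compose_UNIV[OF qs(1) _ W])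
    then have "smooth_on W (\<lambda>s. Re (q (g (sin (s - s0) / cos (s - s0)))) / cos (s - s0))"
      using W by (intro smooth_on_divide smooth_on_compose_UNIV[OF smooth_on_sin_cos(2)] smooth_intros)
        (auto simp: W_def C_def)
    moreover have "rad s = Re (q (g (sin (s - s0) / cos (s - s0)))) / cos (s - s0)" if "s \<in> W" for s
    proof -
      define t where "t = g (sin (s - s0) / cos (s - s0))"
      have c: "cos (s - s0) > 0" and N: "sin (s - s0) / cos (s - s0) \<in> N" using that by (auto simp: W_def C_def)
      have Re0: "Re (q t) > 0" using g(4)[OF N] by (simp add: t_def V_def)
      have "Im (q t) / Re (q t) = sin (s - s0) / cos (s - s0)"
        using g(5)[OF N] by (simp add: t_def F_def)
      then have Imq: "Im (q t) = Re (q t) / cos (s - s0) * sin (s - s0)"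
        using Re0 c by (simp add: field_simps)
      define r where "r = Re (q t) / cos (s - s0)"
      have "q t = r *\<^sub>R cis (s - s0)"
        using c Imq by (simp add: complex_eq_iff r_def)
      then have "q t * cis s0 = r *\<^sub>R cis s" by (simp add: cis_mult)
      moreover have "q t * cis s0 = \<gamma> t - cc" by (simp add: q_def mult.assoc cis_mult)
      ultimately have "\<gamma> t = cc + r *\<^sub>R cis s" by (metis add.commute diff_add_cancel)
      then show ?thesis
        using reach_props(3)[of "cis s" r] fr[of t] Re0 c by (simp add: r_def t_def)
    qed
    ultimately show "\<exists>V g. open V \<and> s0 \<in> V \<and> smooth_on V g \<and> (\<forall>s\<in>V. rad s = g s)"
      using W \<open>s0 \<in> W\<close> by blast
  qed
  then show ?thesis
    unfolding piecewise_smooth_def by (intro exI[of _ "{}"]) auto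
qed

end

subsection \<open>Almost area-preserving maps between convex discs\<close>

lemma interval_index:
  fixes a :: "nat \<Rightarrow> real"
  assumes "a 0 \<le> t" "t < a m"
  shows "\<exists>i<m. a i \<le> t \<and> t < a (Suc i)"
  using assms(2)
proof (induction m)
  case 0
  then show ?case using assms(1) by simp
next
  case (Suc m)
  then show ?case by (cases "t < a m") (auto intro: less_SucI)
qed

lemma finite_set_enumeration:
  fixes C :: "real set"
  assumes "finite C" "x \<in> C" "\<And>y. y \<in> C \<Longrightarrow> x \<le> y" "\<And>y. y \<in> C \<Longrightarrow> y < z"
  obtains m and a :: "nat \<Rightarrow> real" where "m > 0" "a 0 = x" "a m = z" "\<And>i. i < m \<Longrightarrow> a i < a (Suc i)" "C = a ` {..<m}"
proof -
  define xs where "xs = sorted_list_of_set C"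
  have xs: "set xs = C" "sorted_wrt (<) xs" using assms(1) by (auto simp: xs_def)
  define m where "m = length xs"
  define a where "a i = (if i < m then xs ! i else z)" for i
  have m: "m > 0" using xs(1) assms(2) by (auto simp: m_def)
  have aC: "a i \<in> C" if "i < m" for i using that xs(1) by (auto simp: a_def m_def)
  have inc: "a i < a (Suc i)" if "i < m" for i
  proof (cases "Suc i < m")
    case True
    then show ?thesis using xs(2) that by (auto simp: a_def m_def sorted_wrt_nth_less)
  next
    case False
    then show ?thesis using assms(4)[OF aC[OF that]] that by (simp add: a_def)
  qed
  have C: "C = a ` {..<m}"
    using xs(1) by (auto simp: a_def m_def in_set_conv_nth image_iff)
  have "a 0 = x"
  proof -
    obtain j where j: "j < m" "x = a j" using C assms(2) by auto
    have "a 0 \<le> a j" using j xs(2) by (cases "j = 0") (auto simp: a_def m_def intro: less_imp_le sorted_wrt_nth_less)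
    then show ?thesis using assms(3)[OF aC[OF m]] j by simp
  qed
  then show ?thesis using that[of m a] m inc C by (simp add: a_def)
qed

lemma shift_period:
  fixes f :: "real \<Rightarrow> real"
  assumes "\<And>x. f (x + P) = f x + Q"
  shows "f (x + of_int k * P) = f x + of_int k * Q"
proof (induction k rule: int_induct[of _ 0])
  case (step1 i)
  then show ?case using assms[of "x + of_int i * P"] by (simp add: algebra_simps)
next
  case (step2 i)
  then show ?case using assms[of "x + of_int (i - 1) * P"] by (simp add: algebra_simps)
qed simp

context convex_disc
begin

text \<open>Step interpolation with the same numbers as nodes and as values. Near a node \<sigma> is
  constant, so the radius along \<sigma> is constant there; between nodes \<sigma> stays in one
  interval on which the radius is smooth.\<close>

lemma smooth_boundary_parametrization:
  assumes piecewise_smooth and n: "n > 0" and \<phi>: "\<And>i. i < n \<Longrightarrow> \<phi> i < \<phi> (Suc i)" "\<phi> n = \<phi> 0 + 2 * pi"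
  obtains \<sigma> where "smooth_on UNIV \<sigma>" "mono \<sigma>" "\<And>t. \<sigma> (t + 2 * pi) = \<sigma> t + 2 * pi"
    "smooth_on UNIV (\<lambda>t. rad (\<sigma> t))" "\<And>i. i \<le> n \<Longrightarrow> \<sigma> (\<phi> i) = \<phi> i"
proof -
  obtain B where B: "\<And>x. finite (B \<inter> {x..<x + 2 * pi})"
    "\<And>x y. x < y \<Longrightarrow> {x<..<y} \<inter> B = {} \<Longrightarrow>
        \<exists>J g. open J \<and> {x..y} \<subseteq> J \<and> smooth_on J g \<and> (\<forall>s\<in>{x..y}. rad s = g s)"
    using assms(1) unfolding piecewise_smooth_def by blast
  have \<phi>mono: "\<phi> i < \<phi> j" if "i < j" "j \<le> n" for i j
    using that
  proof (induction rule: strict_inc_induct)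
    case (base i)
    then show ?case using \<phi>(1) by simp
  next
    case (step i)
    then show ?case using \<phi>(1)[of i] by force
  qed
  \<comment> \<open>The corners of one period serve as nodes for smoothness; the marked angles are
    added so that \<sigma> fixes them.\<close>
  define C where "C = (B \<inter> {\<phi> 0..<\<phi> 0 + 2 * pi}) \<union> \<phi> ` {..<n}"
  have "finite C" using B(1) by (simp add: C_def)
  moreover have "\<phi> 0 \<in> C" using n by (simp add: C_def)
  moreover have "\<phi> 0 \<le> y \<and> y < \<phi> 0 + 2 * pi" if "y \<in> C" for y
    using that \<phi>mono[of 0] \<phi>mono[of _ n] \<phi>(2) unfolding C_def
    by (auto simp: less_imp_le) (metis gr0I less_imp_le order_refl less_le_not_le)
  ultimately obtain m a where a: "m > 0" "a 0 = \<phi> 0" "a m = \<phi> 0 + 2 * pi" "\<And>i. i < m \<Longrightarrow> a i < a (Suc i)" "C = a ` {..<m}"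
    using finite_set_enumeration[of C "\<phi> 0" "\<phi> 0 + 2 * pi"] by metis
  have amono: "a i \<le> a j" if "i \<le> j" "j \<le> m" for i j
    using that
  proof (induction rule: dec_induct)
    case (step k)
    then show ?case using a(4)[of k] by force
  qed simp
  obtain \<sigma> \<delta> where \<sigma>: "smooth_on UNIV \<sigma>" "mono \<sigma>" "\<And>x. \<sigma> (x + 2 * pi) = \<sigma> x + 2 * pi" "\<delta> > 0"
    "\<And>i x. i \<le> m \<Longrightarrow> \<bar>x - a i\<bar> \<le> \<delta> \<Longrightarrow> \<sigma> x = a i"
    using step_interpolation[of m a a "2 * pi" "2 * pi"] a(1-4) by (smt (verit))
  have fp: "\<sigma> (a i) = a i" if "i \<le> m" for i using \<sigma>(4,5) that by simp
  have gap: "{a i<..<a (Suc i)} \<inter> B = {}" if i: "i < m" for i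
  proof -
    have "x \<notin> B" if x: "a i < x" "x < a (Suc i)" for x
    proof
      assume "x \<in> B"
      moreover have "\<phi> 0 \<le> x" "x < \<phi> 0 + 2 * pi"
        using x amono[of 0 i] amono[of "Suc i" m] i a(2,3) by auto
      ultimately have "x \<in> C" by (simp add: C_def)
      then obtain j where "j < m" "x = a j" using a(5) by auto
      then show False using amono[of j i] amono[of "Suc i" j] x i by (cases "j \<le> i") auto
    qed
    then show ?thesis by auto
  qed
  have loc: "\<exists>V. open V \<and> t \<in> V \<and> smooth_on V (\<lambda>t. rad (\<sigma> t))" if t: "\<phi> 0 \<le> t" "t < \<phi> 0 + 2 * pi" for t
  proof -
    obtain i where i: "i < m" "a i \<le> t" "t < a (Suc i)" using interval_index[of a t m] t a(2,3) by auto
    show ?thesis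
    proof (cases "t = a i")
      case True
      have "smooth_on {a i - \<delta><..<a i + \<delta>} (\<lambda>t. rad (\<sigma> t))"
        by (rule smooth_on_cong[OF _ _ smooth_on_const[of _ "rad (a i)"]]) (use \<sigma>(5)[of i] i in auto)
      then show ?thesis using True \<sigma>(4) by (intro exI[of _ "{a i - \<delta><..<a i + \<delta>}"]) auto
    next
      case False
      obtain J g where J: "open J" "{a i..a (Suc i)} \<subseteq> J" "smooth_on J g" "\<forall>s\<in>{a i..a (Suc i)}. rad s = g s"
        using B(2)[OF a(4)[OF i(1)] gap[OF i(1)]] by blast
      have rng: "\<sigma> s \<in> {a i..a (Suc i)}" if "s \<in> {a i<..<a (Suc i)}" for s
        using monoD[OF \<sigma>(2), of "a i" s] monoD[OF \<sigma>(2), of s "a (Suc i)"] fp[of i] fp[of "Suc i"] that i by auto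
      have "smooth_on {a i<..<a (Suc i)} (\<lambda>t. g (\<sigma> t))"
        using rng J(2) by (intro smooth_on_compose[OF J(3) smooth_on_subset[OF \<sigma>(1)] _ J(1)]) auto
      then have "smooth_on {a i<..<a (Suc i)} (\<lambda>t. rad (\<sigma> t))"
        by (rule smooth_on_cong[rotated 2]) (use rng J(4) in auto)
      then show ?thesis using False i by (intro exI[of _ "{a i<..<a (Suc i)}"]) auto
    qed
  qed
  have "smooth_on UNIV (\<lambda>t. rad (\<sigma> t))"
  proof (rule smooth_on_local)
    fix t :: real
    define k where "k = \<lfloor>(t - \<phi> 0) / (2 * pi)\<rfloor>"
    define t' where "t' = t - of_int k * (2 * pi)"
    have "\<phi> 0 \<le> t'" "t' < \<phi> 0 + 2 * pi"
      using floor_divide_lower[of "2 * pi" "t - \<phi> 0"] floor_divide_upper[of "2 * pi" "t - \<phi> 0"]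
      by (auto simp: t'_def k_def algebra_simps)
    then obtain V where V: "open V" "t' \<in> V" "smooth_on V (\<lambda>t. rad (\<sigma> t))" using loc by blast
    define V' where "V' = (\<lambda>s. s - of_int k * (2 * pi)) -` V"
    have "open V'" unfolding V'_def by (intro open_vimage V(1) continuous_intros)
    have "smooth_on V' (\<lambda>s. rad (\<sigma> (s - of_int k * (2 * pi))))"
      by (rule smooth_on_compose[OF V(3)]) (use \<open>open V'\<close> V(1) in \<open>auto simp: V'_def intro!: smooth_intros\<close>)
    moreover have "rad (\<sigma> s) = rad (\<sigma> (s - of_int k * (2 * pi)))" for s
    proof -
      have "\<sigma> s = \<sigma> (s - of_int k * (2 * pi)) + of_int k * (2 * pi)"
        using shift_period[of \<sigma> "2 * pi" "2 * pi" "s - of_int k * (2 * pi)" k] \<sigma>(3) by simp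
      moreover have "rad (x + of_int k * (2 * pi)) = rad x" for x
        using shift_period[of "\<lambda>s. rad s" "2 * pi" 0 x k] rad_period by simp
      ultimately show ?thesis by metis
    qed
    moreover have "t \<in> V'" using V(2) by (simp add: V'_def t'_def)
    ultimately show "\<exists>V g. open V \<and> t \<in> V \<and> smooth_on V g \<and> (\<forall>y\<in>V. rad (\<sigma> y) = g y)"
      using \<open>open V'\<close> by blast
  qed
  moreover have "\<sigma> (\<phi> i) = \<phi> i" if "i \<le> n" for i
  proof (cases "i = n")
    case True
    then show ?thesis using fp[of m] a(3) \<phi>(2) by simp
  next
    case False
    then have "\<phi> i \<in> C" using that by (simp add: C_def)
    then show ?thesis using a(5) fp by auto
  qed
  ultimately show ?thesis using that \<sigma>(1,2,3) by blast
qed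

text \<open>\<open>G\<close> measures twice the area swept out from the centre, so it grows over a
  period by twice the area of \<open>D\<close>.\<close>

lemma rad_square_antideriv:
  obtains G where "\<And>s. (G has_real_derivative (rad s)\<^sup>2) (at s)"
    "\<And>s. G (s + 2 * pi) = G s + 2 * measure lebesgue D"
proof -
  have "continuous_on UNIV (\<lambda>s. (rad s)\<^sup>2)" by (intro continuous_intros continuous_on_rad)
  then obtain G where G: "\<And>s. (G has_real_derivative (rad s)\<^sup>2) (at s)" using continuous_antideriv by metis
  have "((\<lambda>s. G (s + 2 * pi) - G s) has_real_derivative 0) (at s)" for s
  proof -
    have "((\<lambda>s. G (s + 2 * pi)) has_real_derivative (rad (s + 2 * pi))\<^sup>2) (at s)"
      using G[of "s + 2 * pi"] by (simp add: DERIV_shift)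
    from DERIV_diff[OF this G[of s]] show ?thesis by (simp add: rad_period)
  qed
  then have const: "G (s + 2 * pi) - G s = G (0 + 2 * pi) - G 0" for s
    using DERIV_isconst_all by blast
  have "((\<lambda>s. (rad s)\<^sup>2) has_integral (G (2 * pi) - G 0)) {0..2 * pi}"
    using G by (intro fundamental_theorem_of_calculus)
      (auto simp: has_real_derivative_iff_has_vector_derivative[symmetric] has_field_derivative_at_within)
  then have "G (2 * pi) - G 0 = 2 * measure lebesgue D" by (simp add: measure_disc integral_unique)
  then show ?thesis using that[of G] G const by (metis add.commute add_0 diff_eq_eq)
qed

end

text \<open>A positive derivative gives injectivity, and the shift relation makes \<open>F\<close>
  unbounded in both directions, hence surjective. By injectivity the global inverse coincides with
  the smooth local ones.\<close>

lemma equivariant_inverse: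
  fixes F :: "real \<Rightarrow> real"
  assumes F: "smooth_on UNIV F" "\<And>x. deriv F x > 0" "\<And>x. F (x + P) = F x + L" and "P > 0" "L > 0"
  obtains h where "smooth_on UNIV h" "\<And>y. F (h y) = y" "\<And>y. h (y + L) = h y + P"
proof -
  have D: "(F has_real_derivative deriv F x) (at x)" for x using smooth_on_deriv(2)[OF open_UNIV F(1)] by simp
  have less: "F x < F y" if "x < y" for x y
    using DERIV_pos_imp_increasing[OF that] D F(2) by blast
  then have inj: "x = y" if "F x = F y" for x y
    using that by (metis less_irrefl linorder_neqE)
  have cont: "continuous_on S F" for S
    using D DERIV_continuous_on has_field_derivative_at_within by blast
  have "\<exists>x. F x = y" for y
  proof -
    obtain k :: nat where k: "\<bar>y - F 0\<bar> / L < k" using reals_Archimedean2 by blast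
    then have "\<bar>y - F 0\<bar> \<le> k * L" using assms(5) by (simp add: divide_less_eq less_imp_le)
    moreover have "F (k * P) = F 0 + k * L" "F (- (k * P)) = F 0 - k * L"
      using shift_period[of F P L 0 "int k"] shift_period[of F P L 0 "- int k"] F(3) by simp_all
    ultimately have "F (- (k * P)) \<le> y" "y \<le> F (k * P)" by (auto simp: abs_le_iff)
    then show ?thesis using IVT'[of F "- (k * P)" y "k * P"] cont assms(4) by auto
  qed
  then obtain h where h: "\<And>y. F (h y) = y" by metis
  have "smooth_on UNIV h"
  proof (rule smooth_on_local)
    fix y :: real
    have "deriv F (h y) \<noteq> 0" using F(2)[of "h y"] by simp
    then obtain N g where g: "open N" "F (h y) \<in> N" "smooth_on N g" "\<And>y. y \<in> N \<Longrightarrow> F (g y) = y"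
      using local_smooth_inverse[OF open_UNIV F(1) UNIV_I] by metis
    have "h z = g z" if "z \<in> N" for z using g(4)[OF that] h[of z] inj by metis
    then show "\<exists>V g. open V \<and> y \<in> V \<and> smooth_on V g \<and> (\<forall>y\<in>V. h y = g y)" using g h[of y] by metis
  qed
  moreover have "h (y + L) = h y + P" for y
    by (rule inj) (simp add: h F(3))
  ultimately show ?thesis using that h by blast
qed

section \<open>Jacobians in logarithmic polar coordinates\<close>

lemma jac_eq:
  assumes "((\<lambda>z. Re (F z)) has_derivative (\<lambda>h. a * Re h + b * Im h)) (at w)"
    and "((\<lambda>z. Im (F z)) has_derivative (\<lambda>h. c * Re h + d * Im h)) (at w)"
  shows "jac F w = a * d - b * c"
  unfolding jac_def frechet_derivative_at[OF assms(1), symmetric] frechet_derivative_at[OF assms(2), symmetric]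
  by simp

text \<open>The exponential is holomorphic, so its real Jacobian is the squared modulus of its
  derivative. With w = log r + i s, the point c + exp w has polar coordinates r and s about
  \<open>c\<close>.\<close>

lemma jac_polar:
  assumes "smooth_map_on UNIV \<Psi>"
  shows "jac (\<lambda>w. \<Psi> (c + exp w)) w = jac \<Psi> (c + exp w) * (norm (exp w))\<^sup>2"
proof -
  let ?z = "c + exp w"
  define A where "A = frechet_derivative (\<lambda>z. Re (\<Psi> z)) (at ?z)"
  define B where "B = frechet_derivative (\<lambda>z. Im (\<Psi> z)) (at ?z)"
  have sm: "smooth_on UNIV (\<lambda>z. Re (\<Psi> z))" "smooth_on UNIV (\<lambda>z. Im (\<Psi> z))"
    using assms by (simp_all add: smooth_map_on_complex_iff)
  have A: "((\<lambda>z. Re (\<Psi> z)) has_derivative A) (at ?z)" and B: "((\<lambda>z. Im (\<Psi> z)) has_derivative B) (at ?z)"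
    using smooth_on_differentiable[OF sm(1), of ?z] smooth_on_differentiable[OF sm(2), of ?z]
    by (simp_all add: A_def B_def frechet_derivative_works[symmetric])
  have e: "((\<lambda>w. c + exp w) has_derivative (\<lambda>h. exp w * h)) (at w)"
    by (auto intro!: derivative_eq_intros simp: mult.commute)
  have form: "L (exp w * h) = (L 1 * Re (exp w) + L \<i> * Im (exp w)) * Re h + (L \<i> * Re (exp w) - L 1 * Im (exp w)) * Im h"
    if "linear L" for L :: "complex \<Rightarrow> real" and h
  proof -
    have "L u = L 1 * Re u + L \<i> * Im u" for u
    proof -
      have "u = Re u *\<^sub>R 1 + Im u *\<^sub>R \<i>" by (simp add: complex_eq_iff)
      then have "L u = L (Re u *\<^sub>R 1 + Im u *\<^sub>R \<i>)" by simp
      also have "\<dots> = Re u * L 1 + Im u * L \<i>" by (simp only: linear_add[OF that] linear_scale[OF that] real_scaleR_def)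
      finally show ?thesis by (simp add: mult.commute)
    qed
    from this[of "exp w * h"] show ?thesis by (simp add: algebra_simps)
  qed
  have lin: "linear A" "linear B" using A B has_derivative_linear by blast+
  have "jac (\<lambda>w. \<Psi> (c + exp w)) w =
     (A 1 * Re (exp w) + A \<i> * Im (exp w)) * (B \<i> * Re (exp w) - B 1 * Im (exp w)) -
     (A \<i> * Re (exp w) - A 1 * Im (exp w)) * (B 1 * Re (exp w) + B \<i> * Im (exp w))"
    using has_derivative_compose[OF e A] has_derivative_compose[OF e B]
    unfolding form[OF lin(1)] form[OF lin(2)] by (rule jac_eq)
  also have "\<dots> = (A 1 * B \<i> - A \<i> * B 1) * ((Re (exp w))\<^sup>2 + (Im (exp w))\<^sup>2)"
    by algebra
  finally show ?thesis by (simp only: jac_def[of \<Psi>] A_def B_def cmod_power2)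
qed

text \<open>Periodicity makes the choice of logarithm immaterial, so \<open>F\<close> descends to
  the plane without its centre. Being constant far to the left, it extends by a constant across the
  centre.\<close>

lemma polar_lift:
  assumes F: "smooth_map_on UNIV F" "\<And>w. F (w + 2 * pi * \<i>) = F w" "\<And>w. Re w \<le> s0 \<Longrightarrow> F w = b"
  obtains \<Psi> where "smooth_map_on UNIV \<Psi>" "\<And>w. \<Psi> (c + exp w) = F w" "\<Psi> c = b" "jac \<Psi> c = 0"
proof -
  have per: "F (w + of_int k * (2 * pi * \<i>)) = F w" for w k
  proof (induction k rule: int_induct[of _ 0])
    case (step1 i)
    then show ?case using F(2)[of "w + of_int i * (2 * pi * \<i>)"] by (simp add: algebra_simps)
  next
    case (step2 i)
    then show ?case using F(2)[of "w + of_int (i - 1) * (2 * pi * \<i>)"] by (simp add: algebra_simps)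
  qed simp
  have exp_eq_F: "F v = F w" if e: "exp v = exp w" for v w
  proof -
    obtain n :: int where "v = w + of_real (of_int (2 * n) * pi) * \<i>"
      using e unfolding exp_eq by blast
    then show ?thesis using per[of w n] by (simp add: algebra_simps)
  qed
  define \<Psi> where "\<Psi> z = (if z = c then b else F (Ln (z - c)))" for z
  have exp: "\<Psi> (c + exp w) = F w" for w
    using exp_eq_F[of "Ln (exp w)" w] by (simp add: \<Psi>_def)
  have near: "\<Psi> z = b" if "z \<in> ball c (exp s0)" for z
  proof (cases "z = c")
    case False
    then have "Re (Ln (z - c)) = ln (norm (z - c))" by simp
    also have "\<dots> \<le> ln (exp s0)"
      using that False by (subst ln_le_cancel_iff) (auto simp: dist_norm norm_minus_commute)
    also have "\<dots> = s0" by simp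
    finally show ?thesis using F(3) False by (simp add: \<Psi>_def)
  qed (simp add: \<Psi>_def)
  have loc: "\<exists>V. open V \<and> z \<in> V \<and> smooth_map_on V \<Psi>" for z
  proof (cases "z = c")
    case True
    have "smooth_map_on (ball c (exp s0)) (\<lambda>_. b)" by (simp add: smooth_map_on_def smooth_on_const)
    then have "smooth_map_on (ball c (exp s0)) \<Psi>"
      unfolding smooth_map_on_def using near by (auto intro: smooth_on_cong[rotated 2])
    then show ?thesis using True by (intro exI[of _ "ball c (exp s0)"]) simp
  next
    case False
    define V where "V = (\<lambda>x. (x - c) / (z - c)) -` {x. Re x > 0}"
    have V: "open V"
      unfolding V_def using False by (intro open_vimage open_halfspace_Re_gt continuous_intros) auto
    have zV: "z \<in> V" using False by (simp add: V_def)
    \<comment> \<open>A branch of the logarithm of x - c adapted to \<open>z\<close>: on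
      \<open>V\<close> the quotient lies in the right half-plane and thus avoids the cut.\<close>
    define l where "l x = Ln (z - c) + Ln ((x - c) / (z - c))" for x
    have nn: "(x - c) / (z - c) \<notin> \<real>\<^sub>\<le>\<^sub>0" if "x \<in> V" for x
      using that by (auto simp: V_def complex_nonpos_Reals_iff)
    then have "l holomorphic_on V"
      unfolding l_def using False by (intro holomorphic_intros) auto
    then have l: "smooth_map_on V l" by (rule smooth_map_on_holomorphic[OF V])
    have eq: "\<Psi> x = F (l x)" if "x \<in> V" for x
    proof -
      have "x \<noteq> c" using that by (auto simp: V_def)
      then have "exp (l x) = x - c" using False by (simp add: l_def exp_add)
      then show ?thesis using exp[of "l x"] by simp
    qed
    have sm: "smooth_on V (\<lambda>x. F (l x) \<bullet> i)" if "i \<in> Basis" for i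
      using F(1) that by (intro smooth_on_compose_map[OF V open_UNIV _ _ l]) (auto simp: smooth_map_on_def)
    have "smooth_map_on V \<Psi>"
      unfolding smooth_map_on_def by (intro ballI smooth_on_cong[OF V _ sm]) (simp_all add: eq)
    then show ?thesis using V zV by blast
  qed
  have smooth: "smooth_map_on UNIV \<Psi>"
    unfolding smooth_map_on_def
  proof (intro ballI smooth_on_local)
    fix i :: complex and x assume "i \<in> Basis"
    then show "\<exists>V g. open V \<and> x \<in> V \<and> smooth_on V g \<and> (\<forall>y\<in>V. \<Psi> y \<bullet> i = g y)"
      using loc[of x] unfolding smooth_map_on_def by blast
  qed
  have "jac \<Psi> c = 0"
  proof -
    have "((\<lambda>z. Re (\<Psi> z)) has_derivative (\<lambda>h. 0 * Re h + 0 * Im h)) (at c)"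
      by (rule has_derivative_transform_within_open[of "\<lambda>_. Re b" _ _ _ "ball c (exp s0)"]) (use near in auto)
    moreover have "((\<lambda>z. Im (\<Psi> z)) has_derivative (\<lambda>h. 0 * Re h + 0 * Im h)) (at c)"
      by (rule has_derivative_transform_within_open[of "\<lambda>_. Im b" _ _ _ "ball c (exp s0)"]) (use near in auto)
    ultimately show ?thesis using jac_eq by fastforce
  qed
  then show ?thesis using that smooth exp by (simp add: \<Psi>_def)
qed

text \<open>In the coordinates w = log r + i s the Jacobian of \<open>F\<close> is k k' \<rho> P^2
  \<sigma>' times the derivative of \<tau> in s at fixed \<rho>. Where k' is nonzero, \<tau> is
  \<open>\<mu>0\<close>, which bounds the angular factor by c g^2; k k' \<rho> is at most (1 +
  \<delta>)^2 \<rho>^2, and \<rho> g is the modulus of exp w.\<close>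

lemma area_map:
  assumes S: "convex_disc D cc" and T: "convex_disc D' cc'" and ps: "convex_disc.piecewise_smooth D' cc'"
    and area: "measure lebesgue D = 1" "measure lebesgue D' = 1" and n: "n > 0"
    and \<theta>: "\<And>i. i < n \<Longrightarrow> \<theta> i < \<theta> (Suc i)" "\<theta> n = \<theta> 0 + 2 * pi"
    and \<phi>: "\<And>i. i < n \<Longrightarrow> \<phi> i < \<phi> (Suc i)" "\<phi> n = \<phi> 0 + 2 * pi"
    and e: "e > 0"
  obtains \<Psi> where "smooth_map_on UNIV \<Psi>" "range \<Psi> \<subseteq> D'"
    "\<And>i. i < n \<Longrightarrow> \<Psi> ` convex_disc.bd D cc ` {\<theta> i..\<theta> (Suc i)} \<subseteq> convex_disc.bd D' cc' ` {\<phi> i..\<phi> (Suc i)}"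
    "\<And>z. \<bar>jac \<Psi> z\<bar> \<le> 1 + e"
proof -
  interpret S: convex_disc D cc by (rule S)
  interpret T: convex_disc D' cc' by (rule T)
  \<comment> \<open>The losses to come: \<open>c\<close> will be at most (1 + \<delta>)/(1 -
    \<delta>)^2, and the radial profile costs (1 + \<delta>)^2.\<close>
  have "((\<lambda>\<delta>::real. (1 + \<delta>) ^ 3 / (1 - \<delta>) ^ 2) \<longlongrightarrow> (1 + 0) ^ 3 / (1 - 0) ^ 2) (at_right 0)"
    by (intro tendsto_intros) auto
  then have "eventually (\<lambda>\<delta>::real. (1 + \<delta>) ^ 3 / (1 - \<delta>) ^ 2 < 1 + e) (at_right 0)"
    using e by (intro order_tendstoD(2)) auto
  moreover have "eventually (\<lambda>\<delta>::real. 0 < \<delta> \<and> \<delta> < 1) (at_right 0)"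
    by (auto simp: eventually_at_right_field intro: exI[of _ 1])
  ultimately have "eventually (\<lambda>\<delta>::real. (1 + \<delta>) ^ 3 / (1 - \<delta>) ^ 2 < 1 + e \<and> 0 < \<delta> \<and> \<delta> < 1) (at_right 0)"
    by (rule eventually_conj)
  then obtain \<delta> :: real where \<delta>: "0 < \<delta>" "\<delta> < 1" "(1 + \<delta>) ^ 3 / (1 - \<delta>) ^ 2 < 1 + e"
    using eventually_happens'[of "at_right (0::real)"] by (metis (mono_tags, lifting) trivial_limit_at_right_real)
  define \<eta> where "\<eta> = \<delta> / pi"
  have \<eta>: "\<eta> > 0" "2 + 2 * pi * \<eta> = 2 * (1 + \<delta>)" using \<delta> by (simp_all add: \<eta>_def)

  obtain \<sigma> where \<sigma>: "smooth_on UNIV \<sigma>" "mono \<sigma>" "\<And>t. \<sigma> (t + 2 * pi) = \<sigma> t + 2 * pi"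
    "smooth_on UNIV (\<lambda>t. T.rad (\<sigma> t))" "\<And>i. i \<le> n \<Longrightarrow> \<sigma> (\<phi> i) = \<phi> i"
    using T.smooth_boundary_parametrization[OF ps n \<phi>] by metis
  define P where "P t = T.rad (\<sigma> t)" for t
  define \<sigma>' where "\<sigma>' = deriv \<sigma>"
  have P: "smooth_on UNIV P" "\<And>t. P t > 0" "\<And>t. P (t + 2 * pi) = P t"
    using \<sigma>(4) by (simp_all add: P_def[abs_def] \<sigma>(3) T.rad_period)
  have \<sigma>': "smooth_on UNIV \<sigma>'" "\<And>t. (\<sigma> has_real_derivative \<sigma>' t) (at t)" "\<And>t. \<sigma>' t \<ge> 0"
  proof -
    show "smooth_on UNIV \<sigma>'" and D: "\<And>t. (\<sigma> has_real_derivative \<sigma>' t) (at t)"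
      using smooth_on_deriv[OF open_UNIV \<sigma>(1)] by (simp_all add: \<sigma>'_def)
    show "\<sigma>' t \<ge> 0" for t
      by (rule mono_on_imp_deriv_nonneg[OF _ D, of UNIV]) (use \<sigma>(2) in auto)
  qed

  \<comment> \<open>\<open>g\<close> replaces the source radius. Beyond it the map will depend on
    the angle alone, so the true source boundary may have corners.\<close>
  obtain g where g: "smooth_on UNIV g" "\<And>s. g (s + 2 * pi) = g s" "\<And>s. (1 - \<delta>) * S.rad s < g s" "\<And>s. g s < S.rad s"
    using S.smooth_inner_radius[OF \<delta>(1,2)] by metis
  have g_pos: "g s > 0" for s
    using g(3)[of s] mult_pos_pos[of "1 - \<delta>" "S.rad s"] \<delta> S.rad_pos[of s] by linarith

  obtain G where G: "\<And>s. (G has_real_derivative (T.rad s)\<^sup>2) (at s)" "\<And>s. G (s + 2 * pi) = G s + 2"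
    using T.rad_square_antideriv area(2) by (metis mult.right_neutral)
  \<comment> \<open>twice the area of the target swept out up to \<open>t\<close>; the term \<open>\<eta> * t\<close> makes it invertible where \<open>\<sigma>\<close> stops\<close>
  define W where "W t = G (\<sigma> t) + \<eta> * t" for t
  have W': "(W has_real_derivative (P t)\<^sup>2 * \<sigma>' t + \<eta>) (at t)" for t
    unfolding W_def P_def
    by (rule DERIV_cong[OF DERIV_add[OF DERIV_chain2[OF G(1) \<sigma>'(2)] DERIV_cmult_Id]]) simp
  have W_smooth: "smooth_on UNIV W"
    by (rule smooth_on_real_deriv[OF open_UNIV W']) (intro smooth_intros P \<sigma>' open_UNIV)
  have dW: "deriv W t = (P t)\<^sup>2 * \<sigma>' t + \<eta>" for t by (rule DERIV_imp_deriv[OF W'])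
  have w0: "0 \<le> (P t)\<^sup>2 * \<sigma>' t" for t using \<sigma>'(3) by simp
  have dW_pos: "deriv W t > 0" for t using w0[of t] \<eta>(1) by (simp add: dW add_nonneg_pos)
  have W_shift: "W (t + 2 * pi) = W t + 2 * (1 + \<delta>)" for t
    unfolding W_def \<sigma>(3) G(2) using \<eta>(2) by (simp add: algebra_simps)
  obtain h where h: "smooth_on UNIV h" "\<And>y. W (h y) = y" "\<And>y. h (y + 2 * (1 + \<delta>)) = h y + 2 * pi"
    using equivariant_inverse[OF W_smooth dW_pos W_shift] \<delta> by auto

  have g2: "smooth_on UNIV (\<lambda>s. (g s)\<^sup>2)" by (intro smooth_intros g open_UNIV)
  obtain R where R: "\<And>x. (R has_real_derivative (g x)\<^sup>2) (at x)" "smooth_on UNIV R" "R 0 = 0"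
    using smooth_on_antideriv[OF g2] by blast
  define Rt where "Rt = R (2 * pi)"
  have R_shift: "R (s + 2 * pi) = R s + Rt" for s
  proof -
    have "((\<lambda>s. R (s + 2 * pi) - R s) has_real_derivative 0) (at s)" for s
    proof -
      have "((\<lambda>s. R (s + 2 * pi)) has_real_derivative (g (s + 2 * pi))\<^sup>2) (at s)"
        using R(1)[of "s + 2 * pi"] by (simp add: DERIV_shift)
      from DERIV_diff[OF this R(1)[of s]] show ?thesis by (simp add: g(2))
    qed
    then have "R (s + 2 * pi) - R s = R (0 + 2 * pi) - R 0" using DERIV_isconst_all by blast
    then show ?thesis using R(3) by (simp add: Rt_def)
  qed
  \<comment> \<open>\<open>Rt\<close> is twice the area inside the curve of radius \<open>g\<close>,
    which exceeds (1 - \<delta>) times the radius of a disc of area 1.\<close>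
  have Rt: "2 * (1 - \<delta>)\<^sup>2 \<le> Rt"
  proof -
    obtain GS where GS: "\<And>s. (GS has_real_derivative (S.rad s)\<^sup>2) (at s)" "\<And>s. GS (s + 2 * pi) = GS s + 2"
      using S.rad_square_antideriv area(1) by (metis mult.right_neutral)
    have "R 0 - (1 - \<delta>)\<^sup>2 * GS 0 \<le> R (2 * pi) - (1 - \<delta>)\<^sup>2 * GS (2 * pi)"
    proof (rule DERIV_nonneg_imp_nondecreasing[of 0 "2 * pi" "\<lambda>s. R s - (1 - \<delta>)\<^sup>2 * GS s"])
      fix s
      have "((1 - \<delta>) * S.rad s)\<^sup>2 \<le> (g s)\<^sup>2"
        using g(3)[of s] \<delta> S.rad_pos[of s] by (intro power_mono) (auto simp: less_imp_le)
      then show "\<exists>y. ((\<lambda>s. R s - (1 - \<delta>)\<^sup>2 * GS s) has_real_derivative y) (at s) \<and> 0 \<le> y"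
        by (intro exI[of _ "(g s)\<^sup>2 - (1 - \<delta>)\<^sup>2 * (S.rad s)\<^sup>2"] conjI DERIV_diff R(1) DERIV_cmult GS(1)) (simp add: power_mult_distrib)
    qed simp
    then show ?thesis using R(3) GS(2)[of 0] by (simp add: Rt_def algebra_simps)
  qed
  have Rt_pos: "Rt > 0" using Rt \<delta> by (smt (verit) zero_less_power)
  \<comment> \<open>The ratio of the growths of \<open>W\<close> and \<open>R\<close> over a period,
    so that \<open>\<mu>0\<close> advances by exactly one turn when its argument does.\<close>
  define c where "c = 2 * (1 + \<delta>) / Rt"
  have c: "c > 0" "c * Rt = 2 * (1 + \<delta>)" using Rt_pos \<delta> by (simp_all add: c_def)
  have c_le: "c * (1 + \<delta>)\<^sup>2 \<le> 1 + e"
  proof -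
    have pos: "(1 - \<delta>)\<^sup>2 > 0" using \<delta> by simp
    have "c \<le> 2 * (1 + \<delta>) / (2 * (1 - \<delta>)\<^sup>2)"
      unfolding c_def using Rt \<delta> pos by (intro divide_left_mono) (auto intro!: mult_pos_pos Rt_pos)
    then have "c * (1 + \<delta>)\<^sup>2 \<le> 2 * (1 + \<delta>) / (2 * (1 - \<delta>)\<^sup>2) * (1 + \<delta>)\<^sup>2"
      by (intro mult_right_mono) auto
    also have "2 * (1 + \<delta>) / (2 * (1 - \<delta>)\<^sup>2) = (1 + \<delta>) / (1 - \<delta>)\<^sup>2"
      by (rule mult_divide_mult_cancel_left) simp
    also have "(1 + \<delta>) / (1 - \<delta>)\<^sup>2 * (1 + \<delta>)\<^sup>2 = (1 + \<delta>) ^ 3 / (1 - \<delta>)\<^sup>2"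
      by (simp add: power3_eq_cube power2_eq_square)
    finally show ?thesis using \<delta>(3) by linarith
  qed
  \<comment> \<open>The area-equalising angle: \<open>W\<close> at \<open>\<mu>0 s\<close> equals c
    R(s). Differentiating this and dropping the positive term with \<eta> gives the bound
    \<open>match\<close>.\<close>
  define \<mu>0 where "\<mu>0 s = h (c * R s)" for s
  have \<mu>0: "smooth_on UNIV \<mu>0" "\<mu>0 (s + 2 * pi) = \<mu>0 s + 2 * pi" for s
  proof -
    have "smooth_on UNIV (\<lambda>s. c * R s)" by (intro smooth_intros R open_UNIV)
    then show "smooth_on UNIV \<mu>0" unfolding \<mu>0_def by (rule smooth_on_compose_UNIV[OF h(1) _ open_UNIV])
    have "c * R (s + 2 * pi) = c * R s + 2 * (1 + \<delta>)" by (simp only: R_shift distrib_left c(2))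
    then show "\<mu>0 (s + 2 * pi) = \<mu>0 s + 2 * pi" by (simp only: \<mu>0_def h(3))
  qed
  define \<mu>0' where "\<mu>0' = deriv \<mu>0"
  have \<mu>0': "(\<mu>0 has_real_derivative \<mu>0' s) (at s)" for s
    using smooth_on_deriv(2)[OF open_UNIV \<mu>0(1)] by (simp add: \<mu>0'_def)
  have match: "0 \<le> (P (\<mu>0 s))\<^sup>2 * \<sigma>' (\<mu>0 s) * \<mu>0' s" "(P (\<mu>0 s))\<^sup>2 * \<sigma>' (\<mu>0 s) * \<mu>0' s \<le> c * (g s)\<^sup>2" for s
  proof -
    have "((\<lambda>s. W (\<mu>0 s)) has_real_derivative ((P (\<mu>0 s))\<^sup>2 * \<sigma>' (\<mu>0 s) + \<eta>) * \<mu>0' s) (at s)"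
      by (rule DERIV_chain2[OF W' \<mu>0'])
    moreover have "((\<lambda>s. W (\<mu>0 s)) has_real_derivative c * (g s)\<^sup>2) (at s)"
      unfolding \<mu>0_def h(2) by (intro DERIV_cmult R(1))
    ultimately have eq: "((P (\<mu>0 s))\<^sup>2 * \<sigma>' (\<mu>0 s) + \<eta>) * \<mu>0' s = c * (g s)\<^sup>2" by (rule DERIV_unique)
    have "0 < c * (g s)\<^sup>2" using c(1) g_pos[of s] by simp
    then have pos: "0 < \<mu>0' s"
      using eq dW_pos[of "\<mu>0 s"] by (metis dW zero_less_mult_pos)
    then show "0 \<le> (P (\<mu>0 s))\<^sup>2 * \<sigma>' (\<mu>0 s) * \<mu>0' s" using w0 by simp
    show "(P (\<mu>0 s))\<^sup>2 * \<sigma>' (\<mu>0 s) * \<mu>0' s \<le> c * (g s)\<^sup>2"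
      using eq mult_pos_pos[OF \<eta>(1) pos] by (simp add: distrib_right)
  qed

  obtain \<mu>1 \<delta>1 where \<mu>1: "smooth_on UNIV \<mu>1" "mono \<mu>1" "\<And>x. \<mu>1 (x + 2 * pi) = \<mu>1 x + 2 * pi" "\<delta>1 > 0"
    "\<And>i x. i \<le> n \<Longrightarrow> \<bar>x - \<theta> i\<bar> \<le> \<delta>1 \<Longrightarrow> \<mu>1 x = \<phi> i"
    using step_interpolation[of n \<theta> \<phi> "2 * pi" "2 * pi"] n \<theta> \<phi> by (smt (verit))
  have \<mu>1': "(\<mu>1 has_real_derivative deriv \<mu>1 s) (at s)" for s
    using smooth_on_deriv(2)[OF open_UNIV \<mu>1(1)] by simp

  obtain k k' d where k: "0 < d" "d < 1/2" "smooth_on UNIV k" "\<And>x. (k has_real_derivative k' x) (at x)"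
    "\<And>x. x \<le> d \<Longrightarrow> k x = 0" "\<And>x. x \<ge> 1 - d \<Longrightarrow> k x = 1" "\<And>x. 0 \<le> k x" "\<And>x. k x \<le> 1"
    "\<And>x. 0 \<le> k' x" "\<And>x. k' x \<le> 1 + \<delta>" "\<And>x. x \<ge> 0 \<Longrightarrow> k x \<le> (1 + \<delta>) * x"
    "\<And>x. x \<ge> 1 - d \<Longrightarrow> k' x = 0"
    using radial_profile[OF \<delta>(1)] by metis
  \<comment> \<open>The change from \<open>\<mu>0\<close> to \<open>\<mu>1\<close> takes place only
    for \<rho> between 1 - d and 1, where \<open>k\<close> has already reached 1.\<close>
  define l where "l x = step ((x - (1 - d)) / d)" for x
  have l: "smooth_on UNIV l" "\<And>x. x \<le> 1 - d \<Longrightarrow> l x = 0" "\<And>x. x \<ge> 1 \<Longrightarrow> l x = 1"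
  proof -
    show "smooth_on UNIV l"
      unfolding l_def using k(1) by (intro smooth_on_step_compose smooth_intros open_UNIV) auto
    show "l x = 0" if "x \<le> 1 - d" for x
    proof -
      have "(x - (1 - d)) / d \<le> 0" using that k(1) by (simp add: divide_nonpos_pos)
      then show ?thesis unfolding l_def by (intro step_0) linarith
    qed
    show "l x = 1" if "x \<ge> 1" for x
    proof -
      have "(x - (1 - d)) / d \<ge> 1" using that k(1) by simp
      then show ?thesis unfolding l_def by (intro step_1) linarith
    qed
  qed
  have l': "(l has_real_derivative deriv l x) (at x)" for x
    using smooth_on_deriv(2)[OF open_UNIV l(1)] by simp

  \<comment> \<open>\<open>exp (Re w)\<close> is the distance from the centre and
    \<open>Im w\<close> the angle, so \<rho> is the distance relative to \<open>g\<close>.\<close>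
  define \<rho> where "\<rho> w = exp (Re w) / g (Im w)" for w
  define \<tau> where "\<tau> w = (1 - l (\<rho> w)) * \<mu>0 (Im w) + l (\<rho> w) * \<mu>1 (Im w)" for w
  define F where "F w = cc' + (k (\<rho> w) * P (\<tau> w)) *\<^sub>R cis (\<sigma> (\<tau> w))" for w
  have ReIm: "smooth_on UNIV Re" "smooth_on UNIV Im" by (rule smooth_on_basic)+
  note comp = smooth_on_compose_UNIV[OF _ _ open_UNIV]
  have \<rho>s: "smooth_on UNIV \<rho>"
    unfolding \<rho>_def using g_pos
    by (intro smooth_on_divide comp[OF smooth_on_exp] comp[OF g(1)] ReIm open_UNIV) (auto simp: less_le)
  have \<tau>s: "smooth_on UNIV \<tau>"
    unfolding \<tau>_def
    by (intro smooth_intros comp[OF l(1)] comp[OF \<mu>0(1)] comp[OF \<mu>1(1)] ReIm \<rho>s open_UNIV)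
  have "smooth_on UNIV (\<lambda>w. Re cc' + k (\<rho> w) * P (\<tau> w) * cos (\<sigma> (\<tau> w)))"
    "smooth_on UNIV (\<lambda>w. Im cc' + k (\<rho> w) * P (\<tau> w) * sin (\<sigma> (\<tau> w)))"
    by (intro smooth_on_add smooth_on_mult smooth_on_const comp[OF k(3)] comp[OF P(1)] comp[OF smooth_on_sin_cos(1)]
        comp[OF smooth_on_sin_cos(2)] comp[OF \<sigma>(1)] \<rho>s \<tau>s open_UNIV)+
  then have Fs: "smooth_map_on UNIV F" by (simp add: smooth_map_on_complex_iff F_def)
  have F_per: "F (w + 2 * pi * \<i>) = F w" for w
  proof -
    have \<rho>p: "\<rho> (w + 2 * pi * \<i>) = \<rho> w" by (simp add: \<rho>_def g(2))
    have Imp: "Im (w + 2 * pi * \<i>) = Im w + 2 * pi" by simp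
    have \<tau>p: "\<tau> (w + 2 * pi * \<i>) = \<tau> w + 2 * pi"
      unfolding \<tau>_def \<rho>p Imp \<mu>0(2) \<mu>1(3) by (simp add: algebra_simps)
    have "cis (x + 2 * pi) = cis x" for x by (simp add: cis.ctr)
    then show ?thesis by (simp only: F_def \<rho>p \<tau>p P(3) \<sigma>(3))
  qed
  have F_D: "F w \<in> D'" for w
    using T.reach_props(2)[of "cis (\<sigma> (\<tau> w))" "k (\<rho> w) * P (\<tau> w)"] k(7,8)[of "\<rho> w"] P(2)[of "\<tau> w"]
    by (simp add: F_def P_def mult_left_le_one_le less_imp_le)
  obtain r0 where r0: "r0 > 0" "cball cc r0 \<subseteq> D" using S.int by (auto simp: mem_interior_cball)
  \<comment> \<open>A disc of radius \<open>r0\<close> about the centre lies in \<open>D\<close>, so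
    \<open>g\<close> is at least (1 - \<delta>) r0; below this threshold \<rho> is at most
    \<open>d\<close> and the profile vanishes.\<close>
  define s0 where "s0 = ln (d * ((1 - \<delta>) * r0))"
  have F_c: "F w = cc'" if "Re w \<le> s0" for w
  proof -
    have pos: "0 < d * ((1 - \<delta>) * r0)" using k(1) \<delta> r0 by simp
    have "cc + r0 *\<^sub>R cis (Im w) \<in> D" using r0 by (auto simp: dist_norm)
    then have "r0 \<le> S.rad (Im w)" using S.reach_props(2)[of "cis (Im w)" r0] r0 by simp
    then have "(1 - \<delta>) * r0 \<le> (1 - \<delta>) * S.rad (Im w)" using \<delta> by (intro mult_left_mono) auto
    then have "(1 - \<delta>) * r0 \<le> g (Im w)" using g(3)[of "Im w"] by linarith
    moreover have "exp (Re w) \<le> d * ((1 - \<delta>) * r0)"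
      using that pos unfolding s0_def by (metis exp_le_cancel_iff exp_ln)
    ultimately have "exp (Re w) \<le> d * g (Im w)"
      using k(1) by (meson mult_left_mono less_imp_le order_trans)
    then have "\<rho> w \<le> d" using g_pos[of "Im w"] by (simp add: \<rho>_def pos_divide_le_eq)
    then show ?thesis by (simp add: F_def k(5))
  qed
  have F_jac: "\<bar>jac F w\<bar> \<le> (1 + e) * (norm (exp w))\<^sup>2" for w
  proof -
    define g' where "g' = deriv g (Im w)"
    have dg: "(g has_real_derivative g') (at (Im w))"
      using smooth_on_deriv(2)[OF open_UNIV g(1)] by (simp add: g'_def)
    \<comment> \<open>\<open>B\<close> is the derivative of \<rho> in the angle, \<open>E\<close>
      that of \<tau> in the angle at fixed \<rho>, and \<open>M\<close> that of \<tau> in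
      \<rho>.\<close>
    define B where "B = - \<rho> w * g' / g (Im w)"
    define E where "E = (1 - l (\<rho> w)) * \<mu>0' (Im w) + l (\<rho> w) * deriv \<mu>1 (Im w)"
    define M where "M = deriv l (\<rho> w) * (\<mu>1 (Im w) - \<mu>0 (Im w))"
    have D\<rho>: "(\<rho> has_derivative (\<lambda>h. \<rho> w * Re h + B * Im h)) (at w)"
    proof -
      have "((\<lambda>w. g (Im w)) has_derivative (\<lambda>h. Im h * g')) (at w)"
        by (rule DERIV_compose_FDERIV[where f=g and g=Im and x=w, OF dg]) (rule bounded_linear_imp_has_derivative[OF bounded_linear_Im])
      then show ?thesis
        unfolding \<rho>_def B_def using g_pos[of "Im w"]
        by (auto intro!: derivative_eq_intros simp: field_simps power2_eq_square)
    qed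
    have D\<tau>: "(\<tau> has_derivative (\<lambda>h. M * (\<rho> w * Re h + B * Im h) + E * Im h)) (at w)"
    proof -
      have Im': "(Im has_derivative Im) (at w)" by (rule bounded_linear_imp_has_derivative[OF bounded_linear_Im])
      note dl = DERIV_compose_FDERIV[where f=l and g=\<rho> and x=w, OF l' D\<rho>]
      note d0 = DERIV_compose_FDERIV[where f=\<mu>0 and g=Im and x=w, OF \<mu>0' Im'] and d1 = DERIV_compose_FDERIV[where f=\<mu>1 and g=Im and x=w, OF \<mu>1' Im']
      show ?thesis
        unfolding \<tau>_def M_def E_def
        by (rule has_derivative_eq_rhs[OF has_derivative_add[OF has_derivative_mult[OF has_derivative_diff[OF has_derivative_const dl] d0] has_derivative_mult[OF dl d1]]])
          (auto simp: algebra_simps)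
    qed
    define p where "p t = P t * cos (\<sigma> t)" for t
    define q where "q t = P t * sin (\<sigma> t)" for t
    have P': "(P has_real_derivative deriv P t) (at t)" for t using smooth_on_deriv(2)[OF open_UNIV P(1)] by simp
    define p' where "p' t = deriv P t * cos (\<sigma> t) - P t * (sin (\<sigma> t) * \<sigma>' t)" for t
    define q' where "q' t = deriv P t * sin (\<sigma> t) + P t * (cos (\<sigma> t) * \<sigma>' t)" for t
    have dp: "(p has_real_derivative p' t) (at t)" and dq: "(q has_real_derivative q' t) (at t)" for t
      unfolding p_def q_def p'_def q'_def by (auto intro!: derivative_eq_intros P' \<sigma>'(2))
    have pq: "p t * q' t - q t * p' t = (P t)\<^sup>2 * \<sigma>' t" for t
    proof -
      have "p t * q' t - q t * p' t = (P t)\<^sup>2 * \<sigma>' t * ((cos (\<sigma> t))\<^sup>2 + (sin (\<sigma> t))\<^sup>2)"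
        unfolding p_def q_def p'_def q'_def by algebra
      then show ?thesis by simp
    qed
    note dk = DERIV_compose_FDERIV[where f=k and g=\<rho> and x=w, OF k(4) D\<rho>]
    have form: "((\<lambda>w. a + k (\<rho> w) * f (\<tau> w)) has_derivative
        (\<lambda>h. (k (\<rho> w) * f' * (M * \<rho> w) + k' (\<rho> w) * f (\<tau> w) * \<rho> w) * Re h
            + (k (\<rho> w) * f' * (M * B + E) + k' (\<rho> w) * f (\<tau> w) * B) * Im h)) (at w)"
      if "(f has_real_derivative f') (at (\<tau> w))" for f f' a
      by (rule has_derivative_eq_rhs[OF has_derivative_add[OF has_derivative_const has_derivative_mult[OF dk DERIV_compose_FDERIV[where f=f and g=\<tau> and x=w, OF that D\<tau>]]]])
        (auto simp: algebra_simps)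
    have "jac F w = (k (\<rho> w) * p' (\<tau> w) * (M * \<rho> w) + k' (\<rho> w) * p (\<tau> w) * \<rho> w)
          * (k (\<rho> w) * q' (\<tau> w) * (M * B + E) + k' (\<rho> w) * q (\<tau> w) * B)
        - (k (\<rho> w) * p' (\<tau> w) * (M * B + E) + k' (\<rho> w) * p (\<tau> w) * B)
          * (k (\<rho> w) * q' (\<tau> w) * (M * \<rho> w) + k' (\<rho> w) * q (\<tau> w) * \<rho> w)"
      using form[OF dp, of "Re cc'"] form[OF dq, of "Im cc'"]
      by (intro jac_eq) (simp_all add: F_def p_def q_def mult.assoc)
    \<comment> \<open>All terms with \<open>M\<close> and \<open>B\<close> cancel: how \<tau> varies
      with \<rho> does not affect the determinant, which is why \<tau> may be blended so
      freely.\<close>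
    also have "\<dots> = k (\<rho> w) * k' (\<rho> w) * \<rho> w * E * (p (\<tau> w) * q' (\<tau> w) - q (\<tau> w) * p' (\<tau> w))"
      by algebra
    finally have jac: "jac F w = k (\<rho> w) * k' (\<rho> w) * \<rho> w * (E * ((P (\<tau> w))\<^sup>2 * \<sigma>' (\<tau> w)))"
      by (simp add: pq mult.assoc)
    have \<rho>_pos: "\<rho> w > 0" using g_pos by (simp add: \<rho>_def)
    show ?thesis
    \<comment> \<open>In the collar the factor k' vanishes; below it \<tau> is exactly
      \<open>\<mu>0\<close>.\<close>
    proof (cases "\<rho> w \<ge> 1 - d")
      case True
      then show ?thesis using jac k(12) e by simp
    next
      case False
      then have l0: "l (\<rho> w) = 0" using l(2) by simp
      have a: "E * ((P (\<tau> w))\<^sup>2 * \<sigma>' (\<tau> w)) = (P (\<mu>0 (Im w)))\<^sup>2 * \<sigma>' (\<mu>0 (Im w)) * \<mu>0' (Im w)"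
        by (simp add: E_def \<tau>_def l0)
      define A where "A = E * ((P (\<tau> w))\<^sup>2 * \<sigma>' (\<tau> w))"
      have A: "0 \<le> A" "A \<le> c * (g (Im w))\<^sup>2" using match[of "Im w"] by (simp_all add: A_def a)
      have kk: "0 \<le> k (\<rho> w) * k' (\<rho> w) * \<rho> w" using k(7,9) \<rho>_pos by simp
      have "\<bar>jac F w\<bar> = k (\<rho> w) * k' (\<rho> w) * \<rho> w * A"
        using A(1) kk by (simp add: jac A_def)
      also have "\<dots> \<le> ((1 + \<delta>) * \<rho> w * (1 + \<delta>) * \<rho> w) * (c * (g (Im w))\<^sup>2)"
        using k(7,9,10,11) \<rho>_pos A \<delta> c(1)
        by (intro mult_mono) (auto simp: less_imp_le)
      also have "\<dots> = c * (1 + \<delta>)\<^sup>2 * (\<rho> w * g (Im w))\<^sup>2" by algebra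
      also have "\<dots> \<le> (1 + e) * (\<rho> w * g (Im w))\<^sup>2" using c_le by (intro mult_right_mono) auto
      also have "\<rho> w * g (Im w) = norm (exp w)" using g_pos[of "Im w"] by (simp add: \<rho>_def)
      finally show ?thesis .
    qed
  qed
  obtain \<Psi> where \<Psi>: "smooth_map_on UNIV \<Psi>" "\<And>w. \<Psi> (cc + exp w) = F w" "\<Psi> cc = cc'" "jac \<Psi> cc = 0"
    using polar_lift[OF Fs F_per F_c] by metis
  show ?thesis
  proof (rule that[OF \<Psi>(1)])
    have polar: "z = cc + exp (Ln (z - cc))" if "z \<noteq> cc" for z using that by simp
    show "range \<Psi> \<subseteq> D'"
    proof
      fix y assume "y \<in> range \<Psi>"
      then obtain z where z: "y = \<Psi> z" by blast
      show "y \<in> D'"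
      proof (cases "z = cc")
        case True
        then show ?thesis using z \<Psi>(3) T.int interior_subset by auto
      next
        case False
        then show ?thesis using z \<Psi>(2) F_D polar by metis
      qed
    qed
    show "\<bar>jac \<Psi> z\<bar> \<le> 1 + e" for z
    proof (cases "z = cc")
      case True
      then show ?thesis using \<Psi>(4) e by simp
    next
      case False
      define w where "w = Ln (z - cc)"
      have z: "z = cc + exp w" using polar[OF False] by (simp add: w_def)
      have "jac F w = jac \<Psi> z * (norm (exp w))\<^sup>2"
        using jac_polar[OF \<Psi>(1), of cc w] by (simp only: \<Psi>(2) z)
      then have "\<bar>jac \<Psi> z\<bar> * (norm (exp w))\<^sup>2 \<le> (1 + e) * (norm (exp w))\<^sup>2"
        using F_jac[of w] by (simp add: abs_mult)
      moreover have "0 < (norm (exp w))\<^sup>2" by simp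
      ultimately show ?thesis by (rule mult_right_le_imp_le)
    qed
    show "\<Psi> ` S.bd ` {\<theta> i..\<theta> (Suc i)} \<subseteq> T.bd ` {\<phi> i..\<phi> (Suc i)}" if i: "i < n" for i
    proof
      fix y assume "y \<in> \<Psi> ` S.bd ` {\<theta> i..\<theta> (Suc i)}"
      then obtain s where s: "\<theta> i \<le> s" "s \<le> \<theta> (Suc i)" "y = \<Psi> (S.bd s)" by auto
      define w where "w = Complex (ln (S.rad s)) s"
      have "S.bd s = cc + exp w"
        using S.rad_pos[of s] by (simp add: S.bd_def w_def exp_eq_polar scaleR_conv_of_real flip: exp_of_real)
      then have y: "y = F w" using s(3) \<Psi>(2) by simp
      \<comment> \<open>\<open>g\<close> lies below the true radius, so boundary points of
        \<open>D\<close> are in the region where the blending is complete.\<close>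
      have "\<rho> w \<ge> 1" using g(4)[of s] g_pos[of s] S.rad_pos[of s] by (simp add: \<rho>_def w_def)
      then have "k (\<rho> w) = 1" "\<tau> w = \<mu>1 s" using k(1,6) l(3) by (simp_all add: \<tau>_def w_def)
      then have y2: "y = T.bd (\<sigma> (\<mu>1 s))" by (simp add: y F_def P_def T.bd_def)
      have "\<mu>1 (\<theta> i) = \<phi> i" "\<mu>1 (\<theta> (Suc i)) = \<phi> (Suc i)"
        using \<mu>1(4) \<mu>1(5)[of i "\<theta> i"] \<mu>1(5)[of "Suc i" "\<theta> (Suc i)"] i by auto
      then have "\<phi> i \<le> \<mu>1 s" "\<mu>1 s \<le> \<phi> (Suc i)"
        using monoD[OF \<mu>1(2) s(1)] monoD[OF \<mu>1(2) s(2)] by auto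
      then have "\<phi> i \<le> \<sigma> (\<mu>1 s)" "\<sigma> (\<mu>1 s) \<le> \<phi> (Suc i)"
        using monoD[OF \<sigma>(2), of "\<phi> i" "\<mu>1 s"] monoD[OF \<sigma>(2), of "\<mu>1 s" "\<phi> (Suc i)"] \<sigma>(5)[of i] \<sigma>(5)[of "Suc i"] i by auto
      then show "y \<in> T.bd ` {\<phi> i..\<phi> (Suc i)}" using y2 by auto
    qed
  qed
qed

subsection \<open>The square, and the proof of the theorem\<close>

context convex_disc
begin

lemma Arg2pi_bd:
  assumes "s \<le> t" "t < s + 2 * pi"
  shows "Arg2pi ((bd t - cc) / (bd s - cc)) = t - s"
proof (rule Arg2pi_unique)
  have "exp (\<i> * of_real (t - s)) = cis t / cis s" unfolding cis_divide by (rule cis_conv_exp[symmetric])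
  then show "of_real (rad t / rad s) * exp (\<i> * of_real (t - s)) = (bd t - cc) / (bd s - cc)"
    by (simp add: bd_def scaleR_conv_of_real)
qed (use assms in auto)

text \<open>Cyclic order becomes linear order by lifting the angles of the marked points to one
  period starting at that of \<open>p 0\<close> and closing with the same angle plus a full turn.
  The arcs then become images of intervals.\<close>

lemma datum_angles:
  assumes N: "N \<ge> 2" and fr: "\<And>i. i < N \<Longrightarrow> p i \<in> frontier D"
    and inc: "strict_mono_on {0..<N} (\<lambda>i. Arg2pi ((p i - cc) / (p 0 - cc)))"
  obtains \<theta> where "\<And>i. i < N \<Longrightarrow> \<theta> i < \<theta> (Suc i)" "\<theta> N = \<theta> 0 + 2 * pi"
    "\<And>i. i < N \<Longrightarrow> arc D cc N p i = bd ` {\<theta> i..\<theta> (Suc i)}"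
proof -
  obtain \<alpha> where \<alpha>: "p 0 = bd \<alpha>" using frontier_bd_ex[OF fr[of 0], of 0] N by auto
  define \<theta> where "\<theta> i = (if i < N then \<alpha> + Arg2pi ((p i - cc) / (p 0 - cc)) else \<alpha> + 2 * pi)" for i
  have p: "p i = bd (\<theta> i)" "\<alpha> \<le> \<theta> i" "\<theta> i < \<alpha> + 2 * pi" if i: "i < N" for i
  proof -
    obtain t where t: "\<alpha> \<le> t" "t < \<alpha> + 2 * pi" "p i = bd t" using frontier_bd_ex[OF fr[OF i], of \<alpha>] by auto
    then have "\<theta> i = t" using Arg2pi_bd[of \<alpha> t] i \<alpha> by (simp add: \<theta>_def)
    with t show "p i = bd (\<theta> i)" "\<alpha> \<le> \<theta> i" "\<theta> i < \<alpha> + 2 * pi" by simp_all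
  qed
  have \<theta>0: "\<theta> 0 = \<alpha>" using Arg2pi_bd[of \<alpha> \<alpha>] \<alpha> N by (simp add: \<theta>_def)
  have \<theta>N: "\<theta> N = \<alpha> + 2 * pi" by (simp add: \<theta>_def)
  have \<theta>_less: "\<theta> i < \<theta> j" if "i < j" "j < N" for i j
    using strict_mono_onD[OF inc, of i j] that by (simp add: \<theta>_def)
  have \<theta>_inc: "\<theta> i < \<theta> (Suc i)" if "i < N" for i
    using \<theta>_less[of i "Suc i"] p(3)[OF that] that \<theta>N by (cases "Suc i < N") (auto simp: not_less_eq le_less_Suc_eq \<theta>_def)
  \<comment> \<open>With at least two points every arc is shorter than a full turn, so
    \<open>Arg2pi\<close> reads off its width correctly; a full turn would be read as 0.\<close>
  have gap: "\<theta> (Suc i) < \<theta> i + 2 * pi" if i: "i < N" for i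
  proof (cases "i = 0")
    case True
    then show ?thesis using p(3)[of 1] N \<theta>0 by simp
  next
    case False
    then have "\<alpha> < \<theta> i" using \<theta>_less[of 0 i] \<theta>0 i by simp
    moreover have "\<theta> (Suc i) \<le> \<alpha> + 2 * pi" using p(3)[of "Suc i"] by (cases "Suc i < N") (auto simp: \<theta>_def)
    ultimately show ?thesis by simp
  qed
  have pS: "p (Suc i mod N) = bd (\<theta> (Suc i))" if "i < N" for i
  proof (cases "Suc i < N")
    case False
    then have "Suc i = N" using that by simp
    then show ?thesis using \<alpha> \<theta>N bd_period[of \<alpha>] by simp
  qed (simp add: p)
  have "arc D cc N p i = bd ` {\<theta> i..\<theta> (Suc i)}" if i: "i < N" for i
  proof (intro set_eqI iffI)
    have A: "Arg2pi ((bd (\<theta> (Suc i)) - cc) / (bd (\<theta> i) - cc)) = \<theta> (Suc i) - \<theta> i"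
      using \<theta>_inc[OF i] gap[OF i] by (intro Arg2pi_bd) auto
    have arc: "arc D cc N p i = {z \<in> frontier D. Arg2pi ((z - cc) / (bd (\<theta> i) - cc)) \<le> \<theta> (Suc i) - \<theta> i}"
      by (simp only: arc_def ccw_arc_def pS[OF i] p(1)[OF i] A)
    fix z
    {
      assume "z \<in> arc D cc N p i"
      then have z: "z \<in> frontier D" "Arg2pi ((z - cc) / (bd (\<theta> i) - cc)) \<le> \<theta> (Suc i) - \<theta> i"
        by (simp_all add: arc)
      obtain t where t: "\<theta> i \<le> t" "t < \<theta> i + 2 * pi" "z = bd t" using frontier_bd_ex[OF z(1)] by blast
      then show "z \<in> bd ` {\<theta> i..\<theta> (Suc i)}" using z(2) Arg2pi_bd[OF t(1,2)] by auto
    }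
    assume "z \<in> bd ` {\<theta> i..\<theta> (Suc i)}"
    then obtain t where t: "\<theta> i \<le> t" "t \<le> \<theta> (Suc i)" "z = bd t" by auto
    moreover have "t < \<theta> i + 2 * pi" using t(2) gap[OF i] by simp
    ultimately show "z \<in> arc D cc N p i"
      using Arg2pi_bd[of "\<theta> i" t] bd_frontier by (simp add: arc)
  qed
  then show ?thesis using that \<theta>_inc \<theta>0 \<theta>N by metis
qed

end

lemma measure_lebesgue_eq_1: "compact D \<Longrightarrow> emeasure lborel D = 1 \<Longrightarrow> measure lebesgue D = 1"
  by (simp add: measure_def compact_imp_closed borel_closed)

lemma datumD:
  assumes "datum D cc N p" "N \<ge> 2"
  obtains \<theta> where "convex_disc D cc" "convex_disc.piecewise_smooth D cc" "measure lebesgue D = 1"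
    "\<And>i. i < N \<Longrightarrow> \<theta> i < \<theta> (Suc i)" "\<theta> N = \<theta> 0 + 2 * pi"
    "\<And>i. i < N \<Longrightarrow> arc D cc N p i = convex_disc.bd D cc ` {\<theta> i..\<theta> (Suc i)}"
proof -
  have d: "compact D" "convex D" "emeasure lborel D = 1" "smooth_boundary D \<or> polytope D" "cc \<in> interior D"
    "\<And>i. i < N \<Longrightarrow> p i \<in> frontier D" "strict_mono_on {0..<N} (\<lambda>i. Arg2pi ((p i - cc) / (p 0 - cc)))"
    using assms(1) by (simp_all add: datum_def)
  interpret convex_disc D cc by unfold_locales (rule d)+
  have "piecewise_smooth"
    using d(4) smooth_boundary_piecewise_smooth polytope_piecewise_smooth by blast
  then show ?thesis
    using datum_angles[OF assms(2) d(6,7)] that convex_disc_axioms measure_lebesgue_eq_1[OF d(1,3)] by metis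
qed

section \<open>Transfer of the infimum from one disc to another\<close>

context symplectic
begin

lemma INF_poisson_norm_transfer:
  assumes "\<And>e. e > 0 \<Longrightarrow> \<exists>\<Psi>. smooth_map_on UNIV \<Psi> \<and> \<Psi> ` D \<subseteq> D' \<and> (\<forall>i<n. \<Psi> ` \<gamma> i \<subseteq> \<gamma>' i) \<and> (\<forall>z. \<bar>jac \<Psi> z\<bar> \<le> 1 + e)"
  shows "(INF \<Phi>\<in>plane_maps T A D' n \<gamma>' X. poisson_norm T A om \<Phi>) \<le> (INF \<Phi>\<in>plane_maps T A D n \<gamma> X. poisson_norm T A om \<Phi>)"
    (is "?L \<le> _")
proof (rule INF_greatest)
  fix \<Phi> assume \<Phi>: "\<Phi> \<in> plane_maps T A D n \<gamma> X"
  have L: "?L \<le> ennreal (1 + e) * poisson_norm T A om \<Phi>" if e: "e > 0" for e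
  proof -
    obtain \<Psi> where \<Psi>: "smooth_map_on UNIV \<Psi>" "\<Psi> ` D \<subseteq> D'" "\<And>i. i < n \<Longrightarrow> \<Psi> ` \<gamma> i \<subseteq> \<gamma>' i" "\<And>z. \<bar>jac \<Psi> z\<bar> \<le> 1 + e"
      using assms[OF e] by blast
    have "?L \<le> poisson_norm T A om (\<lambda>x. \<Psi> (\<Phi> x))"
      by (rule INF_lower) (rule plane_maps_compose[OF \<Phi> \<Psi>(1-3)])
    also have "\<dots> \<le> ennreal (1 + e) * poisson_norm T A om \<Phi>"
      by (rule poisson_norm_compose[OF \<Phi> \<Psi>(1,4)])
    finally show ?thesis .
  qed
  show "?L \<le> poisson_norm T A om \<Phi>"
  proof (rule ennreal_le_epsilon)
    fix e :: real assume fin: "poisson_norm T A om \<Phi> < top" and e: "0 < e"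
    obtain r where r: "poisson_norm T A om \<Phi> = ennreal r" "r \<ge> 0"
      using fin by (cases "poisson_norm T A om \<Phi>") auto
    \<comment> \<open>Dividing by r + 1 turns the relative error into an additive one of at most
      \<open>e\<close>, including the case r = 0.\<close>
    have "?L \<le> ennreal (1 + e / (r + 1)) * ennreal r" using L[of "e / (r + 1)"] e r by simp
    also have "\<dots> = ennreal ((1 + e / (r + 1)) * r)" using e r by (simp add: ennreal_mult)
    also have "\<dots> \<le> ennreal (r + e)"
      using e r by (intro ennreal_leI) (simp add: field_simps)
    finally show "?L \<le> poisson_norm T A om \<Phi> + ennreal e" using r e by (simp add: ennreal_plus)
  qed
qed

lemma INF_poisson_norm_le:
  assumes "convex_disc D cc" "convex_disc D' cc'" "convex_disc.piecewise_smooth D' cc'"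
    "measure lebesgue D = 1" "measure lebesgue D' = 1" "n > 0"
    "\<And>i. i < n \<Longrightarrow> \<theta> i < \<theta> (Suc i)" "\<theta> n = \<theta> 0 + 2 * pi"
    "\<And>i. i < n \<Longrightarrow> \<phi> i < \<phi> (Suc i)" "\<phi> n = \<phi> 0 + 2 * pi"
    "\<And>i. i < n \<Longrightarrow> \<gamma> i = convex_disc.bd D cc ` {\<theta> i..\<theta> (Suc i)}"
    "\<And>i. i < n \<Longrightarrow> \<gamma>' i = convex_disc.bd D' cc' ` {\<phi> i..\<phi> (Suc i)}"
  shows "(INF \<Phi>\<in>plane_maps T A D' n \<gamma>' X. poisson_norm T A om \<Phi>) \<le> (INF \<Phi>\<in>plane_maps T A D n \<gamma> X. poisson_norm T A om \<Phi>)"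
proof (rule INF_poisson_norm_transfer)
  fix e :: real assume e: "e > 0"
  obtain \<Psi> where \<Psi>: "smooth_map_on UNIV \<Psi>" "range \<Psi> \<subseteq> D'"
    "\<And>i. i < n \<Longrightarrow> \<Psi> ` convex_disc.bd D cc ` {\<theta> i..\<theta> (Suc i)} \<subseteq> convex_disc.bd D' cc' ` {\<phi> i..\<phi> (Suc i)}"
    "\<And>z. \<bar>jac \<Psi> z\<bar> \<le> 1 + e"
    using area_map[OF assms(1-10) e] by blast
  have "\<forall>i<n. \<Psi> ` \<gamma> i \<subseteq> \<gamma>' i" using \<Psi>(3) assms(11,12) by auto
  moreover have "\<Psi> ` D \<subseteq> D'" using \<Psi>(2) by blast
  ultimately show "\<exists>\<Psi>. smooth_map_on UNIV \<Psi> \<and> \<Psi> ` D \<subseteq> D' \<and> (\<forall>i<n. \<Psi> ` \<gamma> i \<subseteq> \<gamma>' i) \<and> (\<forall>z. \<bar>jac \<Psi> z\<bar> \<le> 1 + e)"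
    using \<Psi>(1,4) by blast
qed

end

section \<open>The square and its right edge\<close>

definition square :: "complex set" where
  "square = cbox (Complex (-1/2) (-1/2)) (Complex (1/2) (1/2))"

lemma square_disc: "convex_disc square 0"
proof
  show "compact square" "convex square" by (simp_all add: square_def)
  show "0 \<in> interior square"
    by (simp add: square_def interior_cbox in_box_complex_iff)
qed

interpretation square: convex_disc square 0 by (rule square_disc)

lemma measure_square: "measure lebesgue square = 1"
proof (rule measure_lebesgue_eq_1[OF square.comp])
  show "emeasure lborel square = 1"
    unfolding square_def by (subst emeasure_lborel_cbox) (auto simp: Basis_complex_def inner_complex_def)
qed

lemma square_piecewise_smooth: "square.piecewise_smooth"
  by (rule square.polytope_piecewise_smooth) (simp add: square_def polytope_interval)

lemma square_edge:
  assumes "\<bar>y\<bar> \<le> 1/2" shows "Complex (1/2) y = square.bd (arctan (2 * y))"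
proof -
  define r where "r = sqrt (1 + (2 * y)\<^sup>2) / 2"
  have pos: "0 < sqrt (1 + (2 * y)\<^sup>2)" by (simp add: add_pos_nonneg)
  have z: "Complex (1/2) y = 0 + r *\<^sub>R cis (arctan (2 * y))"
    using pos by (simp add: complex_eq_iff r_def cos_arctan sin_arctan)
  have "Complex (1/2) y \<in> frontier square"
    using assms by (auto simp: square_def frontier_cbox in_box_complex_iff in_cbox_complex_iff)
  then show ?thesis
    using square.frontier_eq_bd[of r "arctan (2 * y)"] pos unfolding z by (simp add: r_def)
qed

text \<open>The right edge is taken at the end of the period that starts at the corner of angle
  \<pi>/4. It is then a single interval of angles, and its arc is the last one.\<close>

lemma square_bd_edge:
  assumes "7 * pi / 4 \<le> s" "s \<le> 9 * pi / 4"
  shows "square.bd s = Complex (1/2) (tan (s - 2 * pi) / 2)" "\<bar>tan (s - 2 * pi)\<bar> \<le> 1"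
proof -
  have rng: "- (pi / 4) \<le> s - 2 * pi" "s - 2 * pi \<le> pi / 4" using assms by auto
  have "tan (- (pi / 4)) \<le> tan (s - 2 * pi)"
    by (rule tan_mono_le) (use rng pi_gt_zero in linarith)+
  moreover have "tan (s - 2 * pi) \<le> tan (pi / 4)"
    by (rule tan_mono_le) (use rng pi_gt_zero in linarith)+
  ultimately show le: "\<bar>tan (s - 2 * pi)\<bar> \<le> 1" by (simp add: tan_45)
  have "arctan (2 * (tan (s - 2 * pi) / 2)) = s - 2 * pi"
    using arctan_tan[of "s - 2 * pi"] rng pi_gt_zero by simp
  then show "square.bd s = Complex (1/2) (tan (s - 2 * pi) / 2)"
    using square_edge[of "tan (s - 2 * pi) / 2"] le square.bd_period[of "s - 2 * pi"] by simp
qed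

lemma closed_segment_edge:
  assumes "y1 \<le> y2"
  shows "z \<in> closed_segment (Complex x y1) (Complex x y2) \<longleftrightarrow> (\<exists>y. y1 \<le> y \<and> y \<le> y2 \<and> z = Complex x y)"
proof
  assume "z \<in> closed_segment (Complex x y1) (Complex x y2)"
  then obtain u where u: "0 \<le> u" "u \<le> 1" "z = (1 - u) *\<^sub>R Complex x y1 + u *\<^sub>R Complex x y2" by (auto simp: in_segment)
  have "z = Complex x (y1 + u * (y2 - y1))" unfolding u(3) by (simp add: complex_eq_iff algebra_simps)
  moreover have "u * (y2 - y1) \<le> y2 - y1" using u assms by (simp add: mult_left_le_one_le)
  ultimately show "\<exists>y. y1 \<le> y \<and> y \<le> y2 \<and> z = Complex x y"
    using u assms by (intro exI[of _ "y1 + u * (y2 - y1)"]) auto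
next
  assume "\<exists>y. y1 \<le> y \<and> y \<le> y2 \<and> z = Complex x y"
  then obtain y where y: "y1 \<le> y" "y \<le> y2" "z = Complex x y" by blast
  show "z \<in> closed_segment (Complex x y1) (Complex x y2)"
  proof (cases "y1 = y2")
    case True
    then show ?thesis using y by simp
  next
    case False
    define u where "u = (y - y1) / (y2 - y1)"
    have "u * (y2 - y1) = y - y1" using False by (simp add: u_def)
    then have "z = (1 - u) *\<^sub>R Complex x y1 + u *\<^sub>R Complex x y2"
      by (simp add: y(3) complex_eq_iff algebra_simps)
    moreover have "0 \<le> u" "u \<le> 1" using y False by (auto simp: u_def divide_simps)
    ultimately show ?thesis by (auto simp: in_segment)
  qed
qed

theorem mainTheorem2:
  fixes T :: "'a topology" and A :: "('a,'e::euclidean_space) chart set"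
    and om :: "('a,'e) chart \<Rightarrow> 'e \<Rightarrow> 'e \<Rightarrow> 'e \<Rightarrow> real"
    and N :: nat and X :: "nat \<Rightarrow> 'a set"
    and D :: "complex set" and cc :: complex and p :: "nat \<Rightarrow> complex"
    and D' :: "complex set" and cc' :: complex and p' :: "nat \<Rightarrow> complex"
  assumes "symplectic_manifold T A om"
    and "N \<ge> 4"
    and "\<forall>i<N. compactin T (X i)"
    and "intersect_cyclically N X"
    and "datum D cc N p"
    and "datum D' cc' (N - 1) p'"
  shows "Pb T A om D cc N p X
       = Pb T A om D' cc' (N - 1) p'
            (\<lambda>i. if i = N - 2 then X (N - 2) \<union> X (N - 1) else X i)"
proof -
  interpret symplectic T A om by unfold_locales (rule assms(1))
  define n where "n = N - 1"
  have N: "N = Suc n" "n \<ge> 3" using assms(2) by (auto simp: n_def)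
  define Y where "Y i = (if i = N - 2 then X (N - 2) \<union> X (N - 1) else X i)" for i
  have Y: "Y i = X i" if "i < n - 1" for i using that N by (simp add: Y_def)
  have Y': "Y (n - 1) = X (n - 1) \<union> X n" using N by (simp add: Y_def)
  define pn where "pn = poisson_norm T A om"
  obtain \<theta> where D: "convex_disc D cc" "convex_disc.piecewise_smooth D cc" "measure lebesgue D = 1"
    and \<theta>: "\<And>i. i < N \<Longrightarrow> \<theta> i < \<theta> (Suc i)" "\<theta> N = \<theta> 0 + 2 * pi"
    "\<And>i. i < N \<Longrightarrow> arc D cc N p i = convex_disc.bd D cc ` {\<theta> i..\<theta> (Suc i)}"
    using datumD[OF assms(5)] assms(2) by auto
  obtain \<theta>' where D': "convex_disc D' cc'" "convex_disc.piecewise_smooth D' cc'" "measure lebesgue D' = 1"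
    and \<theta>': "\<And>i. i < n \<Longrightarrow> \<theta>' i < \<theta>' (Suc i)" "\<theta>' n = \<theta>' 0 + 2 * pi"
    "\<And>i. i < n \<Longrightarrow> arc D' cc' n p' i = convex_disc.bd D' cc' ` {\<theta>' i..\<theta>' (Suc i)}"
    using datumD[OF assms(6)] N by (auto simp: n_def[symmetric])
  \<comment> \<open>Marked angles on the square: the first n - 1 arcs share the other three edges
    equally, and the last two are the lower and upper half of the right edge, separated at angle 2
    \<pi>.\<close>
  define \<psi> where "\<psi> i = (if i \<le> n - 1 then pi / 4 + 3 * pi / 2 * (real i / real (n - 1))
      else if i = n then 2 * pi else 9 * pi / 4)" for i
  \<comment> \<open>The same angles without the midpoint 2 \<pi>, so that the last of the n arcs is
    the whole right edge.\<close>
  define \<xi> where "\<xi> i = (if i < n then \<psi> i else 9 * pi / 4)" for i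
  have \<psi>_vals: "\<psi> 0 = pi / 4" "\<psi> (n - 1) = 7 * pi / 4" "\<psi> n = 2 * pi" "\<psi> (Suc n) = 9 * pi / 4"
    using N by (auto simp: \<psi>_def)
  have \<psi>_low: "\<psi> i < \<psi> j" if "i < j" "j \<le> n - 1" for i j
    using that N by (simp add: \<psi>_def divide_strict_right_mono)
  have \<psi>: "\<psi> i < \<psi> (Suc i)" if i: "i < N" for i
  proof -
    consider "Suc i \<le> n - 1" | "i = n - 1" | "i = n" using i N by linarith
    then show ?thesis
    proof cases
      case 1
      then show ?thesis by (intro \<psi>_low) auto
    next
      case 2
      then have "\<psi> i = 7 * pi / 4" "\<psi> (Suc i) = 2 * pi" using N \<psi>_vals by simp_all
      then show ?thesis using pi_gt_zero by linarith
    next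
      case 3
      then have "\<psi> i = 2 * pi" "\<psi> (Suc i) = 9 * pi / 4" using \<psi>_vals by simp_all
      then show ?thesis using pi_gt_zero by linarith
    qed
  qed
  have \<xi>_vals: "\<xi> 0 = pi / 4" "\<xi> n = 9 * pi / 4" "\<And>i. i < n \<Longrightarrow> \<xi> i = \<psi> i"
    using N \<psi>_vals by (auto simp: \<xi>_def)
  have \<xi>: "\<xi> i < \<xi> (Suc i)" if "i < n" for i
  proof (cases "Suc i < n")
    case True
    then show ?thesis using \<psi>[of i] N by (simp add: \<xi>_def)
  next
    case False
    then have "i = n - 1" "Suc i = n" using that N by auto
    then have "\<xi> i = 7 * pi / 4" "\<xi> (Suc i) = 9 * pi / 4" using \<psi>_vals N by (simp_all add: \<xi>_def)
    then show ?thesis using pi_gt_zero by linarith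
  qed
  have \<psi>N: "\<psi> N = \<psi> 0 + 2 * pi" using \<psi>_vals N by simp
  have \<xi>n: "\<xi> n = \<xi> 0 + 2 * pi" using \<xi>_vals N by simp
  define \<gamma> where "\<gamma> i = square.bd ` {\<xi> i..\<xi> (Suc i)}" for i
  define \<gamma>' where "\<gamma>' i = square.bd ` {\<psi> i..\<psi> (Suc i)}" for i

  \<comment> \<open>A plane map from the square to \<open>D\<close> bounds the infimum for
    \<open>D\<close> by that for the square; piecewise smoothness of the boundary of
    \<open>D\<close> is used here.\<close>
  have "(INF \<Phi>\<in>plane_maps T A D N (arc D cc N p) X. pn \<Phi>) \<le> (INF \<Phi>\<in>plane_maps T A square N \<gamma>' X. pn \<Phi>)"
    unfolding pn_def using N
    by (intro INF_poisson_norm_le[OF square_disc D(1,2) measure_square D(3) _ \<psi> \<psi>N \<theta>(1,2)] \<theta>(3)) (auto simp: \<gamma>'_def)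
  also have "\<dots> \<le> (INF \<Phi>\<in>plane_maps T A square n \<gamma> Y. pn \<Phi>)"
  proof (rule INF_mono)
    fix \<Phi> assume \<Phi>: "\<Phi> \<in> plane_maps T A square n \<gamma> Y"
    define a where "a = Complex (1/2) (- 1/2)"
    define b where "b = Complex (1/2) (1/2)"
    have mid: "midpoint a b = Complex (1/2) 0" by (simp add: midpoint_def a_def b_def complex_eq_iff)
    have seg: "z \<in> closed_segment a b \<longleftrightarrow> (\<exists>y. - 1/2 \<le> y \<and> y \<le> 1/2 \<and> z = Complex (1/2) y)" for z
      unfolding a_def b_def by (rule closed_segment_edge) simp
    have seg_bd: "\<exists>t. 7 * pi / 4 \<le> t \<and> t \<le> 9 * pi / 4 \<and> (y \<le> 0 \<longrightarrow> t \<le> 2 * pi) \<and> (0 \<le> y \<longrightarrow> 2 * pi \<le> t) \<and> Complex (1/2) y = square.bd t"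
      if y: "- 1/2 \<le> y" "y \<le> 1/2" for y
    proof -
      have "arctan (- 1) \<le> arctan (2 * y)" "arctan (2 * y) \<le> arctan 1"
        by (rule arctan_monotone', use y in simp)+
      then have "- (pi / 4) \<le> arctan (2 * y)" "arctan (2 * y) \<le> pi / 4" by (simp_all add: arctan_one arctan_minus)
      moreover have "y \<le> 0 \<longrightarrow> arctan (2 * y) \<le> 0" "0 \<le> y \<longrightarrow> 0 \<le> arctan (2 * y)" by simp_all
      ultimately show ?thesis
        using square_edge[of y] y square.bd_period[of "arctan (2 * y)"]
        by (intro exI[of _ "arctan (2 * y) + 2 * pi"]) auto
    qed
    have bd_a: "square.bd (7 * pi / 4) = a"
    proof -
      have "tan (7 * pi / 4 - 2 * pi) = - 1" using tan_45 tan_minus[of "pi / 4"] by simp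
      then show ?thesis using square_bd_edge(1)[of "7 * pi / 4"] by (simp add: a_def)
    qed
    have bd_b: "square.bd (9 * pi / 4) = b" "square.bd (pi / 4) = b"
    proof -
      have "tan (9 * pi / 4 - 2 * pi) = 1" using tan_45 by simp
      then show "square.bd (9 * pi / 4) = b" using square_bd_edge(1)[of "9 * pi / 4"] by (simp add: b_def)
      then show "square.bd (pi / 4) = b" using square.bd_period[of "pi / 4"] by simp
    qed
    \<comment> \<open>The other three edges meet the right edge only at its two corners. By
      injectivity of the boundary parametrization on the period from \<pi>/4 this is a comparison of
      angles, in which 9 \<pi>/4 has to be read as \<pi>/4.\<close>
    have meet: "(s = 7 * pi / 4 \<and> square.bd s = a) \<or> (s = pi / 4 \<and> square.bd s = b)"
      if s: "pi / 4 \<le> s" "s \<le> 7 * pi / 4" "square.bd s \<in> closed_segment a b" for s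
    proof -
      obtain t where t: "7 * pi / 4 \<le> t" "t \<le> 9 * pi / 4" "square.bd s = square.bd t"
        using s(3) seg seg_bd by metis
      have inj: "s = u" if "square.bd s = square.bd u" "pi / 4 \<le> u" "u < pi / 4 + 2 * pi" for u
        using inj_onD[OF cis_inj_on[of "pi / 4"] square.bd_inj[OF that(1)]] s(1,2) that(2,3) pi_gt_zero by simp
      show ?thesis
      proof (cases "t = 9 * pi / 4")
        case True
        then have "square.bd s = square.bd (pi / 4)" by (simp only: t(3) bd_b)
        then have "s = pi / 4" by (rule inj) simp_all
        then show ?thesis using bd_b(2) by blast
      next
        case False
        then have "t < pi / 4 + 2 * pi" using t(2) by linarith
        moreover have "pi / 4 \<le> t" using t(1) pi_gt_zero by linarith
        ultimately have "s = t" using inj t(3) by blast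
        then have "s = 7 * pi / 4" using t(1) s(2) by linarith
        then show ?thesis using bd_a by blast
      qed
    qed
    have arcs: "pi / 4 \<le> s" "s \<le> 7 * pi / 4" "0 < i \<Longrightarrow> pi / 4 < s" "i < n - 2 \<Longrightarrow> s < 7 * pi / 4"
      if i: "i < n - 1" "\<xi> i \<le> s" "s \<le> \<xi> (Suc i)" for i s
    proof -
      have s: "\<psi> i \<le> s" "s \<le> \<psi> (Suc i)" using i \<xi>_vals(3) by simp_all
      show "pi / 4 \<le> s" "0 < i \<Longrightarrow> pi / 4 < s"
        using s(1) \<psi>_low[of 0 i] i(1) \<psi>_vals(1) by (cases "i = 0"; simp)+
      have "\<psi> (Suc i) \<le> \<psi> (n - 1)" "i < n - 2 \<Longrightarrow> \<psi> (Suc i) < \<psi> (n - 1)"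
        using \<psi>_low[of "Suc i" "n - 1"] i(1) by (cases "Suc i = n - 1"; simp)+
      then show "s \<le> 7 * pi / 4" "i < n - 2 \<Longrightarrow> s < 7 * pi / 4"
        using s(2) unfolding \<psi>_vals(2) by linarith+
    qed
    have last: "\<gamma> (n - 1) = square.bd ` {7 * pi / 4..9 * pi / 4}"
      "\<gamma>' (n - 1) = square.bd ` {7 * pi / 4..2 * pi}" "\<gamma>' n = square.bd ` {2 * pi..9 * pi / 4}"
    proof -
      have n1: "n - 1 < n" "Suc (n - 1) = n" using N by simp_all
      show "\<gamma> (n - 1) = square.bd ` {7 * pi / 4..9 * pi / 4}"
        "\<gamma>' (n - 1) = square.bd ` {7 * pi / 4..2 * pi}" "\<gamma>' n = square.bd ` {2 * pi..9 * pi / 4}"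
        by (simp_all only: \<gamma>_def \<gamma>'_def n1 \<xi>_vals \<psi>_vals)
    qed
    have "\<exists>\<Phi>'\<in>plane_maps T A square (Suc n) \<gamma>' X. poisson_norm T A om \<Phi>' \<le> poisson_norm T A om \<Phi>"
    proof (rule split_arc[OF \<Phi> N(2) _ _ _ Y Y' square.conv])
      show "compactin T (X i)" if "i \<le> n" for i using assms(3) that N by simp
      show "X (n - 1) \<inter> X 0 = {}" "X n \<inter> X (n - 2) = {}"
      proof -
        have disj: "X i \<inter> X j = {}" if "i < N" "j < N" "i \<noteq> j" "i \<noteq> Suc j mod N" "j \<noteq> Suc i mod N" for i j
          using assms(4) that unfolding intersect_cyclically_def by blast
        have "Suc (n - 1) mod N = n" "Suc (n - 2) mod N = n - 1" "Suc 0 mod N = 1" "Suc n mod N = 0" using N by simp_all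
        then show "X (n - 1) \<inter> X 0 = {}" "X n \<inter> X (n - 2) = {}"
          using N by (intro disj; simp)+
      qed
      show "a \<in> square" "b \<in> square" "a \<noteq> b"
        by (auto simp: a_def b_def square_def in_cbox_complex_iff)
      show "\<gamma> (n - 1) \<subseteq> closed_segment a b"
      proof
        fix z assume "z \<in> \<gamma> (n - 1)"
        then obtain s where s: "7 * pi / 4 \<le> s" "s \<le> 9 * pi / 4" "z = square.bd s"
          unfolding last by auto
        show "z \<in> closed_segment a b"
          unfolding seg using square_bd_edge[OF s(1,2)] s(3)
          by (intro exI[of _ "tan (s - 2 * pi) / 2"]) (auto simp: abs_le_iff)
      qed
      show "\<gamma> 0 \<inter> closed_segment a b \<subseteq> {b}"
        using meet arcs(1,2,4)[of 0] N by (fastforce simp: \<gamma>_def)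
      show "\<gamma> (n - 2) \<inter> closed_segment a b \<subseteq> {a}"
        using meet arcs(1-3)[of "n - 2"] N by (fastforce simp: \<gamma>_def)
      show "\<gamma> i \<inter> closed_segment a b = {}" if "0 < i" "i < n - 2" for i
        using meet arcs[of i] that N by (fastforce simp: \<gamma>_def)
      show "\<gamma>' i = \<gamma> i" if "i < n - 1" for i using that by (simp add: \<gamma>_def \<gamma>'_def \<xi>_def)
      show "closed_segment a (midpoint a b) \<subseteq> \<gamma>' (n - 1)"
      proof
        fix z assume "z \<in> closed_segment a (midpoint a b)"
        then have "z \<in> closed_segment a (Complex (1/2) 0)" by (simp only: mid)
        then obtain y where "- 1/2 \<le> y" "y \<le> 0" "z = Complex (1/2) y"
          unfolding a_def using closed_segment_edge[of "- 1/2" 0 z "1/2"] by auto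
        then show "z \<in> \<gamma>' (n - 1)" unfolding last using seg_bd[of y] by auto
      qed
      show "closed_segment (midpoint a b) b \<subseteq> \<gamma>' n"
      proof
        fix z assume "z \<in> closed_segment (midpoint a b) b"
        then have "z \<in> closed_segment (Complex (1/2) 0) b" by (simp only: mid)
        then obtain y where "0 \<le> y" "y \<le> 1/2" "z = Complex (1/2) y"
          unfolding b_def using closed_segment_edge[of 0 "1/2" z "1/2"] by auto
        then show "z \<in> \<gamma>' n" unfolding last using seg_bd[of y] by auto
      qed
    qed
    then show "\<exists>\<Phi>'\<in>plane_maps T A square N \<gamma>' X. pn \<Phi>' \<le> pn \<Phi>" by (simp add: N pn_def)
  qed
  also have "\<dots> \<le> (INF \<Phi>\<in>plane_maps T A D' n (arc D' cc' n p') Y. pn \<Phi>)"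
    unfolding pn_def using N
    by (intro INF_poisson_norm_le[OF D'(1) square_disc square_piecewise_smooth D'(3) measure_square _ \<theta>'(1,2) \<xi> \<xi>n] \<theta>'(3)) (auto simp: \<gamma>_def)
  finally have le: "(INF \<Phi>\<in>plane_maps T A D N (arc D cc N p) X. pn \<Phi>) \<le> (INF \<Phi>\<in>plane_maps T A D' n (arc D' cc' n p') Y. pn \<Phi>)" .

  \<comment> \<open>The angles of the first datum with the last marked point removed: the last arc
    now runs from angle \<theta> (n - 1) to the end of the period.\<close>
  define \<theta>m where "\<theta>m i = (if i < n then \<theta> i else \<theta> N)" for i
  define \<gamma>m where "\<gamma>m i = convex_disc.bd D cc ` {\<theta>m i..\<theta>m (Suc i)}" for i
  have \<theta>m: "\<theta>m i < \<theta>m (Suc i)" if "i < n" for i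
    using \<theta>(1)[of i] \<theta>(1)[of n] that N by (cases "Suc i = n") (auto simp: \<theta>m_def)
  have \<theta>mn: "\<theta>m n = \<theta>m 0 + 2 * pi" using \<theta>(2) N by (simp add: \<theta>m_def)
  have "(INF \<Phi>\<in>plane_maps T A D' n (arc D' cc' n p') Y. pn \<Phi>) \<le> (INF \<Phi>\<in>plane_maps T A D n \<gamma>m Y. pn \<Phi>)"
    unfolding pn_def using N
    by (intro INF_poisson_norm_le[OF D(1) D'(1,2) D(3) D'(3) _ \<theta>m \<theta>mn \<theta>'(1,2)] \<theta>'(3)) (auto simp: \<gamma>m_def)
  also have "\<dots> \<le> (INF \<Phi>\<in>plane_maps T A D N (arc D cc N p) X. pn \<Phi>)"
  proof (rule INF_superset_mono)
    \<comment> \<open>Both of the last two arcs lie in the merged one, so the union of the two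
      neighbourhoods is a neighbourhood for the union of the two sets.\<close>
    show "plane_maps T A D N (arc D cc N p) X \<subseteq> plane_maps T A D n \<gamma>m Y"
    proof
      fix \<Phi> assume \<Phi>: "\<Phi> \<in> plane_maps T A D N (arc D cc N p) X"
      have nbhd: "\<exists>U. openin T U \<and> X i \<subseteq> U \<and> \<Phi> ` U \<subseteq> arc D cc N p i" if "i < N" for i
        using \<Phi> that by (simp add: plane_maps_def)
      have "\<exists>U. openin T U \<and> Y i \<subseteq> U \<and> \<Phi> ` U \<subseteq> \<gamma>m i" if i: "i < n" for i
      proof (cases "i = n - 1")
        case False
        then have lt: "i < n - 1" "i < n" "Suc i < n" "i < N" using i N by auto
        have "\<gamma>m i = arc D cc N p i" using lt(2,3) by (simp add: \<gamma>m_def \<theta>m_def \<theta>(3)[OF lt(4)])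
        then show ?thesis using nbhd[OF lt(4)] Y[OF lt(1)] by simp
      next
        case True
        have lt: "n - 1 < N" "n < N" "n - 1 < n" and S: "Suc (n - 1) = n" "Suc n = N" using N by auto
        obtain U V where U: "openin T U" "X (n - 1) \<subseteq> U" "\<Phi> ` U \<subseteq> arc D cc N p (n - 1)"
          and V: "openin T V" "X n \<subseteq> V" "\<Phi> ` V \<subseteq> arc D cc N p n"
          using nbhd[OF lt(1)] nbhd[OF lt(2)] by blast
        have "\<theta> (n - 1) < \<theta> n" "\<theta> n < \<theta> N" using \<theta>(1)[OF lt(1)] \<theta>(1)[OF lt(2)] by (simp_all only: S)
        moreover have "\<gamma>m i = convex_disc.bd D cc ` {\<theta> (n - 1)..\<theta> N}"
          using lt(3) by (simp only: \<gamma>m_def \<theta>m_def True S if_True less_irrefl if_False)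
        moreover have "arc D cc N p (n - 1) = convex_disc.bd D cc ` {\<theta> (n - 1)..\<theta> n}"
          "arc D cc N p n = convex_disc.bd D cc ` {\<theta> n..\<theta> N}"
          using \<theta>(3)[OF lt(1)] \<theta>(3)[OF lt(2)] by (simp_all only: S)
        ultimately have "arc D cc N p (n - 1) \<subseteq> \<gamma>m i" "arc D cc N p n \<subseteq> \<gamma>m i"
          by (auto intro!: image_mono)
        then show ?thesis using U V True Y' by (intro exI[of _ "U \<union> V"]) auto
      qed
      then show "\<Phi> \<in> plane_maps T A D n \<gamma>m Y" using \<Phi> by (simp add: plane_maps_def)
    qed
  qed simp
  finally have "(INF \<Phi>\<in>plane_maps T A D' n (arc D' cc' n p') Y. pn \<Phi>) \<le> (INF \<Phi>\<in>plane_maps T A D N (arc D cc N p) X. pn \<Phi>)" .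
  with le show ?thesis
    unfolding Pb_eq_poisson_norm by (simp add: pn_def n_def Y_def[abs_def])
qed

end
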